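(* Let $d\ge2$, $n\ge1$, $k\ge1$, let $G=G(d,1,n)$ and let $c$ be a fixed Coxeter element of $G$. For partitions $\lambda^{(1)},\dots,\lambda^{(k)}$ (each of size at most $n$, possibly empty) let $a^{(d)}_{\lambda^{(1)},\ldots,\lambda^{(k)}}$ be the number of $k$-tuples $(u_1,\dots,u_k)\in G^k$ with $u_1\cdots u_k=c$ such that $u_i$ has weight-$0$ cycle type $\lambda^{(i)}$ for each $i$. Then \[ \sum_{\lambda^{(1)},\ldots,\lambda^{(k)}}a^{(d)}_{\lambda^{(1)},\ldots,\lambda^{(k)}}\prod_{i=1}^kp_{\lambda^{(i)}}\big(1,\underbrace{y^{(i)}_1,\ldots,y^{(i)}_1}_{d},\underbrace{y^{(i)}_2,\ldots,y^{(i)}_2}_{d},\ldots\big) =|G|^{k-1}\sum_{\mu^{(1)},\ldots,\mu^{(k)}}\frac{M^{n-1}_{q_1-1,\ldots,q_k-1}}{\prod_{i=1}^k\binom{n-1}{q_i-1}}\,m_{\mu^{(1)}}(\mathbf y_1)\cdots m_{\mu^{(k)}}(\mathbf y_k), \] where the sum on the right is over $k$-tuples of partitions $\mu^{(i)}$ of size at most $n$ that are not all of size $n$, and $q_j=\ell(\mu^{(j)})$ if $|\mu^{(j)}|=n$ and $q_j=\ell(\mu^{(j)})+1$ otherwise.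
   Context: Elements of $G(d,1,n)$ ($n\times n$ monomial matrices with $d$-th roots of unity as nonzero entries; $|G|=d^nn!$) are written $[\pi;a]$, $\pi\in\mathfrak S_n$, $a\in(\mathbb Z/d\mathbb Z)^n$, with product $[\pi;a][\sigma;b]=[\pi\sigma;\sigma(a)+b]$, $\sigma(a)=(a_{\sigma(1)},\dots,a_{\sigma(n)})$. Cycles of $[\pi;a]$ are cycles of $\pi$; the weight of a cycle is the sum of the $a_i$ over its entries, in $\mathbb Z/d\mathbb Z$. The weight-$0$ cycle type of $u$ is the partition formed by the lengths of its weight-$0$ cycles. A Coxeter element is a regular element (one with an eigenvector on no reflecting hyperplane) of order $h$, the largest regular integer; e.g. $[(1\,2\cdots n);(0,\dots,0,1)]$. $\mathbf y_i=(y^{(i)}_1,y^{(i)}_2,\dots)$ are $k$ sets of variables; $p_\lambda$ are power sum and $m_\mu$ monomial symmetric functions ($p_\varnothing=m_\varnothing=1$); $\ell(\lambda)$ is the number of parts. $M^n_{p_1,\ldots,p_k}:=[x_1^{p_1}\cdots x_k^{p_k}]\big(\prod_i(1+x_i)-\prod_ix_i\big)^n$ (zero if some index is negative). *)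

theory Defs
  imports
    "Jordan_Normal_Form.Char_Poly"
    "Jordan_Normal_Form.Matrix_Kernel"
    "HOL-Algebra.Multiplicative_Group"
    "HOL-Combinatorics.Orbits"
    "HOL-Combinatorics.Permutations"
    "HOL-Library.Multiset"
    "HOL-Library.Poly_Mapping"
    "HOL-Library.Groups_Big_Fun"
begin

section \<open>Formal power series in arbitrarily many variables\<close>

text \<open>
  Symmetric functions live in the ring of formal power series in infinitely many variables.
  A monomial is a finitely supported exponent function on the set of variables, and a series
  is an arbitrary function from monomials to coefficients.
\<close>

typedef ('v, 'a) mseries = "UNIV :: (('v \<Rightarrow>\<^sub>0 nat) \<Rightarrow> 'a) set"
  morphisms coeff_ms Abs_mseries by simp

setup_lifting type_definition_mseries

lemma mseries_eqI: "(\<And>m. coeff_ms f m = coeff_ms g m) \<Longrightarrow> f = g"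
  by transfer blast

lemma finite_monomials_below:
  "finite {p :: 'v \<Rightarrow>\<^sub>0 nat. \<forall>v. Poly_Mapping.lookup p v \<le> Poly_Mapping.lookup m v}"
proof -
  let ?K = "Poly_Mapping.keys m"
  let ?B = "Max (insert 0 (Poly_Mapping.lookup m ` ?K))"
  let ?F = "{f :: 'v \<Rightarrow> nat. \<forall>v. (v \<in> ?K \<longrightarrow> f v \<in> {..?B}) \<and> (v \<notin> ?K \<longrightarrow> f v = 0)}"
  have fin: "finite ?F" by (rule finite_set_of_finite_funs) simp_all
  have "Poly_Mapping.lookup ` {p :: 'v \<Rightarrow>\<^sub>0 nat. \<forall>v. Poly_Mapping.lookup p v \<le> Poly_Mapping.lookup m v} \<subseteq> ?F"
  proof (intro subsetI CollectI allI conjI impI; elim imageE CollectE; hypsubst)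
    fix v p assume "\<forall>v. Poly_Mapping.lookup p v \<le> Poly_Mapping.lookup m v" "v \<in> ?K"
    moreover from \<open>v \<in> ?K\<close> have "Poly_Mapping.lookup m v \<le> ?B" by (intro Max_ge) auto
    ultimately show "Poly_Mapping.lookup p v \<in> {..?B}" by (meson atMost_iff order_trans)
  next
    fix v p assume "\<forall>v. Poly_Mapping.lookup p v \<le> Poly_Mapping.lookup m v" "v \<notin> ?K"
    thus "Poly_Mapping.lookup p v = 0" by (metis in_keys_iff le_zero_eq)
  qed
  hence "finite (Poly_Mapping.lookup ` {p :: 'v \<Rightarrow>\<^sub>0 nat. \<forall>v. Poly_Mapping.lookup p v \<le> Poly_Mapping.lookup m v})"
    using fin finite_subset by blast
  thus ?thesis
    by (rule finite_imageD) (auto intro!: inj_onI poly_mapping_eqI)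
qed

lemma finite_splittings: "finite {(p, q :: 'v \<Rightarrow>\<^sub>0 nat). p + q = m}"
proof (rule finite_subset)
  let ?S = "{p :: 'v \<Rightarrow>\<^sub>0 nat. \<forall>v. Poly_Mapping.lookup p v \<le> Poly_Mapping.lookup m v}"
  show "{(p, q :: 'v \<Rightarrow>\<^sub>0 nat). p + q = m} \<subseteq> ?S \<times> ?S" by (auto simp: lookup_add)
  show "finite (?S \<times> ?S)" using finite_monomials_below by blast
qed

instantiation mseries :: (type, comm_ring_1) comm_ring_1
begin

lift_definition zero_mseries :: "('a, 'b) mseries" is "\<lambda>_. 0" .
lift_definition one_mseries :: "('a, 'b) mseries" is "\<lambda>m. if m = 0 then 1 else 0" .
lift_definition plus_mseries :: "('a, 'b) mseries \<Rightarrow> ('a, 'b) mseries \<Rightarrow> ('a, 'b) mseries"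
  is "\<lambda>f g m. f m + g m" .
lift_definition minus_mseries :: "('a, 'b) mseries \<Rightarrow> ('a, 'b) mseries \<Rightarrow> ('a, 'b) mseries"
  is "\<lambda>f g m. f m - g m" .
lift_definition uminus_mseries :: "('a, 'b) mseries \<Rightarrow> ('a, 'b) mseries"
  is "\<lambda>f m. - f m" .
lift_definition times_mseries :: "('a, 'b) mseries \<Rightarrow> ('a, 'b) mseries \<Rightarrow> ('a, 'b) mseries"
  is "\<lambda>f g m. \<Sum>(p, q) \<in> {(p, q). p + q = m}. f p * g q" .

instance
proof
  fix a b c :: "('a, 'b) mseries"
  show "a + b + c = a + (b + c)" by transfer (simp add: add.assoc)
  show "a + b = b + a" by transfer (simp add: add.commute)
  show "0 + a = a" by transfer simp
  show "- a + a = 0" by transfer simp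
  show "a - b = a + - b" by transfer simp
  show "(0 :: ('a, 'b) mseries) \<noteq> 1" by transfer (metis zero_neq_one)
  show "(a + b) * c = a * c + b * c"
    by transfer (simp add: distrib_right sum.distrib split_def)
  show "a * b = b * a"
  proof (transfer, rule ext)
    fix f g :: "('a \<Rightarrow>\<^sub>0 nat) \<Rightarrow> 'b" and m
    show "(\<Sum>(p, q) \<in> {(p, q). p + q = m}. f p * g q) = (\<Sum>(p, q) \<in> {(p, q). p + q = m}. g p * f q)"
      by (rule sum.reindex_bij_witness[of _ "\<lambda>(p, q). (q, p)" "\<lambda>(p, q). (q, p)"])
        (auto simp: ac_simps)
  qed
  show "1 * a = a"
  proof (transfer, rule ext)
    fix f :: "('a \<Rightarrow>\<^sub>0 nat) \<Rightarrow> 'b" and m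
    have "(\<Sum>(p, q) \<in> {(p, q). p + q = m}. (if p = 0 then 1 else 0) * f q)
        = (\<Sum>(p, q) \<in> {(0 :: 'a \<Rightarrow>\<^sub>0 nat, m)}. (if p = 0 then 1 else 0) * f q)"
      by (rule sum.mono_neutral_right) (auto simp: finite_splittings split: if_splits)
    thus "(\<Sum>(p, q) \<in> {(p, q). p + q = m}. (if p = 0 then 1 else 0) * f q) = f m" by simp
  qed
  show "a * b * c = a * (b * c)"
  proof (transfer, rule ext)
    fix f g h :: "('a \<Rightarrow>\<^sub>0 nat) \<Rightarrow> 'b" and m
    let ?S = "\<lambda>m :: 'a \<Rightarrow>\<^sub>0 nat. {(p, q). p + q = m}"
    have "(\<Sum>(p, q) \<in> ?S m. (\<Sum>(r, s) \<in> ?S p. f r * g s) * h q)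
        = (\<Sum>x \<in> ?S m. \<Sum>y \<in> ?S (fst x). f (fst y) * g (snd y) * h (snd x))"
      by (simp add: split_def sum_distrib_right)
    also have "\<dots> = (\<Sum>(x, y) \<in> Sigma (?S m) (\<lambda>x. ?S (fst x)). f (fst y) * g (snd y) * h (snd x))"
      by (rule sum.Sigma) (auto simp: finite_splittings)
    also have "\<dots> = (\<Sum>(x, y) \<in> Sigma (?S m) (\<lambda>x. ?S (snd x)). f (fst x) * (g (fst y) * h (snd y)))"
      by (rule sum.reindex_bij_witness[of _
            "\<lambda>(x, y). ((fst x + fst y, snd y), (fst x, fst y))"
            "\<lambda>(x, y). ((fst y, snd y + snd x), (snd y, snd x))"]) (auto simp: ac_simps)
    also have "\<dots> = (\<Sum>x \<in> ?S m. \<Sum>y \<in> ?S (snd x). f (fst x) * (g (fst y) * h (snd y)))"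
      by (rule sum.Sigma[symmetric]) (auto simp: finite_splittings)
    also have "\<dots> = (\<Sum>(p, q) \<in> ?S m. f p * (\<Sum>(r, s) \<in> ?S q. g r * h s))"
      by (simp add: split_def sum_distrib_left)
    finally show "(\<Sum>(p, q) \<in> ?S m. (\<Sum>(r, s) \<in> ?S p. f r * g s) * h q)
        = (\<Sum>(p, q) \<in> ?S m. f p * (\<Sum>(r, s) \<in> ?S q. g r * h s))" .
  qed
qed

end

lift_definition const_ms :: "'a \<Rightarrow> ('v, 'a :: zero) mseries"
  is "\<lambda>c m. if m = 0 then c else 0" .

lift_definition var_ms :: "'v \<Rightarrow> ('v, 'a :: zero_neq_one) mseries"
  is "\<lambda>v m. if m = Poly_Mapping.single v 1 then 1 else 0" .

text \<open>
  Coefficientwise sum of a family of series. It is the intended infinite sum whenever each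
  monomial has nonzero coefficient in only finitely many members of the family.
\<close>

lift_definition sum_ms :: "('i \<Rightarrow> ('v, 'a :: comm_monoid_add) mseries) \<Rightarrow> ('v, 'a) mseries"
  is "\<lambda>F m. Sum_any (\<lambda>i. F i m)" .


section \<open>Partitions and symmetric functions\<close>

text \<open>A partition is the multiset of its (positive) parts.\<close>

definition partitions_upto :: "nat \<Rightarrow> nat multiset set" where
  "partitions_upto n = {\<mu>. 0 \<notin># \<mu> \<and> sum_mset \<mu> \<le> n}"

lemma finite_partitions_upto: "finite (partitions_upto n)"
proof (rule finite_subset)
  show "partitions_upto n \<subseteq> (\<Union>l\<le>n. {\<mu>. set_mset \<mu> \<subseteq> {..n} \<and> size \<mu> = l})"
  proof
    fix \<mu> assume \<mu>: "\<mu> \<in> partitions_upto n"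
    have "size \<mu> \<le> sum_mset \<mu>" if "0 \<notin># \<mu>" for \<mu> :: "nat multiset"
      using that by (induction \<mu>) auto
    moreover have "x \<le> sum_mset \<mu>" if "x \<in># \<mu>" for x
      using that by (metis le_add1 multi_member_split sum_mset.add_mset)
    ultimately show "\<mu> \<in> (\<Union>l\<le>n. {\<mu>. set_mset \<mu> \<subseteq> {..n} \<and> size \<mu> = l})"
      using \<mu> by (force simp: partitions_upto_def intro: order_trans)
  qed
  show "finite (\<Union>l\<le>n. {\<mu> :: nat multiset. set_mset \<mu> \<subseteq> {..n} \<and> size \<mu> = l})"
    by (intro finite_UN_I finite_multisets_of_size[unfolded multisets_of_size_def]) auto
qed

text \<open>
  Symmetric functions are evaluated at a sequence \<open>z\<close> of series: the variables themselves, or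
  series substituted for them.
\<close>

definition power_sum :: "nat \<Rightarrow> (nat \<Rightarrow> ('v, 'a :: comm_ring_1) mseries) \<Rightarrow> ('v, 'a) mseries" where
  "power_sum r z = sum_ms (\<lambda>j. z j ^ r)"

definition power_sum_part :: "nat multiset \<Rightarrow> (nat \<Rightarrow> ('v, 'a :: comm_ring_1) mseries) \<Rightarrow> ('v, 'a) mseries" where
  "power_sum_part lam z = (\<Prod>r \<in># lam. power_sum r z)"

definition exponent_type :: "(nat \<Rightarrow>\<^sub>0 nat) \<Rightarrow> nat multiset" where
  "exponent_type \<alpha> = image_mset (Poly_Mapping.lookup \<alpha>) (mset_set (Poly_Mapping.keys \<alpha>))"

definition monomial_sym :: "nat multiset \<Rightarrow> (nat \<Rightarrow> ('v, 'a :: comm_ring_1) mseries) \<Rightarrow> ('v, 'a) mseries" where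
  "monomial_sym \<mu> z = sum_ms (\<lambda>\<alpha>. if exponent_type \<alpha> = \<mu>
     then \<Prod>j \<in> Poly_Mapping.keys \<alpha>. z j ^ Poly_Mapping.lookup \<alpha> j else 0)"

text \<open>The pair \<open>(i, j)\<close> indexes the \<open>j\<close>-th variable of the \<open>i\<close>-th set of variables, both counted from \<open>0\<close>.\<close>

definition yvars :: "nat \<Rightarrow> nat \<Rightarrow> (nat \<times> nat, rat) mseries" where
  "yvars i j = var_ms (i, j)"

text \<open>The sequence consisting of \<open>1\<close> followed by each variable of the \<open>i\<close>-th set repeated \<open>d\<close> times.\<close>

definition one_then_copies :: "nat \<Rightarrow> nat \<Rightarrow> nat \<Rightarrow> (nat \<times> nat, rat) mseries" where
  "one_then_copies d i j = (case j of 0 \<Rightarrow> 1 | Suc j' \<Rightarrow> yvars i (j' div d))"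


section \<open>The group $G(d,1,n)$ and its Coxeter elements\<close>

text \<open>
  Coordinates are indexed by \<open>{..<n}\<close>, and $\mathbb{Z}/d\mathbb{Z}$ is represented by residues
  below \<open>d\<close>. Outside the index range the exponent vector is \<open>0\<close>, so that elements have a unique
  representation.
\<close>

type_synonym gelem = "(nat \<Rightarrow> nat) \<times> (nat \<Rightarrow> nat)"

definition Gd1n :: "nat \<Rightarrow> nat \<Rightarrow> gelem monoid" where
  "Gd1n d n =
    \<lparr> carrier = {(\<pi>, a). \<pi> permutes {..<n} \<and> (\<forall>i<n. a i < d) \<and> (\<forall>i\<ge>n. a i = 0)},
      mult = (\<lambda>(\<pi>, a) (\<sigma>, b). (\<pi> \<circ> \<sigma>, \<lambda>i. (a (\<sigma> i) + b i) mod d)),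
      one = (id, \<lambda>_. 0) \<rparr>"

lemma group_Gd1n:
  assumes "d \<ge> 1"
  shows "group (Gd1n d n)"
proof (rule groupI)
  fix x y assume "x \<in> carrier (Gd1n d n)" "y \<in> carrier (Gd1n d n)"
  thus "x \<otimes>\<^bsub>Gd1n d n\<^esub> y \<in> carrier (Gd1n d n)"
    using assms by (auto simp: Gd1n_def permutes_compose permutes_not_in)
next
  show "\<one>\<^bsub>Gd1n d n\<^esub> \<in> carrier (Gd1n d n)"
    using assms by (auto simp: Gd1n_def permutes_id)
next
  fix x y z
  show "x \<otimes>\<^bsub>Gd1n d n\<^esub> y \<otimes>\<^bsub>Gd1n d n\<^esub> z = x \<otimes>\<^bsub>Gd1n d n\<^esub> (y \<otimes>\<^bsub>Gd1n d n\<^esub> z)"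
    by (auto simp: Gd1n_def split_def fun_eq_iff mod_simps ac_simps)
next
  fix x assume "x \<in> carrier (Gd1n d n)"
  thus "\<one>\<^bsub>Gd1n d n\<^esub> \<otimes>\<^bsub>Gd1n d n\<^esub> x = x"
    using assms by (auto simp: Gd1n_def fun_eq_iff) (metis mod_less mod_0 not_le)
next
  fix x assume x: "x \<in> carrier (Gd1n d n)"
  then obtain p a where pa: "x = (p, a)" "p permutes {..<n}" "\<forall>i<n. a i < d" "\<forall>i\<ge>n. a i = 0"
    by (auto simp: Gd1n_def)
  let ?y = "(inv_into UNIV p, \<lambda>i. (d - a (inv_into UNIV p i)) mod d)"
  have le: "a i \<le> d" for i using pa by (metis less_imp_le_nat not_le zero_le)
  have "?y \<in> carrier (Gd1n d n)"
    using assms pa permutes_inv[OF pa(2)] permutes_not_in[OF permutes_inv[OF pa(2)]]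
    by (auto simp: Gd1n_def)
  moreover have "?y \<otimes>\<^bsub>Gd1n d n\<^esub> x = \<one>\<^bsub>Gd1n d n\<^esub>"
    using pa le permutes_inv_o[OF pa(2)] permutes_inverses[OF pa(2)]
    by (auto simp: Gd1n_def fun_eq_iff mod_simps)
  ultimately show "\<exists>y \<in> carrier (Gd1n d n). y \<otimes>\<^bsub>Gd1n d n\<^esub> x = \<one>\<^bsub>Gd1n d n\<^esub>" by blast
qed

lemma finite_carrier_Gd1n: "finite (carrier (Gd1n d n))"
proof (rule finite_subset)
  let ?A = "{a :: nat \<Rightarrow> nat. \<forall>i. (i \<in> {..<n} \<longrightarrow> a i \<in> {..<d}) \<and> (i \<notin> {..<n} \<longrightarrow> a i = 0)}"
  show "carrier (Gd1n d n) \<subseteq> {p. p permutes {..<n}} \<times> ?A" by (auto simp: Gd1n_def)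
  have "finite ?A" by (rule finite_set_of_finite_funs) simp_all
  thus "finite ({p. p permutes {..<n}} \<times> ?A)" by (simp add: finite_permutations)
qed

text \<open>The monomial matrix of $[\pi;a]$ sends $e_i$ to $\zeta^{a_i} e_{\pi(i)}$ with $\zeta = e^{2\pi \mathrm{i}/d}$.\<close>

definition gmat :: "nat \<Rightarrow> nat \<Rightarrow> gelem \<Rightarrow> complex mat" where
  "gmat d n g = mat n n (\<lambda>(r, s). if r = fst g s then cis (2 * pi / real d) ^ snd g s else 0)"

definition fixed_space :: "nat \<Rightarrow> nat \<Rightarrow> gelem \<Rightarrow> complex vec set" where
  "fixed_space d n g = mat_kernel (gmat d n g - 1\<^sub>m n)"

definition is_reflection :: "nat \<Rightarrow> nat \<Rightarrow> gelem \<Rightarrow> bool" where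
  "is_reflection d n g \<longleftrightarrow> g \<in> carrier (Gd1n d n) \<and> kernel_dim (gmat d n g - 1\<^sub>m n) + 1 = n"

definition regular_element :: "nat \<Rightarrow> nat \<Rightarrow> gelem \<Rightarrow> bool" where
  "regular_element d n g \<longleftrightarrow> g \<in> carrier (Gd1n d n) \<and>
     (\<exists>v z. eigenvector (gmat d n g) v z \<and> (\<forall>t. is_reflection d n t \<longrightarrow> v \<notin> fixed_space d n t))"

definition regular_integers :: "nat \<Rightarrow> nat \<Rightarrow> nat set" where
  "regular_integers d n = {group.ord (Gd1n d n) g | g. regular_element d n g}"

definition coxeter_element :: "nat \<Rightarrow> nat \<Rightarrow> gelem \<Rightarrow> bool" where
  "coxeter_element d n c \<longleftrightarrow>
     regular_element d n c \<and> group.ord (Gd1n d n) c = Max (regular_integers d n)"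

lemma finite_regular_integers: "finite (regular_integers d n)"
proof -
  have "regular_integers d n \<subseteq> group.ord (Gd1n d n) ` carrier (Gd1n d n)"
    by (auto simp: regular_integers_def regular_element_def)
  thus ?thesis using finite_carrier_Gd1n finite_subset by blast
qed


section \<open>Weight-zero cycle types and factorizations\<close>

definition cycle_weight :: "nat \<Rightarrow> gelem \<Rightarrow> nat set \<Rightarrow> nat" where
  "cycle_weight d g C = (\<Sum>i\<in>C. snd g i) mod d"

text \<open>Cycles, fixed points included, are represented by their underlying sets.\<close>

definition weight0_cycle_type :: "nat \<Rightarrow> nat \<Rightarrow> gelem \<Rightarrow> nat multiset" where
  "weight0_cycle_type d n g =
     image_mset card (mset_set {C \<in> orbit (fst g) ` {..<n}. cycle_weight d g C = 0})"

definition num_factorizations :: "nat \<Rightarrow> nat \<Rightarrow> gelem \<Rightarrow> nat multiset list \<Rightarrow> nat" where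
  "num_factorizations d n c lams =
     card {us. length us = length lams \<and> set us \<subseteq> carrier (Gd1n d n) \<and>
               foldr (mult (Gd1n d n)) us (one (Gd1n d n)) = c \<and>
               (\<forall>i < length lams. weight0_cycle_type d n (us ! i) = lams ! i)}"


section \<open>The coefficients $M$ and the indices $q$\<close>

definition xvar :: "nat \<Rightarrow> ((nat \<Rightarrow>\<^sub>0 nat) \<Rightarrow>\<^sub>0 int)" where
  "xvar i = Poly_Mapping.single (Poly_Mapping.single i 1) 1"

text \<open>The number $k$ of variables is the length of the list of indices.\<close>

definition Mcoeff :: "nat \<Rightarrow> int list \<Rightarrow> int" where
  "Mcoeff n ps = (let k = length ps in
     if \<exists>p \<in> set ps. p < 0 then 0
     else Poly_Mapping.lookup (((\<Prod>i<k. 1 + xvar i) - (\<Prod>i<k. xvar i)) ^ n)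
            (\<Sum>i<k. Poly_Mapping.single i (nat (ps ! i))))"

definition qindex :: "nat \<Rightarrow> nat multiset \<Rightarrow> nat" where
  "qindex n \<mu> = (if sum_mset \<mu> = n then size \<mu> else size \<mu> + 1)"

end

theory Submission
  imports Defs "HOL-Number_Theory.Cong"
begin

text \<open>
  Compare coefficients of a monomial. On the left, the coefficient counts tuples of factors
  \<open>u\<^sub>i = [\<pi>\<^sub>i; a\<^sub>i]\<close> of \<open>c\<close> together with words fixed by \<open>\<pi>\<^sub>i\<close>, where a cycle of nonzero colour must have
  weight \<open>0\<close> and then counts \<open>d\<close> times. Summing over the exponent vectors \<open>a\<^sub>i\<close> removes the weight
  condition, a position of colour \<open>0\<close> makes the total weight equidistributed, and all elements
  with a single cycle and a given weight are conjugate. This reduces the count to factorizations of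
  long cycles in the symmetric group, where each factor fixes a word of given content.

  There, the indicator function of the long cycles is an alternating sum, over hook shapes, of
  coefficients of Young symmetrizers (a cycle avoiding a given point can be moved between the row
  and the column group, which changes the sign). By von Neumann's lemma, convolving the coefficient
  function of a symmetrizer with a class function multiplies it by a scalar. For the number of fixed
  words of content \<open>A\<close>, with \<open>l\<close> different colours, and the hook with leg \<open>r\<close> the scalar is
  \<open>n! (l - 1 choose r) / (n - 1 choose r)\<close>. The
  resulting alternating sum over \<open>r\<close> is the binomial expansion of the coefficient \<open>M\<close>.

  If all words avoid colour \<open>0\<close>, all factors have weight \<open>0\<close>, but \<open>c\<close> does not. A Coxeter element is
  a single cycle because its eigenvector lies on no hyperplane \<open>v\<^sub>y = \<zeta>\<^sup>e v\<^sub>x\<close>.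
\<close>

section \<open>Single cycles and hook-shaped Young symmetrizers\<close>

text \<open>Behind the elementary manipulations stands the Frobenius formula. Only hook characters
  are nonzero on a long cycle (Murnaghan-Nakayama), and for hooks everything is explicit because row
  and column meet in the single corner \<open>p\<close>. A class function acts on an irreducible
  representation of dimension D by n!/D times the multiplicity of its character. For the hook with
  leg r the dimension is (n - 1 choose r), and its multiplicity in the permutation character on
  words with l colours is the Kostka number (l - 1 choose r); this is the origin of the scalar. The
  obstacle is that \<open>c\<close> is one element of G, while these tools see class functions on
  the symmetric group. The target function is therefore a parameter of every convolution sum: it is
  averaged over the class of \<open>c\<close>, then summed over all total weights, until it depends
  on the permutation part alone. Coxeter elements are defined by maximal order, so an explicit
  regular element of order at least nd has to be exhibited; this bound is what forces a cycle of
  \<open>c\<close> to have length n.\<close>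

abbreviation pinv :: "('a \<Rightarrow> 'a) \<Rightarrow> 'a \<Rightarrow> 'a" where
  "pinv \<equiv> inv_into UNIV"

text \<open>Transitivity is stated through invariant subsets: in this form it passes to the set with
  a point cut out and to minimal invariant blocks, and its failure directly yields a smaller
  invariant block.\<close>

definition single_cycle :: "'a set \<Rightarrow> ('a \<Rightarrow> 'a) \<Rightarrow> bool" where
  "single_cycle V g \<longleftrightarrow>
     V \<noteq> {} \<and> g permutes V \<and> (\<forall>A\<subseteq>V. A \<noteq> {} \<longrightarrow> g ` A \<subseteq> A \<longrightarrow> A = V)"

lemma permutes_image_subset_eq:
  assumes "finite A" "g permutes V" "g ` A \<subseteq> A"
  shows "g ` A = A"
  using assms by (metis card_image card_subset_eq permutes_inj_on)

text \<open>Composing with the transposition of \<open>x\<close> and \<open>g x\<close> splits off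
  \<open>x\<close> as a fixed point, which drives an induction. The sign is paired with
  \<open>(-1) ^ card V\<close> because the alternating sum over columns produces exactly this
  product.\<close>

lemma sign_single_cycle:
  assumes "finite V" "single_cycle V g"
  shows "sign g * (-1) ^ card V = -1"
  using assms
proof (induction "card V" arbitrary: V g rule: less_induct)
  case less
  from less.prems have g: "g permutes V" and ne: "V \<noteq> {}"
    and min: "\<And>A. A \<subseteq> V \<Longrightarrow> A \<noteq> {} \<Longrightarrow> g ` A \<subseteq> A \<Longrightarrow> A = V"
    by (auto simp: single_cycle_def)
  from ne obtain x where x: "x \<in> V" by blast
  show ?case
  proof (cases "g x = x")
    case True
    hence "V = {x}" using min[of "{x}"] x by auto
    thus ?thesis using g by simp
  next
    case False
    define y where "y = g x"
    define h where "h = transpose x y \<circ> g"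
    have y: "y \<in> V" "y \<noteq> x" using x g False by (auto simp: y_def permutes_in_image)
    have hV: "h permutes V" unfolding h_def
      using permutes_compose[OF g permutes_swap_id[OF x y(1)]] .
    have hx: "h x = x" by (simp add: h_def y_def)
    have hW: "h permutes (V - {x})" by (rule permutes_superset[OF hV]) (use hx in auto)
    have "single_cycle (V - {x}) h" unfolding single_cycle_def
    proof (intro conjI allI impI hW)
      show "V - {x} \<noteq> {}" using y by blast
      fix A assume A: "A \<subseteq> V - {x}" "A \<noteq> {}" "h ` A \<subseteq> A"
      have finA: "finite A" using A less.prems finite_subset by blast
      have hA: "h ` A = A" using permutes_image_subset_eq[OF finA hV A(3)] .
      have g_h: "g z = transpose x y (h z)" for z by (simp add: h_def)
      show "A = V - {x}"
      \<comment> \<open>If \<open>y\<close> lies in \<open>A\<close>, putting \<open>x\<close> back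
        makes the set invariant under \<open>g\<close>; otherwise \<open>g\<close> and
        \<open>h\<close> agree on \<open>A\<close>.\<close>
      proof (cases "y \<in> A")
        case True
        have "g ` insert x A \<subseteq> insert x A"
          using True A hx by (auto simp: g_h transpose_def image_subset_iff)
        hence "insert x A = V" using min[of "insert x A"] A x by blast
        thus ?thesis using A by blast
      next
        case False
        have "g ` A \<subseteq> A"
        proof
          fix w assume "w \<in> g ` A"
          then obtain z where z: "z \<in> A" "w = g z" by blast
          have "h z \<in> A" using z A by blast
          moreover have "h z \<noteq> x" "h z \<noteq> y" using \<open>h z \<in> A\<close> False A by auto
          ultimately show "w \<in> A" using z by (simp add: g_h)
        qed
        hence "A = V" using min[of A] A by blast
        thus ?thesis using A x by blast
      qed
    qed
    moreover have c: "card (V - {x}) < card V" "card V = Suc (card (V - {x}))"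
      using card_Diff1_less[OF less.prems(1) x] card.remove[OF less.prems(1) x] by simp_all
    ultimately have "sign h * (-1) ^ card (V - {x}) = -1"
      using less.hyps[of "V - {x}" h] less.prems(1) by simp
    moreover have "sign h = - sign g"
      unfolding h_def using y permutes_imp_permutation[OF less.prems(1) g]
      by (simp add: sign_compose permutation_swap_id sign_swap_id)
    ultimately show ?thesis by (simp add: c(2))
  qed
qed

section \<open>Young symmetrizers of hook shape\<close>

definition hook_factorizations ::
    "'a set \<Rightarrow> 'a \<Rightarrow> 'a set \<Rightarrow> ('a \<Rightarrow> 'a) \<Rightarrow> (('a \<Rightarrow> 'a) \<times> ('a \<Rightarrow> 'a)) set" where
  "hook_factorizations V p C g =
     {(\<rho>, \<gamma>). \<rho> permutes insert p (V - C) \<and> \<gamma> permutes C \<and> \<rho> \<circ> \<gamma> = g}"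

text \<open>The coefficient at \<open>g\<close> of the Young symmetrizer for the hook tableau with
  corner \<open>p\<close>, first column \<open>C\<close> and first row
  \<open>insert p (V - C)\<close>, hence with leg length \<open>card C - 1\<close>. The sum has at
  most one term; writing it as a sum covers the case of no factorization.\<close>

definition hook_coeff :: "'a set \<Rightarrow> 'a \<Rightarrow> 'a set \<Rightarrow> ('a \<Rightarrow> 'a) \<Rightarrow> rat" where
  "hook_coeff V p C g = (\<Sum>(\<rho>, \<gamma>) \<in> hook_factorizations V p C g. of_int (sign \<gamma>))"

context
  fixes V C :: "'a set" and p :: 'a
  assumes finV: "finite V" and CV: "C \<subseteq> V" and pC: "p \<in> C"
begin

lemma finite_column: "finite C" using finV CV finite_subset by blast

lemma row_subset: "insert p (V - C) \<subseteq> V" using CV pC by blast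

text \<open>The row and the column share only the corner \<open>p\<close>, so row group and column
  group intersect trivially.\<close>

lemma hook_factorization_unique:
  assumes "(\<rho>, \<gamma>) \<in> hook_factorizations V p C g" "(\<rho>', \<gamma>') \<in> hook_factorizations V p C g"
  shows "\<rho>' = \<rho> \<and> \<gamma>' = \<gamma>"
proof -
  have a: "\<rho> permutes insert p (V - C)" "\<gamma> permutes C" "\<rho> \<circ> \<gamma> = g"
    "\<rho>' permutes insert p (V - C)" "\<gamma>' permutes C" "\<rho>' \<circ> \<gamma>' = g"
    using assms by (auto simp: hook_factorizations_def)
  have eq: "\<rho> (\<gamma> x) = \<rho>' (\<gamma>' x)" for x using a by (metis comp_apply)
  have "\<gamma> x = \<gamma>' x" if "\<gamma> x \<noteq> p" "\<gamma>' x \<noteq> p" for x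
  proof (cases "x \<in> C")
    case True
    hence "\<gamma> x \<in> C - {p}" "\<gamma>' x \<in> C - {p}" using a that by (auto simp: permutes_in_image)
    hence "\<rho> (\<gamma> x) = \<gamma> x" "\<rho>' (\<gamma>' x) = \<gamma>' x" using a permutes_not_in[of \<rho>] permutes_not_in[of \<rho>'] by auto
    thus ?thesis using eq by metis
  next
    case False thus ?thesis using a permutes_not_in[of \<gamma> C] permutes_not_in[of \<gamma>' C] by simp
  qed note E = this
  \<comment> \<open>It remains to see that both column factors send the same point to
    \<open>p\<close>. Otherwise \<open>\<rho> p\<close> would be a point of \<open>C - {p}\<close>,
    although \<open>\<rho>\<close> keeps \<open>p\<close> in the row.\<close>
  define x where "x = pinv \<gamma> p"
  have x: "\<gamma> x = p" using permutes_inverses(1)[OF a(2)] by (simp add: x_def)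
  have "\<gamma>' x = p"
  proof (rule ccontr)
    assume np: "\<gamma>' x \<noteq> p"
    have xC: "x \<in> C" using permutes_in_image[OF a(2), of x] x pC by simp
    define z where "z = \<gamma>' x"
    have z: "z \<in> C" "z \<noteq> p" using np xC permutes_in_image[OF a(5)] by (auto simp: z_def)
    have "\<rho>' z = z" using z permutes_not_in[OF a(4)] by auto
    hence "\<rho> p = z" using eq[of x] x by (simp add: z_def)
    moreover have "\<rho> p \<in> insert p (V - C)" using permutes_in_image[OF a(1)] by simp
    ultimately show False using z by auto
  qed
  hence "\<gamma> y = \<gamma>' y" for y
    using E[of y] x permutes_inj[OF a(2)] permutes_inj[OF a(5)] by (metis injD)
  hence g: "\<gamma> = \<gamma>'" by blast
  have "\<rho> y = \<rho>' y" for y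
    using eq[of "pinv \<gamma> y"] g permutes_inverses(1)[OF a(2)] by simp
  thus ?thesis using g by auto
qed

text \<open>von Neumann's lemma for hook shapes.\<close>

lemma hook_factorization_exists:
  assumes u: "u permutes V"
    and inj: "\<And>x y. x \<in> C \<Longrightarrow> y \<in> C \<Longrightarrow> u x \<notin> C - {p} \<Longrightarrow> u y \<notin> C - {p} \<Longrightarrow> x = y"
  shows "\<exists>\<rho> \<gamma>. (\<rho>, \<gamma>) \<in> hook_factorizations V p C u"
proof -
  have cuC: "card (u ` C) = card C" using u by (simp add: card_image permutes_inj_on)
  \<comment> \<open>By counting, exactly one point \<open>x\<close> of \<open>C\<close> is mapped
    out of \<open>C - {p}\<close>, and the images of the others fill \<open>C - {p}\<close>. A row
    transposition brings \<open>u x\<close> to \<open>p\<close>; after that \<open>C\<close> is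
    invariant and the permutation splits into a part on \<open>C\<close> and a part on
    \<open>V - C\<close>.\<close>
  have "\<not> u ` C \<subseteq> C - {p}"
  proof
    assume "u ` C \<subseteq> C - {p}"
    hence "card (u ` C) \<le> card (C - {p})" using finite_column by (intro card_mono) auto
    moreover have "card (C - {p}) < card C" using finite_column pC by (intro psubset_card_mono) auto
    ultimately show False using cuC by simp
  qed
  then obtain x where x: "x \<in> C" "u x \<notin> C - {p}" by blast
  have sub: "u ` (C - {x}) \<subseteq> C - {p}" using inj x by blast
  have "card (u ` (C - {x})) = card (C - {p})"
    using x pC u by (simp add: card_image permutes_inj_on)
  hence eq: "u ` (C - {x}) = C - {p}" using sub finite_column by (intro card_subset_eq) auto
  define q where "q = u x"
  have qR: "q \<in> insert p (V - C)" using x u CV by (auto simp: q_def permutes_in_image)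
  define \<tau> where "\<tau> = transpose p q"
  define w where "w = \<tau> \<circ> u"
  have \<tau>: "\<tau> permutes insert p (V - C)" unfolding \<tau>_def by (rule permutes_swap_id) (use qR in auto)
  have \<tau>V: "\<tau> permutes V" using permutes_subset[OF \<tau> row_subset] .
  have wV: "w permutes V" unfolding w_def by (rule permutes_compose[OF u \<tau>V])
  have wC: "w ` C \<subseteq> C"
  proof
    fix z assume "z \<in> w ` C"
    then obtain y where y: "y \<in> C" "z = \<tau> (u y)" by (auto simp: w_def)
    show "z \<in> C"
    proof (cases "y = x")
      case True thus ?thesis using y pC by (simp add: \<tau>_def q_def)
    next
      case False
      hence "u y \<in> C - {p}" using y eq by blast
      moreover have "u y \<noteq> q" using calculation qR by auto
      ultimately show ?thesis using y by (auto simp: \<tau>_def)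
    qed
  qed
  have wC': "w ` C = C" using permutes_image_subset_eq[OF finite_column wV wC] .
  have wD': "w ` (V - C) = V - C"
    using wC' permutes_image[OF wV] permutes_inj[OF wV] by (simp add: image_set_diff)
  have bC: "bij_betw w C C" and bD: "bij_betw w (V - C) (V - C)"
    using wC' wD' permutes_inj_on[OF wV] by (auto simp: bij_betw_def)
  define \<gamma> where "\<gamma> = restrict_id w C"
  define \<sigma> where "\<sigma> = restrict_id w (V - C)"
  have \<gamma>: "\<gamma> permutes C" unfolding \<gamma>_def by (rule permutes_restrict_id[OF bC])
  have "\<sigma> permutes (V - C)" unfolding \<sigma>_def by (rule permutes_restrict_id[OF bD])
  hence \<sigma>: "\<sigma> permutes insert p (V - C)" by (rule permutes_subset) auto
  have ws: "w z = \<sigma> (\<gamma> z)" for z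
  proof -
    consider "z \<in> C" | "z \<in> V - C" | "z \<notin> V" by blast
    thus ?thesis
    proof cases
      case 1 thus ?thesis using wC by (auto simp: \<gamma>_def \<sigma>_def restrict_id_def)
    next
      case 2 thus ?thesis by (auto simp: \<gamma>_def \<sigma>_def restrict_id_def)
    next
      case 3 thus ?thesis using wV CV by (auto simp: \<gamma>_def \<sigma>_def restrict_id_def permutes_not_in)
    qed
  qed
  have "u = (\<tau> \<circ> \<sigma>) \<circ> \<gamma>"
  proof
    fix z
    have "(\<tau> \<circ> \<sigma> \<circ> \<gamma>) z = \<tau> (w z)" by (simp add: ws)
    thus "u z = (\<tau> \<circ> \<sigma> \<circ> \<gamma>) z" by (simp add: w_def \<tau>_def)
  qed
  thus ?thesis unfolding hook_factorizations_def
    using \<gamma> permutes_compose[OF \<sigma> \<tau>] by blast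
qed

lemma hook_coeff_unique:
  assumes "(\<rho>, \<gamma>) \<in> hook_factorizations V p C g"
  shows "hook_coeff V p C g = of_int (sign \<gamma>)"
proof -
  have "hook_factorizations V p C g = {(\<rho>, \<gamma>)}"
  proof (intro equalityI subsetI)
    fix x assume x: "x \<in> hook_factorizations V p C g"
    show "x \<in> {(\<rho>, \<gamma>)}"
      using x hook_factorization_unique[OF assms, of "fst x" "snd x"] by (cases x) simp
  qed (use assms in simp)
  thus ?thesis by (simp add: hook_coeff_def)
qed

lemma hook_coeff_eq_0: "hook_factorizations V p C g = {} \<Longrightarrow> hook_coeff V p C g = 0"
  by (simp add: hook_coeff_def)

lemma permutation_column: "\<gamma> permutes C \<Longrightarrow> permutation \<gamma>"
  using finite_column permutes_imp_permutation by blast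

text \<open>Composing with \<open>\<rho>\<close> on the left and \<open>\<gamma>\<close> on the
  right carries the factorizations of \<open>g\<close> bijectively to those of the product, and only
  the column factor changes its sign, by that of \<open>\<gamma>\<close>.\<close>

lemma hook_coeff_equivariant:
  assumes \<rho>: "\<rho> permutes insert p (V - C)" and \<gamma>: "\<gamma> permutes C"
  shows "hook_coeff V p C (\<rho> \<circ> g \<circ> \<gamma>) = of_int (sign \<gamma>) * hook_coeff V p C g"
proof -
  note inv_simps = permutes_inv_o[OF \<rho>] permutes_inv_o[OF \<gamma>]
  have s: "sign (\<gamma>'' \<circ> \<gamma>) = sign \<gamma> * sign \<gamma>''" if "\<gamma>'' permutes C" for \<gamma>''
    using sign_compose[OF permutation_column[OF that] permutation_column[OF \<gamma>]] by simp
  have "hook_coeff V p C (\<rho> \<circ> g \<circ> \<gamma>)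
      = (\<Sum>(\<rho>', \<gamma>') \<in> hook_factorizations V p C g. of_int (sign (\<gamma>' \<circ> \<gamma>)))"
    unfolding hook_coeff_def
  proof (rule sum.reindex_bij_witness[of _ "\<lambda>(\<rho>', \<gamma>'). (\<rho> \<circ> \<rho>', \<gamma>' \<circ> \<gamma>)"
        "\<lambda>(\<rho>', \<gamma>'). (pinv \<rho> \<circ> \<rho>', \<gamma>' \<circ> pinv \<gamma>)"], goal_cases)
    case (1 a)
    obtain r c where a: "a = (r, c)" by (cases a)
    have "\<rho> \<circ> (pinv \<rho> \<circ> r) = r" unfolding o_assoc inv_simps by simp
    moreover have "c \<circ> pinv \<gamma> \<circ> \<gamma> = c" unfolding comp_assoc inv_simps by simp
    ultimately show ?case using a by simp
  next
    case (2 a)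
    then obtain r c where a: "a = (r, c)" "r permutes insert p (V - C)" "c permutes C" "r \<circ> c = \<rho> \<circ> g \<circ> \<gamma>"
      by (auto simp: hook_factorizations_def)
    have "(pinv \<rho> \<circ> r) \<circ> (c \<circ> pinv \<gamma>) = pinv \<rho> \<circ> (r \<circ> c) \<circ> pinv \<gamma>" by (simp add: o_assoc)
    also have "\<dots> = (pinv \<rho> \<circ> \<rho>) \<circ> g \<circ> (\<gamma> \<circ> pinv \<gamma>)" unfolding a(4) by (simp add: o_assoc)
    also have "\<dots> = g" by (simp add: inv_simps)
    finally show ?case using a \<rho> \<gamma> by (auto simp: hook_factorizations_def intro!: permutes_compose permutes_inv)
  next
    case (3 a)
    obtain r c where a: "a = (r, c)" by (cases a)
    have "pinv \<rho> \<circ> (\<rho> \<circ> r) = r" unfolding o_assoc inv_simps by simp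
    moreover have "c \<circ> \<gamma> \<circ> pinv \<gamma> = c" unfolding comp_assoc inv_simps by simp
    ultimately show ?case using a by simp
  next
    case (4 a) 
    then obtain r c where a: "a = (r, c)" "r permutes insert p (V - C)" "c permutes C" "r \<circ> c = g"
      by (auto simp: hook_factorizations_def)
    thus ?case using \<rho> \<gamma> by (auto simp: hook_factorizations_def o_assoc intro!: permutes_compose)
  next
    case (5 a)
    then obtain r c where a: "a = (r, c)" by (cases a)
    have "c \<circ> pinv \<gamma> \<circ> \<gamma> = c" unfolding comp_assoc inv_simps by simp
    thus ?case using a by simp
  qed
  also have "\<dots> = (\<Sum>(\<rho>', \<gamma>') \<in> hook_factorizations V p C g. of_int (sign \<gamma>) * of_int (sign \<gamma>'))"
    by (rule sum.cong) (auto simp: s hook_factorizations_def)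
  finally show ?thesis by (simp add: hook_coeff_def sum_distrib_left split_def)
qed

lemma hook_coeff_id: "hook_coeff V p C id = 1"
  using hook_coeff_unique[of id id id] by (simp add: hook_factorizations_def)

lemma sum_permutations_reindex:
  assumes "\<sigma> permutes V" "\<tau> permutes V"
  shows "(\<Sum>v | v permutes V. f (\<sigma> \<circ> v \<circ> \<tau>)) = (\<Sum>v | v permutes V. f v)"
proof -
  have i: "pinv \<sigma> \<circ> \<sigma> = id" "\<sigma> \<circ> pinv \<sigma> = id" "pinv \<tau> \<circ> \<tau> = id" "\<tau> \<circ> pinv \<tau> = id"
    using assms permutes_inv_o by auto
  have 1: "pinv \<sigma> \<circ> (\<sigma> \<circ> v \<circ> \<tau>) \<circ> pinv \<tau> = v" for v
    using i by (simp add: fun_eq_iff)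
  have 2: "\<sigma> \<circ> (pinv \<sigma> \<circ> v \<circ> pinv \<tau>) \<circ> \<tau> = v" for v
    using i by (simp add: fun_eq_iff)
  show ?thesis
    by (rule sum.reindex_bij_witness[of _ "\<lambda>v. pinv \<sigma> \<circ> v \<circ> pinv \<tau>" "\<lambda>v. \<sigma> \<circ> v \<circ> \<tau>"])
      (use assms in \<open>auto simp only: 1 2 mem_Collect_eq intro!: permutes_compose permutes_inv\<close>)
qed

text \<open>Summing a class function against \<open>hook_coeff\<close> gives a function that is invariant on the
  left under the row group and alternating on the right under the column group; by von Neumann's
  lemma such a function is a multiple of \<open>hook_coeff\<close>.\<close>

lemma class_sum_hook_coeff:
  assumes h: "\<And>x g. x permutes V \<Longrightarrow> g permutes V \<Longrightarrow> h (x \<circ> g \<circ> pinv x) = h g"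
    and u: "u permutes V"
  shows "(\<Sum>v | v permutes V. h v * hook_coeff V p C (u \<circ> v))
       = hook_coeff V p C u * (\<Sum>v | v permutes V. h v * hook_coeff V p C v)"
proof -
  define F where "F u = (\<Sum>v | v permutes V. h v * hook_coeff V p C (u \<circ> v))" for u
  have F: "F (\<rho> \<circ> w \<circ> \<gamma>) = of_int (sign \<gamma>) * F w"
    if \<rho>: "\<rho> permutes insert p (V - C)" and \<gamma>: "\<gamma> permutes C" and w: "w permutes V" for \<rho> \<gamma> w
  proof -
    have \<gamma>V: "\<gamma> permutes V" using permutes_subset[OF \<gamma> CV] .
    have iV: "pinv \<gamma> permutes V" by (rule permutes_inv[OF \<gamma>V])
    \<comment> \<open>Replacing \<open>v\<close> by a conjugate leaves the class function unchanged
      and moves \<open>\<gamma>\<close> past \<open>v\<close> to the right end, where equivariance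
      applies.\<close>
    have "F (\<rho> \<circ> w \<circ> \<gamma>) = (\<Sum>v | v permutes V. h (pinv \<gamma> \<circ> v \<circ> \<gamma>) * hook_coeff V p C (\<rho> \<circ> w \<circ> \<gamma> \<circ> (pinv \<gamma> \<circ> v \<circ> \<gamma>)))"
      unfolding F_def by (subst sum_permutations_reindex[OF iV \<gamma>V, symmetric]) simp
    also have "\<dots> = (\<Sum>v | v permutes V. h v * (of_int (sign \<gamma>) * hook_coeff V p C (w \<circ> v)))"
    proof (rule sum.cong[OF refl])
      fix v assume "v \<in> {v. v permutes V}"
      hence v: "v permutes V" by simp
      have 1: "h (pinv \<gamma> \<circ> v \<circ> \<gamma>) = h v"
        using h[OF iV v] permutes_inv_inv[OF \<gamma>V] by simp
      have "\<rho> \<circ> w \<circ> \<gamma> \<circ> (pinv \<gamma> \<circ> v \<circ> \<gamma>) = \<rho> \<circ> w \<circ> (\<gamma> \<circ> pinv \<gamma>) \<circ> v \<circ> \<gamma>" by (simp add: o_assoc)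
      also have "\<dots> = \<rho> \<circ> (w \<circ> v) \<circ> \<gamma>" using permutes_inv_o[OF \<gamma>V] by (simp add: o_assoc)
      finally show "h (pinv \<gamma> \<circ> v \<circ> \<gamma>) * hook_coeff V p C (\<rho> \<circ> w \<circ> \<gamma> \<circ> (pinv \<gamma> \<circ> v \<circ> \<gamma>))
          = h v * (of_int (sign \<gamma>) * hook_coeff V p C (w \<circ> v))"
        using 1 hook_coeff_equivariant[OF \<rho> \<gamma>, of "w \<circ> v"] by simp
    qed
    also have "\<dots> = of_int (sign \<gamma>) * F w"
      by (simp add: F_def sum_distrib_left mult_ac)
    finally show ?thesis .
  qed
  have "F u = hook_coeff V p C u * F id"
  proof (cases "hook_factorizations V p C u = {}")
    case False
    then obtain \<rho> \<gamma> where rg: "(\<rho>, \<gamma>) \<in> hook_factorizations V p C u" by auto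
    hence "u = \<rho> \<circ> id \<circ> \<gamma>" "\<rho> permutes insert p (V - C)" "\<gamma> permutes C"
      by (auto simp: hook_factorizations_def)
    hence "F u = of_int (sign \<gamma>) * F id" using F[of \<rho> \<gamma> id] by simp
    thus ?thesis using hook_coeff_unique[OF rg] by simp
  next
    case True
    then obtain x y where xy: "x \<in> C" "y \<in> C" "u x \<notin> C - {p}" "u y \<notin> C - {p}" "x \<noteq> y"
      using hook_factorization_exists[OF u] by blast
    \<comment> \<open>Two column points are sent into the row. Swapping them before \<open>u\<close>
      is the same as swapping their images after \<open>u\<close>, so equivariance gives
      \<open>F u = - F u\<close>.\<close>
    let ?t = "transpose x y" and ?s = "transpose (u x) (u y)"
    have uxy: "u x \<in> insert p (V - C)" "u y \<in> insert p (V - C)"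
      using xy u CV by (auto simp: permutes_in_image)
    have s: "?s permutes insert p (V - C)" by (rule permutes_swap_id[OF uxy])
    have t: "?t permutes C" by (rule permutes_swap_id[OF xy(1,2)])
    have "?s \<circ> u = u \<circ> ?t"
      using permutes_inj[OF u] by (auto simp: fun_eq_iff transpose_def inj_def)
    hence "?s \<circ> u \<circ> ?t = u" by (simp add: comp_assoc)
    hence "F u = - F u" using F[OF s t u] xy(5) by (simp add: sign_swap_id)
    thus ?thesis using True by (simp add: hook_coeff_eq_0)
  qed
  thus ?thesis by (simp add: F_def)
qed

end

section \<open>The alternating sum of hook coefficients over all columns\<close>

lemma single_cycle_minimal:
  "single_cycle V g \<Longrightarrow> A \<subseteq> V \<Longrightarrow> A \<noteq> {} \<Longrightarrow> g ` A \<subseteq> A \<Longrightarrow> A = V"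
  by (simp add: single_cycle_def)

text \<open>The orbit of \<open>p\<close> is a nonempty invariant set, hence all of
  \<open>V\<close>.\<close>

lemma single_cycle_enum:
  assumes V: "finite V" and g: "single_cycle V g" and p: "p \<in> V"
  shows "bij_betw (\<lambda>i. (g ^^ i) p) {..<card V} V" and "(g ^^ card V) p = p"
proof -
  have gV: "g permutes V" using g by (simp add: single_cycle_def)
  have self: "p \<in> orbit g p"
    using permutation_self_in_orbit permutes_imp_permutation[OF V gV] by metis
  have sub: "orbit g p \<subseteq> V" using permutes_orbit_subset[OF gV p] .
  have orb: "orbit g p = V"
    by (rule single_cycle_minimal[OF g sub]) (use self in \<open>auto intro: orbit.intros\<close>)
  define m where "m = funpow_dist1 g p p"
  have im: "(\<lambda>i. (g ^^ i) p) ` {0..<m} = V"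
    using orbit_conv_funpow_dist1[OF self] orb by (simp add: m_def)
  have inj: "inj_on (\<lambda>i. (g ^^ i) p) {0..<m}"
    unfolding m_def by (rule inj_on_funpow_dist1[OF self])
  have m: "m = card V" using card_image[OF inj] im by simp
  show "bij_betw (\<lambda>i. (g ^^ i) p) {..<card V} V"
    using inj im by (simp add: bij_betw_def m lessThan_atLeast0)
  show "(g ^^ card V) p = p" using funpow_dist1_prop[OF self] by (simp add: m_def[symmetric] m)
qed

lemma single_cycle_restrict_minimal:
  assumes g: "g permutes V" and V: "finite V" and D: "D \<subseteq> V" "D \<noteq> {}" "g ` D \<subseteq> D"
    and min: "\<And>A. A \<subseteq> D \<Longrightarrow> A \<noteq> {} \<Longrightarrow> g ` A \<subseteq> A \<Longrightarrow> A = D"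
  shows "single_cycle D (restrict_id g D)"
proof -
  have fin: "finite D" using V D finite_subset by blast
  have "bij_betw g D D"
    using permutes_image_subset_eq[OF fin g D(3)] permutes_inj_on[OF g] by (simp add: bij_betw_def)
  moreover have "restrict_id g D ` A = g ` A" if "A \<subseteq> D" for A
    by (rule image_cong) (use that in auto)
  ultimately show ?thesis using D(2) min by (auto simp: single_cycle_def intro: permutes_restrict_id)
qed

text \<open>The sign-reversing involution on columns needs a cycle of \<open>g\<close> that misses
  the corner; an invariant set avoiding \<open>p\<close> of least cardinality is one.\<close>

lemma not_single_cycle_obtains:
  assumes V: "finite V" and g: "g permutes V" and p: "p \<in> V" and ns: "\<not> single_cycle V g"
  obtains D where "D \<subseteq> V" "D \<noteq> {}" "p \<notin> D" "g ` D \<subseteq> D"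
    "\<And>A. A \<subseteq> D \<Longrightarrow> A \<noteq> {} \<Longrightarrow> g ` A \<subseteq> A \<Longrightarrow> A = D"
proof -
  let ?P = "\<lambda>B. B \<subseteq> V \<and> B \<noteq> {} \<and> p \<notin> B \<and> g ` B \<subseteq> B"
  obtain A where A: "A \<subseteq> V" "A \<noteq> {}" "g ` A \<subseteq> A" "A \<noteq> V"
    using ns g p unfolding single_cycle_def by blast
  have gA: "g ` A = A"
    using permutes_image_subset_eq[OF finite_subset[OF A(1) V] g A(3)] .
  have "\<exists>B. ?P B"
  proof (cases "p \<in> A")
    case False thus ?thesis using A by blast
  next
    case True
    have "g ` (V - A) = V - A"
      using gA permutes_image[OF g] permutes_inj[OF g] by (simp add: image_set_diff)
    hence "?P (V - A)" using A True by blast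
    thus ?thesis by blast
  qed
  then obtain D where D: "?P D" and least: "\<And>B. ?P B \<Longrightarrow> card D \<le> card B"
    using exists_least_iff[of "\<lambda>m. \<exists>B. ?P B \<and> card B = m"] by (metis not_le_imp_less)
  have "A = D" if "A \<subseteq> D" "A \<noteq> {}" "g ` A \<subseteq> A" for A
  proof -
    have "card D \<le> card A" using least[of A] that D by blast
    thus ?thesis using that D V by (meson card_seteq finite_subset)
  qed
  thus ?thesis using that D by blast
qed

text \<open>The row permutations for \<open>C\<close> fix \<open>D\<close> pointwise, so a
  factorization must realise the cycle on \<open>D\<close> in its column factor. Transferring this
  cycle to the row factor is reversible; its sign times \<open>(-1) ^ card D\<close>, for the cells
  that leave the column, is -1.\<close>

lemma hook_coeff_move_cycle:
  assumes V: "finite V" and g: "g permutes V" and C: "C \<subseteq> V" "p \<in> C"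
    and D: "D \<subseteq> C" "D \<noteq> {}" "p \<notin> D" "g ` D \<subseteq> D"
    and min: "\<And>A. A \<subseteq> D \<Longrightarrow> A \<noteq> {} \<Longrightarrow> g ` A \<subseteq> A \<Longrightarrow> A = D"
  shows "(-1) ^ card C * hook_coeff V p C g = - ((-1) ^ card (C - D) * hook_coeff V p (C - D) g)"
proof -
  have C': "C - D \<subseteq> V" "p \<in> C - D" using C D by auto
  define \<delta> where "\<delta> = restrict_id g D"
  have DV: "D \<subseteq> V" using C D by blast
  have finC: "finite C" using V C finite_subset by blast
  have finD: "finite D" using finC D finite_subset by blast
  have \<delta>: "single_cycle D \<delta>" unfolding \<delta>_def
    by (rule single_cycle_restrict_minimal[OF g V DV D(2,4) min])
  have \<delta>D: "\<delta> permutes D" using \<delta> by (simp add: single_cycle_def)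
  have iD: "pinv \<delta> permutes D" by (rule permutes_inv[OF \<delta>D])
  have \<delta>x: "\<delta> x = g x" if "x \<in> D" for x using that by (simp add: \<delta>_def)
  have io: "\<delta> \<circ> pinv \<delta> = id" "pinv \<delta> \<circ> \<delta> = id" using permutes_inv_o[OF \<delta>D] by auto
  have R': "insert p (V - (C - D)) = insert p (V - C) \<union> D" using DV D by auto
  have cC: "card C = card D + card (C - D)"
    using D finC finD by (simp add: card_Diff_subset card_mono)
  have sgn: "sign \<delta> * (-1) ^ card D = -1" by (rule sign_single_cycle[OF finD \<delta>])
  show ?thesis
  proof (cases "hook_factorizations V p C g = {}")
    case False
    then obtain \<rho> \<gamma> where rg: "(\<rho>, \<gamma>) \<in> hook_factorizations V p C g" by auto
    hence \<rho>: "\<rho> permutes insert p (V - C)" and \<gamma>: "\<gamma> permutes C" and eq: "\<rho> \<circ> \<gamma> = g"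
      by (auto simp: hook_factorizations_def)
    have gD: "\<gamma> x = \<delta> x" if "x \<in> D" for x
    proof -
      have "\<rho> (\<gamma> x) = g x" using eq by auto
      moreover have "g x \<in> D" using that D by blast
      hence "\<rho> (g x) = g x" using D(1,3) by (intro permutes_not_in[OF \<rho>]) blast
      ultimately have "\<gamma> x = g x" using permutes_inj[OF \<rho>] by (metis injD)
      thus ?thesis using that by (simp add: \<delta>x)
    qed
    define \<gamma>' where "\<gamma>' = pinv \<delta> \<circ> \<gamma>"
    have "\<gamma>' permutes C" unfolding \<gamma>'_def
      by (rule permutes_compose[OF \<gamma> permutes_subset[OF iD D(1)]])
    moreover have "\<gamma>' x = x" if "x \<in> D" for x
      using gD[OF that] permutes_inverses(2)[OF \<delta>D] by (simp add: \<gamma>'_def)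
    ultimately have \<gamma>': "\<gamma>' permutes (C - D)" by (auto intro: permutes_superset)
    have "\<rho> \<circ> \<delta> permutes insert p (V - (C - D))" unfolding R'
      by (rule permutes_compose) (auto intro: permutes_subset[OF \<rho>] permutes_subset[OF \<delta>D])
    moreover have "\<rho> \<circ> \<delta> \<circ> \<gamma>' = g"
      unfolding \<gamma>'_def eq[symmetric] using io(1) by (simp add: fun_eq_iff)
    ultimately have rg': "(\<rho> \<circ> \<delta>, \<gamma>') \<in> hook_factorizations V p (C - D) g"
      using \<gamma>' by (simp add: hook_factorizations_def)
    have "\<gamma> = \<delta> \<circ> \<gamma>'" unfolding \<gamma>'_def using io(1) by (simp add: fun_eq_iff)
    hence "sign \<gamma> = sign \<delta> * sign \<gamma>'"
      using sign_compose permutes_imp_permutation[OF finD \<delta>D]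
        permutes_imp_permutation[OF _ \<gamma>'] finC by simp
    hence "sign \<gamma> * (-1) ^ card C = - (sign \<gamma>' * (-1) ^ card (C - D))"
      using sgn by (simp add: cC power_add algebra_simps) (metis mult.left_commute mult_minus_right mult_1_right)
    hence "(of_int (sign \<gamma> * (-1) ^ card C) :: rat) = of_int (- (sign \<gamma>' * (-1) ^ card (C - D)))"
      by (rule arg_cong)
    thus ?thesis
      using hook_coeff_unique[OF V C rg] hook_coeff_unique[OF V C' rg'] by (simp add: mult.commute)
  next
    case True
    have "hook_factorizations V p (C - D) g = {}"
    proof (rule ccontr)
      assume "hook_factorizations V p (C - D) g \<noteq> {}"
      then obtain \<rho> \<gamma> where rg: "(\<rho>, \<gamma>) \<in> hook_factorizations V p (C - D) g" by auto
      hence \<rho>: "\<rho> permutes insert p (V - (C - D))" and \<gamma>: "\<gamma> permutes (C - D)" and eq: "\<rho> \<circ> \<gamma> = g"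
        by (auto simp: hook_factorizations_def)
      have "\<rho> \<circ> pinv \<delta> permutes insert p (V - (C - D))"
        by (rule permutes_compose[OF permutes_subset[OF iD] \<rho>]) (use R' in auto)
      \<comment> \<open>On \<open>D\<close> the column factor is trivial, so \<open>\<rho>\<close>
        acts there as \<open>g\<close>, that is as \<open>\<delta>\<close>. Undoing
        \<open>\<delta>\<close> gives a permutation of the smaller row.\<close>
      moreover have "(\<rho> \<circ> pinv \<delta>) x = x" if "x \<in> D" for x
      proof -
        define y where "y = pinv \<delta> x"
        have y: "y \<in> D" "\<delta> y = x"
          using that permutes_in_image[OF iD] permutes_inverses(1)[OF \<delta>D] by (auto simp: y_def)
        have "\<gamma> y = y" using permutes_not_in[OF \<gamma>] y by auto
        hence "\<rho> y = g y" using eq by (metis comp_apply)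
        thus ?thesis using y \<delta>x by (simp add: y_def)
      qed
      ultimately have 1: "\<rho> \<circ> pinv \<delta> permutes insert p (V - C)"
        by (rule permutes_superset) (use DV D in auto)
      have 2: "\<delta> \<circ> \<gamma> permutes C"
        by (rule permutes_compose) (use D in \<open>auto intro: permutes_subset[OF \<gamma>] permutes_subset[OF \<delta>D]\<close>)
      have "\<rho> \<circ> pinv \<delta> \<circ> (\<delta> \<circ> \<gamma>) = g" unfolding eq[symmetric] using io(2) by (simp add: fun_eq_iff)
      hence "(\<rho> \<circ> pinv \<delta>, \<delta> \<circ> \<gamma>) \<in> hook_factorizations V p C g"
        using 1 2 by (simp add: hook_factorizations_def)
      thus False using True by blast
    qed
    thus ?thesis using True hook_coeff_eq_0[OF V C] hook_coeff_eq_0[OF V C'] by simp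
  qed
qed

text \<open>The terms cancel in pairs when \<open>C\<close> is replaced by its symmetric difference
  with a cycle \<open>D\<close> of \<open>g\<close> that avoids \<open>p\<close>.\<close>

lemma sum_hook_coeff_not_single_cycle:
  assumes V: "finite V" and g: "g permutes V" and p: "p \<in> V" and ns: "\<not> single_cycle V g"
  shows "(\<Sum>C | C \<subseteq> V \<and> p \<in> C. (-1) ^ card C * hook_coeff V p C g) = 0"
proof -
  obtain D where D: "D \<subseteq> V" "D \<noteq> {}" "p \<notin> D" "g ` D \<subseteq> D"
    and min: "\<And>A. A \<subseteq> D \<Longrightarrow> A \<noteq> {} \<Longrightarrow> g ` A \<subseteq> A \<Longrightarrow> A = D"
    using not_single_cycle_obtains[OF V g p ns] by metis
  define t where "t C = (-1) ^ card C * hook_coeff V p C g" for C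
  define f where "f C = (C - D) \<union> (D - C)" for C
  have t: "t (f C) = - t C" if C: "C \<subseteq> V" "p \<in> C" for C
  proof -
    have fC: "f C \<subseteq> V" "p \<in> f C" using C D by (auto simp: f_def)
    consider "D \<subseteq> C" | "D \<inter> C = {}" | "D - C \<noteq> {}" "D - C \<noteq> D" by blast
    thus ?thesis
    proof cases
      case 1
      have "f C = C - D" using 1 by (auto simp: f_def)
      thus ?thesis using hook_coeff_move_cycle[OF V g C 1 D(2-4) min] by (simp add: t_def)
    next
      case 2
      have "D \<subseteq> f C" "f C - D = C" using 2 by (auto simp: f_def)
      thus ?thesis using hook_coeff_move_cycle[OF V g fC _ D(2-4) min] by (simp add: t_def)
    next
      case 3
      \<comment> \<open>A column that cuts \<open>D\<close> properly has no factorization: the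
        points of \<open>D\<close> outside it are fixed by the column factor and kept in the row by
        the row factor, so they would form a smaller invariant set.\<close>
      have E: "hook_factorizations V p B g = {}"
        if B: "B \<subseteq> V" "p \<in> B" "D - B \<noteq> {}" "D - B \<noteq> D" for B
      proof (rule ccontr)
        assume "hook_factorizations V p B g \<noteq> {}"
        then obtain \<rho> \<gamma> where \<rho>: "\<rho> permutes insert p (V - B)" and \<gamma>: "\<gamma> permutes B" and eq: "\<rho> \<circ> \<gamma> = g"
          by (auto simp: hook_factorizations_def)
        have "g ` (D - B) \<subseteq> D - B"
        proof
          fix y assume "y \<in> g ` (D - B)"
          then obtain x where x: "x \<in> D" "x \<notin> B" "y = g x" by auto
          have "\<gamma> x = x" using permutes_not_in[OF \<gamma>] x by auto
          hence "y = \<rho> x" using x eq by auto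
          moreover have "x \<in> insert p (V - B)" using x D by auto
          ultimately have "y \<in> insert p (V - B)" using permutes_in_image[OF \<rho>, of x] by simp
          moreover have "y \<in> D" using x D by blast
          ultimately show "y \<in> D - B" using D by auto
        qed
        thus False using min[of "D - B"] B by blast
      qed
      have "D - f C \<noteq> {}" "D - f C \<noteq> D" using 3 by (auto simp: f_def)
      thus ?thesis
        using E[OF C 3] E[OF fC] hook_coeff_eq_0[OF V C] hook_coeff_eq_0[OF V fC] by (simp add: t_def)
    qed
  qed
  have "(\<Sum>C | C \<subseteq> V \<and> p \<in> C. t C) = (\<Sum>C | C \<subseteq> V \<and> p \<in> C. t (f C))"
  proof (rule sum.reindex_bij_witness[of _ f f])
    show ff: "f (f C) = C" for C by (auto simp: f_def)
    show "t (f (f C)) = t C" for C by (simp only: ff)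
  qed (use D in \<open>auto simp: f_def\<close>)
  also have "\<dots> = - (\<Sum>C | C \<subseteq> V \<and> p \<in> C. t C)"
    unfolding sum_negf[symmetric] by (rule sum.cong) (auto simp: t)
  finally show ?thesis by (simp add: t_def)
qed

text \<open>Exactly the \<open>card V\<close> initial arcs \<open>s 0, ..., s j\<close> of the
  cycle, starting at \<open>p\<close>, are columns with a factorization. For each of them the column
  factor is itself a single cycle on the column, so its sign times \<open>(-1) ^ card C\<close> is
  -1.\<close>

lemma sum_hook_coeff_single_cycle:
  assumes V: "finite V" and p: "p \<in> V" and g: "single_cycle V g"
  shows "(\<Sum>C | C \<subseteq> V \<and> p \<in> C. (-1) ^ card C * hook_coeff V p C g) = - of_nat (card V)"
proof -
  have gV: "g permutes V" using g by (simp add: single_cycle_def)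
  define n where "n = card V"
  define s where "s i = (g ^^ i) p" for i
  have bij: "bij_betw s {..<n} V" and sn: "s n = p" and s0: "s 0 = p" and sS: "s (Suc i) = g (s i)" for i
    using single_cycle_enum[OF V g p] by (auto simp: s_def[abs_def] n_def)
  have inj: "inj_on s {..<n}" and im: "s ` {..<n} = V" using bij by (auto simp: bij_betw_def)
  have seq: "s i = s j \<longleftrightarrow> i = j" if "i < n" "j < n" for i j using inj that by (auto simp: inj_on_def)
  have n0: "n > 0" using V p by (auto simp: n_def card_gt_0_iff)
  define P where "P j = s ` {..j}" for j
  have PV: "P j \<subseteq> V" "p \<in> P j" if "j < n" for j
    using that im s0 by (auto simp: P_def image_iff intro: bexI[of _ 0])
  have val: "(-1) ^ card C * hook_coeff V p C g = -1"
    if C: "C \<subseteq> V" "p \<in> C" and rg: "(\<rho>, \<gamma>) \<in> hook_factorizations V p C g" for C \<rho> \<gamma>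
  proof -
    have \<rho>: "\<rho> permutes insert p (V - C)" and \<gamma>: "\<gamma> permutes C" and eq: "\<And>x. g x = \<rho> (\<gamma> x)"
      using rg by (auto simp: hook_factorizations_def)
    have finC: "finite C" using C V finite_subset by blast
    have "single_cycle C \<gamma>" unfolding single_cycle_def
    proof (intro conjI allI impI \<gamma>)
      show "C \<noteq> {}" using C by blast
      fix A assume A: "A \<subseteq> C" "A \<noteq> {}" "\<gamma> ` A \<subseteq> A"
      have \<rho>x: "\<rho> x = x" if "x \<in> C" "x \<noteq> p" for x using permutes_not_in[OF \<rho>] that by auto
      \<comment> \<open>A \<open>\<gamma>\<close>-invariant set without \<open>p\<close> is
        invariant under \<open>g\<close>, since \<open>\<rho>\<close> fixes it pointwise; one that
        contains \<open>p\<close> becomes invariant under \<open>g\<close> once \<open>V - C\<close>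
        is added. Minimality of the cycle \<open>g\<close> applies in both cases.\<close>
      have pA: "p \<in> A"
      proof (rule ccontr)
        assume "p \<notin> A"
        hence "g ` A \<subseteq> A" using A \<rho>x by (fastforce simp: eq)
        hence "A = V" using single_cycle_minimal[OF g _ A(2)] A C by blast
        thus False using \<open>p \<notin> A\<close> p by blast
      qed
      have R: "\<rho> x \<in> insert p (V - C)" if "x \<in> insert p (V - C)" for x
        using that permutes_in_image[OF \<rho>, of x] by blast
      have "g ` (A \<union> (V - C)) \<subseteq> A \<union> (V - C)"
      proof
        fix y assume "y \<in> g ` (A \<union> (V - C))"
        then obtain x where x: "x \<in> A \<or> x \<in> V - C" "y = \<rho> (\<gamma> x)" by (auto simp: eq)
        have z: "\<gamma> x \<in> A \<or> \<gamma> x \<in> V - C" using x A permutes_not_in[OF \<gamma>, of x] by auto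
        show "y \<in> A \<union> (V - C)"
        proof (cases "\<gamma> x \<in> A \<and> \<gamma> x \<noteq> p")
          case True
          hence "\<rho> (\<gamma> x) = \<gamma> x" using \<rho>x A by blast
          thus ?thesis using x True by simp
        next
          case False
          hence "\<gamma> x \<in> insert p (V - C)" using z by blast
          hence "y \<in> insert p (V - C)" unfolding x(2) by (rule R)
          thus ?thesis using pA by auto
        qed
      qed
      hence "A \<union> (V - C) = V" using single_cycle_minimal[OF g, of "A \<union> (V - C)"] A C by blast
      thus "A = C" using A C by blast
    qed
    hence "sign \<gamma> * (-1) ^ card C = -1" by (rule sign_single_cycle[OF finC])
    hence "(of_int (sign \<gamma> * (-1) ^ card C) :: rat) = of_int (-1)" by (rule arg_cong)
    thus ?thesis using hook_coeff_unique[OF V C rg] by (simp add: mult.commute)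
  qed
  have ex: "\<exists>\<rho> \<gamma>. (\<rho>, \<gamma>) \<in> hook_factorizations V p (P j) g" if j: "j < n" for j
  proof (rule hook_factorization_exists[OF V PV[OF j] gV])
    have last: "i = j" if "i \<le> j" "g (s i) \<notin> P j - {p}" for i
    proof (rule ccontr)
      assume "i \<noteq> j"
      hence "Suc i \<le> j" using that by simp
      hence "s (Suc i) \<in> P j" "s (Suc i) \<noteq> p" using j seq[of "Suc i" 0] s0 by (auto simp: P_def)
      thus False using that by (simp add: sS)
    qed
    fix x y assume "x \<in> P j" "y \<in> P j" "g x \<notin> P j - {p}" "g y \<notin> P j - {p}"
    thus "x = y" using last unfolding P_def by blast
  qed
  have only: "C \<in> P ` {..<n}"
    if C: "C \<subseteq> V" "p \<in> C" and rg: "(\<rho>, \<gamma>) \<in> hook_factorizations V p C g" for C \<rho> \<gamma>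
  proof -
    have \<rho>: "\<rho> permutes insert p (V - C)" and \<gamma>: "\<gamma> permutes C" and eq: "\<And>x. g x = \<rho> (\<gamma> x)"
      using rg by (auto simp: hook_factorizations_def)
    \<comment> \<open>From outside \<open>C\<close> the walk along the cycle stays in the row and
      can re-enter \<open>C\<close> only at \<open>p\<close>, where it closes; hence the indices of
      points of \<open>C\<close> form an initial segment.\<close>
    have step: "s (Suc i) \<notin> C" if i: "Suc i < n" "s i \<notin> C" for i
    proof -
      have "s i \<in> V" using im i by auto
      have "g (s i) = \<rho> (s i)" using eq permutes_not_in[OF \<gamma> i(2)] by simp
      moreover have "\<rho> (s i) \<in> insert p (V - C)"
        using permutes_in_image[OF \<rho>, of "s i"] i \<open>s i \<in> V\<close> by blast
      moreover have "s (Suc i) \<noteq> p" using seq[of "Suc i" 0] i s0 n0 by auto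
      ultimately show ?thesis by (auto simp: sS)
    qed
    have up: "i + k < n \<longrightarrow> s (i + k) \<notin> C" if "s i \<notin> C" for i k
      by (induction k) (use that step in auto)
    define J where "J = {i. i < n \<and> s i \<in> C}"
    have J: "finite J" "0 \<in> J" using n0 C s0 by (auto simp: J_def)
    define j where "j = Max J"
    have jJ: "j \<in> J" unfolding j_def using J by (intro Max_in) auto
    have "J = {..j}"
    proof (intro equalityI subsetI)
      fix i assume "i \<in> J" thus "i \<in> {..j}" using J by (simp add: j_def)
    next
      fix i assume "i \<in> {..j}"
      thus "i \<in> J" using jJ up[of i "j - i"] by (auto simp: J_def)
    qed
    moreover have "C = s ` J" using C im by (auto simp: J_def)
    ultimately have "C = P j" by (simp add: P_def)
    thus ?thesis using jJ by (simp add: J_def)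
  qed
  have "(\<Sum>C | C \<subseteq> V \<and> p \<in> C. (-1) ^ card C * hook_coeff V p C g) = (\<Sum>C\<in>P ` {..<n}. -1)"
  proof (rule sum.mono_neutral_cong_right)
    show "finite {C. C \<subseteq> V \<and> p \<in> C}" using V by (auto intro: finite_subset[of _ "Pow V"])
    show "P ` {..<n} \<subseteq> {C. C \<subseteq> V \<and> p \<in> C}" using PV by auto
    show "\<forall>C\<in>{C. C \<subseteq> V \<and> p \<in> C} - P ` {..<n}. (-1) ^ card C * hook_coeff V p C g = 0"
    proof
      fix C assume C: "C \<in> {C. C \<subseteq> V \<and> p \<in> C} - P ` {..<n}"
      hence "hook_factorizations V p C g = {}" using only[of C] by auto
      thus "(-1) ^ card C * hook_coeff V p C g = 0" using C hook_coeff_eq_0[OF V] by simp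
    qed
    fix C assume "C \<in> P ` {..<n}"
    then obtain j where j: "j < n" "C = P j" by auto
    thus "(-1) ^ card C * hook_coeff V p C g = -1" using ex[OF j(1)] val[OF PV[OF j(1)]] by blast
  qed
  also have "card (P ` {..<n}) = n"
  proof -
    have "inj_on P {..<n}"
    proof (rule inj_onI)
      fix i j assume ij: "i \<in> {..<n}" "j \<in> {..<n}" "P i = P j"
      have "card (P k) = Suc k" if "k < n" for k
      proof -
        have "{..k} \<subseteq> {..<n}" using that by auto
        thus ?thesis using card_image[OF inj_on_subset[OF inj]] by (simp add: P_def)
      qed
      thus "i = j" using ij by (metis lessThan_iff nat.inject)
    qed
    thus ?thesis by (simp add: card_image)
  qed
  hence "(\<Sum>C\<in>P ` {..<n}. -1 :: rat) = - of_nat n" by simp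
  finally show ?thesis by (simp add: n_def)
qed

section \<open>Fixed words\<close>

definition words :: "'a set \<Rightarrow> 'c multiset \<Rightarrow> ('a \<Rightarrow> 'c) set" where
  "words V A = {f \<in> V \<rightarrow>\<^sub>E UNIV. image_mset f (mset_set V) = A}"

definition fixes_word :: "'a set \<Rightarrow> ('a \<Rightarrow> 'a) \<Rightarrow> ('a \<Rightarrow> 'c) \<Rightarrow> bool" where
  "fixes_word V u f \<longleftrightarrow> (\<forall>x\<in>V. f (u x) = f x)"

text \<open>For \<open>size A = card V\<close> this is the permutation character on words of content
  \<open>A\<close>, that is, the trivial character of a Young subgroup induced to the symmetric
  group.\<close>

definition num_fixed_words :: "'a set \<Rightarrow> 'c multiset \<Rightarrow> ('a \<Rightarrow> 'a) \<Rightarrow> rat" where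
  "num_fixed_words V A u = of_nat (card {f \<in> words V A. fixes_word V u f})"

lemma words_range: "finite V \<Longrightarrow> f \<in> words V A \<Longrightarrow> x \<in> V \<Longrightarrow> f x \<in># A"
  by (auto simp: words_def)

lemma finite_words: "finite V \<Longrightarrow> finite (words V A)"
  by (rule finite_subset[of _ "V \<rightarrow>\<^sub>E set_mset A"])
    (auto simp: words_def intro: finite_PiE)

lemma count_words:
  assumes "finite V" "f \<in> words V A"
  shows "card {x \<in> V. f x = c} = count A c"
proof -
  have "count A c = sum (count (mset_set V)) (f -` {c} \<inter> V)"
    using assms by (auto simp: words_def count_image_mset)
  also have "\<dots> = (\<Sum>x \<in> f -` {c} \<inter> V. 1)"
    by (rule sum.cong) (use assms in auto)
  also have "f -` {c} \<inter> V = {x \<in> V. f x = c}" by auto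
  finally show ?thesis by simp
qed

lemma restrict_in_words:
  assumes "finite V" "image_mset f (mset_set V) = A"
  shows "restrict f V \<in> words V A"
proof -
  have "image_mset (restrict f V) (mset_set V) = image_mset f (mset_set V)"
    by (rule image_mset_cong) (use assms in auto)
  thus ?thesis using assms by (simp add: words_def)
qed

lemma fixes_word_conj:
  assumes x: "x permutes V" and g: "g permutes V"
  shows "fixes_word V (x \<circ> g \<circ> pinv x) f \<longleftrightarrow> fixes_word V g (f \<circ> x)"
proof
  assume L: "fixes_word V (x \<circ> g \<circ> pinv x) f"
  show "fixes_word V g (f \<circ> x)" unfolding fixes_word_def
  proof
    fix y assume "y \<in> V"
    hence "f ((x \<circ> g \<circ> pinv x) (x y)) = f (x y)"
      using L permutes_in_image[OF x] by (simp add: fixes_word_def)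
    thus "(f \<circ> x) (g y) = (f \<circ> x) y" using permutes_inverses[OF x] by simp
  qed
next
  assume R: "fixes_word V g (f \<circ> x)"
  show "fixes_word V (x \<circ> g \<circ> pinv x) f" unfolding fixes_word_def
  proof
    fix y assume "y \<in> V"
    hence "(f \<circ> x) (g (pinv x y)) = (f \<circ> x) (pinv x y)"
      using R permutes_in_image[OF permutes_inv[OF x]] by (simp add: fixes_word_def)
    thus "f ((x \<circ> g \<circ> pinv x) y) = f y" using permutes_inverses[OF x] by simp
  qed
qed

lemma fixes_word_restrict:
  "u permutes V \<Longrightarrow> fixes_word V u (restrict f V) \<longleftrightarrow> fixes_word V u f"
  by (auto simp: fixes_word_def permutes_in_image)

text \<open>Precomposition with \<open>x\<close> matches the words fixed by the conjugate with those
  fixed by \<open>g\<close> and preserves the content.\<close>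

lemma num_fixed_words_conj:
  assumes V: "finite V" and x: "x permutes V" and g: "g permutes V"
  shows "num_fixed_words V A (x \<circ> g \<circ> pinv x) = num_fixed_words V A g"
proof -
  have ix: "pinv x permutes V" by (rule permutes_inv[OF x])
  have c: "restrict (f \<circ> y) V \<in> words V A" if "f \<in> words V A" "y permutes V" for f y
    by (rule restrict_in_words[OF V])
      (use that V in \<open>simp add: words_def permutes_image_mset flip: multiset.map_comp\<close>)
  have r: "restrict (restrict (f \<circ> y) V \<circ> z) V = f"
    if "f \<in> words V A" "z permutes V" "\<And>v. y (z v) = v" for f y z
    using that by (auto simp: fun_eq_iff words_def permutes_in_image PiE_def extensional_def)
  have "bij_betw (\<lambda>f. restrict (f \<circ> x) V) {f \<in> words V A. fixes_word V (x \<circ> g \<circ> pinv x) f}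
      {f \<in> words V A. fixes_word V g f}"
  proof (rule bij_betwI[where g = "\<lambda>f. restrict (f \<circ> pinv x) V"])
    show "(\<lambda>f. restrict (f \<circ> x) V) \<in> {f \<in> words V A. fixes_word V (x \<circ> g \<circ> pinv x) f}
        \<rightarrow> {f \<in> words V A. fixes_word V g f}"
      using c x fixes_word_conj[OF x g] fixes_word_restrict[OF g] by auto
    show "(\<lambda>f. restrict (f \<circ> pinv x) V) \<in> {f \<in> words V A. fixes_word V g f}
        \<rightarrow> {f \<in> words V A. fixes_word V (x \<circ> g \<circ> pinv x) f}"
    proof (intro Pi_I CollectI conjI)
      fix f assume f: "f \<in> {f \<in> words V A. fixes_word V g f}"
      show "restrict (f \<circ> pinv x) V \<in> words V A" using c ix f by blast
      have "f \<circ> pinv x \<circ> x = f" using permutes_inverses[OF x] by (simp add: fun_eq_iff)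
      hence "fixes_word V (x \<circ> g \<circ> pinv x) (f \<circ> pinv x)"
        using f fixes_word_conj[OF x g, of "f \<circ> pinv x"] by simp
      thus "fixes_word V (x \<circ> g \<circ> pinv x) (restrict (f \<circ> pinv x) V)"
        by (rule iffD2[OF fixes_word_restrict[OF permutes_compose[OF ix permutes_compose[OF g x]]]])
    qed
  qed (use r x ix permutes_inverses[OF x] in auto)
  thus ?thesis by (simp add: num_fixed_words_def bij_betw_same_card)
qed

text \<open>On \<open>V - C\<close> the column factor is trivial, so \<open>\<rho>\<close> preserves
  the colours there. The colour at the corner is then forced, because \<open>\<rho>\<close> permutes
  the row and leaves the multiset of its colours unchanged.\<close>

lemma fixes_word_hook_product:
  assumes V: "finite V" and C: "C \<subseteq> V" "p \<in> C"
    and \<rho>: "\<rho> permutes insert p (V - C)" and \<gamma>: "\<gamma> permutes C"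
  shows "fixes_word V (\<rho> \<circ> \<gamma>) f \<longleftrightarrow> fixes_word V \<rho> f \<and> fixes_word V \<gamma> f"
proof
  have \<gamma>V: "\<gamma> permutes V" using permutes_subset[OF \<gamma> C(1)] .
  assume "fixes_word V \<rho> f \<and> fixes_word V \<gamma> f"
  thus "fixes_word V (\<rho> \<circ> \<gamma>) f" using permutes_in_image[OF \<gamma>V] by (simp add: fixes_word_def)
next
  have \<gamma>V: "\<gamma> permutes V" using permutes_subset[OF \<gamma> C(1)] .
  assume L: "fixes_word V (\<rho> \<circ> \<gamma>) f"
  have 1: "f (\<rho> x) = f x" if "x \<in> V - C" for x
    using L that permutes_not_in[OF \<gamma>, of x] by (auto simp: fixes_word_def)
  have finR: "finite (insert p (V - C))" using V by simp
  have "image_mset f (mset_set (insert p (V - C))) = image_mset (f \<circ> \<rho>) (mset_set (insert p (V - C)))"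
    using permutes_image_mset[OF \<rho>] by (simp flip: multiset.map_comp)
  moreover have "image_mset (f \<circ> \<rho>) (mset_set (V - C)) = image_mset f (mset_set (V - C))"
    by (rule image_mset_cong) (use 1 V in auto)
  ultimately have fp: "f (\<rho> p) = f p"
    using V C by (simp add: mset_set.insert)
  have F: "f (\<rho> x) = f x" for x
  proof (cases "x \<in> insert p (V - C)")
    case True thus ?thesis using fp 1 by blast
  next
    case False thus ?thesis using permutes_not_in[OF \<rho>] by simp
  qed
  thus "fixes_word V \<rho> f \<and> fixes_word V \<gamma> f" using L by (simp add: fixes_word_def)
qed

text \<open>If two points of \<open>C\<close> have the same colour, composing with their
  transposition pairs off the stabilizer with opposite signs; if not, only the identity
  stabilizes.\<close>

lemma signed_stabilizer_sum:
  assumes C: "finite C" "C \<subseteq> V"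
  shows "(\<Sum>\<gamma> | \<gamma> permutes C \<and> fixes_word V \<gamma> f. of_int (sign \<gamma>)) = (if inj_on f C then 1 else 0 :: rat)"
proof (cases "inj_on f C")
  case True
  have "{\<gamma>. \<gamma> permutes C \<and> fixes_word V \<gamma> f} = {id}"
  proof (intro equalityI subsetI)
    fix \<gamma> assume "\<gamma> \<in> {\<gamma>. \<gamma> permutes C \<and> fixes_word V \<gamma> f}"
    hence \<gamma>: "\<gamma> permutes C" "fixes_word V \<gamma> f" by auto
    have "\<gamma> x = x" for x
    proof (cases "x \<in> C")
      case x: True
      hence "f (\<gamma> x) = f x" using \<gamma> C by (auto simp: fixes_word_def)
      thus ?thesis using True x permutes_in_image[OF \<gamma>(1)] by (auto simp: inj_on_def)
    next
      case False thus ?thesis using permutes_not_in[OF \<gamma>(1)] by simp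
    qed
    thus "\<gamma> \<in> {id}" by auto
  qed (auto simp: fixes_word_def permutes_id)
  thus ?thesis using True by simp
next
  case False
  then obtain x y where xy: "x \<in> C" "y \<in> C" "x \<noteq> y" "f x = f y" by (auto simp: inj_on_def)
  let ?t = "transpose x y" and ?S = "{\<gamma>. \<gamma> permutes C \<and> fixes_word V \<gamma> f}"
  have t: "?t permutes C" by (rule permutes_swap_id[OF xy(1,2)])
  have ft: "f (?t z) = f z" for z using xy by (auto simp: transpose_def)
  have cl: "?t \<circ> \<gamma> \<in> ?S" if "\<gamma> \<in> ?S" for \<gamma>
    using that permutes_compose[OF _ t, of \<gamma>] by (simp add: fixes_word_def ft)
  have "(\<Sum>\<gamma>\<in>?S. of_int (sign \<gamma>)) = (\<Sum>\<gamma>\<in>?S. of_int (sign (?t \<circ> \<gamma>)) :: rat)"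
    by (rule sum.reindex_bij_witness[of _ "\<lambda>\<gamma>. ?t \<circ> \<gamma>" "\<lambda>\<gamma>. ?t \<circ> \<gamma>"])
      (use cl in \<open>auto simp only: o_assoc transpose_comp_involutory id_comp\<close>)
  also have "\<dots> = (\<Sum>\<gamma>\<in>?S. - of_int (sign \<gamma>))"
  proof (rule sum.cong[OF refl])
    fix \<gamma> assume "\<gamma> \<in> ?S"
    hence "permutation \<gamma>" using C permutes_imp_permutation by blast
    thus "of_int (sign (?t \<circ> \<gamma>)) = (- of_int (sign \<gamma>) :: rat)"
      using xy(3) by (simp add: sign_compose permutation_swap_id sign_swap_id)
  qed
  finally show ?thesis using False by (simp add: sum_negf)
qed

section \<open>The scalar by which a fixed-word count acts on a hook\<close>

lemma sum_mult_hook_coeff: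
  assumes V: "finite V" and C: "C \<subseteq> V" "p \<in> C"
  shows "(\<Sum>v | v permutes V. F v * hook_coeff V p C v)
    = (\<Sum>\<rho> | \<rho> permutes insert p (V - C). \<Sum>\<gamma> | \<gamma> permutes C. F (\<rho> \<circ> \<gamma>) * of_int (sign \<gamma>))"
proof -
  let ?R = "{\<rho>. \<rho> permutes insert p (V - C)}" and ?C = "{\<gamma>. \<gamma> permutes C}"
  have RV: "insert p (V - C) \<subseteq> V" using C by auto
  have fin: "finite (?R \<times> ?C)"
    using V C by (intro finite_cartesian_product finite_permutations) (auto intro: finite_subset)
  have im: "(\<lambda>(\<rho>, \<gamma>). \<rho> \<circ> \<gamma>) ` (?R \<times> ?C) \<subseteq> {v. v permutes V}"
    by (auto intro!: permutes_compose intro: permutes_subset[OF _ RV] permutes_subset[OF _ C(1)])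
  have "(\<Sum>v | v permutes V. F v * hook_coeff V p C v)
    = (\<Sum>v | v permutes V. \<Sum>x \<in> {x \<in> ?R \<times> ?C. (case x of (\<rho>, \<gamma>) \<Rightarrow> \<rho> \<circ> \<gamma>) = v}. F (fst x \<circ> snd x) * of_int (sign (snd x)))"
    unfolding hook_coeff_def sum_distrib_left
    by (intro sum.cong refl) (auto simp: hook_factorizations_def)
  also have "\<dots> = (\<Sum>x \<in> ?R \<times> ?C. F (fst x \<circ> snd x) * of_int (sign (snd x)))"
    by (rule sum.group[OF fin finite_permutations[OF V] im])
  finally show ?thesis by (simp add: sum.cartesian_product split_def)
qed

lemma card_permutes_mapsto:
  assumes R: "finite R" "p \<in> R" "q \<in> R"
  shows "card {\<sigma>. \<sigma> permutes R \<and> \<sigma> p = q} = fact (card R - 1)"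
proof -
  let ?t = "transpose p q"
  have t: "?t permutes R" by (rule permutes_swap_id) fact+
  have "bij_betw (\<lambda>\<sigma>. ?t \<circ> \<sigma>) {\<sigma>. \<sigma> permutes R \<and> \<sigma> p = q} {\<sigma>. \<sigma> permutes R - {p}}"
  proof (rule bij_betwI[where g = "\<lambda>\<sigma>. ?t \<circ> \<sigma>"])
    show "(\<lambda>\<sigma>. ?t \<circ> \<sigma>) \<in> {\<sigma>. \<sigma> permutes R \<and> \<sigma> p = q} \<rightarrow> {\<sigma>. \<sigma> permutes R - {p}}"
    proof (intro Pi_I CollectI)
      fix \<sigma> assume "\<sigma> \<in> {\<sigma>. \<sigma> permutes R \<and> \<sigma> p = q}"
      hence \<sigma>: "\<sigma> permutes R" "\<sigma> p = q" by auto
      show "?t \<circ> \<sigma> permutes R - {p}"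
        by (rule permutes_superset[OF permutes_compose[OF \<sigma>(1) t]]) (use \<sigma> in auto)
    qed
    show "(\<lambda>\<sigma>. ?t \<circ> \<sigma>) \<in> {\<sigma>. \<sigma> permutes R - {p}} \<rightarrow> {\<sigma>. \<sigma> permutes R \<and> \<sigma> p = q}"
    proof (intro Pi_I CollectI conjI)
      fix \<sigma> assume "\<sigma> \<in> {\<sigma>. \<sigma> permutes R - {p}}"
      hence \<sigma>: "\<sigma> permutes R - {p}" by auto
      hence "\<sigma> permutes R" by (rule permutes_subset) auto
      thus "?t \<circ> \<sigma> permutes R" using t by (rule permutes_compose)
      show "(?t \<circ> \<sigma>) p = q" using permutes_not_in[OF \<sigma>, of p] by simp
    qed
  qed (auto simp: o_assoc)
  hence "card {\<sigma>. \<sigma> permutes R \<and> \<sigma> p = q} = card {\<sigma>. \<sigma> permutes R - {p}}"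
    by (rule bij_betw_same_card)
  also have "\<dots> = fact (card R - 1)"
    using R by (simp add: card_permutations)
  finally show ?thesis .
qed

lemma exists_image_mset:
  assumes "finite S" "size M = card S"
  shows "\<exists>f. image_mset f (mset_set S) = M"
  using assms
proof (induction S arbitrary: M rule: finite_induct)
  case (insert x S)
  then obtain c M' where M: "M = add_mset c M'" by (metis card_insert_disjoint size_eq_Suc_imp_eq_union)
  then obtain f where f: "image_mset f (mset_set S) = M'" using insert by auto
  have "image_mset (f(x := c)) (mset_set S) = image_mset f (mset_set S)"
    by (rule image_mset_cong) (use insert in auto)
  thus ?case using insert f M by (intro exI[of _ "f(x := c)"]) (simp del: fun_upd_apply add: fun_upd_same)
qed simp

text \<open>A word with a prescribed restriction \<open>h\<close> to \<open>C\<close> is obtained from a fixed such word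
  \<open>f\<^sub>1\<close> by composing with a permutation of the row, so the sum of the stabilizer sizes counts
  permutations.\<close>

lemma sum_row_stabilizers:
  assumes V: "finite V" and C: "C \<subseteq> V" "p \<in> C" and A: "size A = card V"
    and h: "h \<in> C \<rightarrow>\<^sub>E set_mset A" "inj_on h C"
  shows "(\<Sum>f \<in> {f \<in> words V A. restrict f C = h}.
            card {\<rho>. \<rho> permutes insert p (V - C) \<and> fixes_word V \<rho> f})
       = fact (card (V - C)) * count A (h p)"
proof -
  define R where "R = insert p (V - C)"
  have finC: "finite C" using V C finite_subset by blast
  have R: "finite R" "p \<in> R" "R \<subseteq> V" using V C by (auto simp: R_def)
  have cR: "card R - 1 = card (V - C)" using V C by (simp add: R_def)
  let ?M = "image_mset h (mset_set C)"
  have "?M = mset_set (h ` C)" using h by (simp add: image_mset_mset_set)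
  hence sub: "?M \<subseteq># A" using h finC
    by (intro mset_subset_eqI) (auto simp: count_mset_set' PiE_def Pi_def Suc_le_eq)
  have "size (A - ?M) = card (V - C)"
    using sub A V C finC by (simp add: size_Diff_submset card_Diff_subset)
  then obtain f0 where f0: "image_mset f0 (mset_set (V - C)) = A - ?M"
    using exists_image_mset[of "V - C"] V by auto
  define f1 where "f1 = (\<lambda>x. if x \<in> C then h x else f0 x)"
  have split: "image_mset f (mset_set V) = image_mset f (mset_set C) + image_mset f (mset_set (V - C))"
    for f :: "'a \<Rightarrow> 'b"
  proof -
    have "mset_set V = mset_set (C \<union> (V - C))" using C by (simp add: Un_absorb1)
    also have "\<dots> = mset_set C + mset_set (V - C)" using V finC by (intro mset_set_Union) auto
    finally show ?thesis by simp
  qed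
  have "image_mset f1 (mset_set C) = ?M" "image_mset f1 (mset_set (V - C)) = image_mset f0 (mset_set (V - C))"
    by (rule image_mset_cong; use V finC in \<open>simp add: f1_def\<close>)+
  hence f1A: "image_mset f1 (mset_set V) = A" using split[of f1] f0 sub by simp
  have f1C: "f1 x = h x" if "x \<in> C" for x using that by (simp add: f1_def)
  let ?W = "{f \<in> words V A. restrict f C = h}"
  \<comment> \<open>Row permutations move no point of \<open>C\<close> except \<open>p\<close>, so
    \<open>f1\<close> composed with \<open>\<sigma>\<close> restricts to \<open>h\<close> as soon as
    the colour at \<open>p\<close> is right.\<close>
  let ?T = "{\<sigma>. \<sigma> permutes R \<and> f1 (\<sigma> p) = h p}"
  define \<Phi> where "\<Phi> \<sigma> = restrict (f1 \<circ> \<sigma>) V" for \<sigma>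
  have finT: "finite ?T" using finite_permutations[OF R(1)] by simp
  have finW: "finite ?W" using finite_words[OF V, of A] by simp
  have \<Phi>W: "\<Phi> \<sigma> \<in> ?W" if "\<sigma> \<in> ?T" for \<sigma>
  proof -
    have \<sigma>: "\<sigma> permutes R" "f1 (\<sigma> p) = h p" using that by auto
    have "\<Phi> \<sigma> \<in> words V A" unfolding \<Phi>_def
      by (rule restrict_in_words[OF V])
        (use f1A permutes_image_mset[OF permutes_subset[OF \<sigma>(1) R(3)]] in \<open>simp flip: multiset.map_comp\<close>)
    moreover have "f1 (\<sigma> x) = h x" if "x \<in> C" for x
    proof (cases "x = p")
      case False
      hence "\<sigma> x = x" using permutes_not_in[OF \<sigma>(1), of x] that by (auto simp: R_def)
      thus ?thesis using f1C that by simp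
    qed (use \<sigma> in simp)
    hence "restrict (\<Phi> \<sigma>) C = h" using h(1) C by (auto simp: \<Phi>_def fun_eq_iff PiE_def extensional_def)
    ultimately show ?thesis by simp
  qed
  have fibre: "card {\<rho>. \<rho> permutes R \<and> fixes_word V \<rho> f} = card {\<sigma> \<in> ?T. \<Phi> \<sigma> = f}" if f: "f \<in> ?W" for f
  proof -
    have fV: "f \<in> words V A" and fC: "restrict f C = h" using f by auto
    have fh: "f x = h x" if "x \<in> C" for x using fC that by auto
    have "image_mset f (mset_set C) = image_mset f1 (mset_set C)"
      by (rule image_mset_cong) (use finC fh f1C in auto)
    hence "image_mset f (mset_set (V - C)) = image_mset f1 (mset_set (V - C))"
      using fV split[of f] split[of f1] f1A by (auto simp: words_def)
    \<comment> \<open>The words \<open>f\<close> and \<open>f1\<close> agree on \<open>C\<close> and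
      have equal content, so they differ by a permutation \<open>s\<close> of \<open>V - C\<close>.
      Composing with \<open>s\<close> identifies the stabilizer of \<open>f\<close> in the row group
      with the fibre of \<open>\<Phi>\<close> over \<open>f\<close>.\<close>
    then obtain s where s: "s permutes V - C" "\<forall>x\<in>V - C. f x = f1 (s x)"
      using image_mset_eq_implies_permutes[of "V - C" f f1] V by blast
    have sR: "s permutes R" using s(1) unfolding R_def by (rule permutes_subset) auto
    have fs: "f x = f1 (s x)" if "x \<in> V" for x
    proof (cases "x \<in> C")
      case True
      thus ?thesis using permutes_not_in[OF s(1), of x] fh f1C by simp
    qed (use s that in auto)
    have fext: "f x = undefined" if "x \<notin> V" for x using fV that by (auto simp: words_def)
    have iR: "pinv s permutes R" by (rule permutes_inv[OF sR])
    have RV: "\<rho> x \<in> V" if "\<rho> permutes R" "x \<in> V" for \<rho> x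
      using permutes_in_image[OF permutes_subset[OF that(1) R(3)]] that by blast
    have "bij_betw (\<lambda>\<rho>. s \<circ> \<rho>) {\<rho>. \<rho> permutes R \<and> fixes_word V \<rho> f} {\<sigma> \<in> ?T. \<Phi> \<sigma> = f}"
    proof (rule bij_betwI[where g = "\<lambda>\<sigma>. pinv s \<circ> \<sigma>"])
      show "(\<lambda>\<rho>. s \<circ> \<rho>) \<in> {\<rho>. \<rho> permutes R \<and> fixes_word V \<rho> f} \<rightarrow> {\<sigma> \<in> ?T. \<Phi> \<sigma> = f}"
      proof
        fix \<rho> assume "\<rho> \<in> {\<rho>. \<rho> permutes R \<and> fixes_word V \<rho> f}"
        hence \<rho>: "\<rho> permutes R" "fixes_word V \<rho> f" by auto
        have e: "f1 (s (\<rho> x)) = f x" if "x \<in> V" for x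
          using fs[OF RV[OF \<rho>(1) that]] \<rho>(2) that by (simp add: fixes_word_def)
        have "\<Phi> (s \<circ> \<rho>) = f" using e fext by (auto simp: \<Phi>_def fun_eq_iff)
        moreover have "f1 ((s \<circ> \<rho>) p) = h p" using e[of p] fh C by auto
        ultimately show "s \<circ> \<rho> \<in> {\<sigma> \<in> ?T. \<Phi> \<sigma> = f}" using permutes_compose[OF \<rho>(1) sR] by simp
      qed
      show "(\<lambda>\<sigma>. pinv s \<circ> \<sigma>) \<in> {\<sigma> \<in> ?T. \<Phi> \<sigma> = f} \<rightarrow> {\<rho>. \<rho> permutes R \<and> fixes_word V \<rho> f}"
      proof
        fix \<sigma> assume "\<sigma> \<in> {\<sigma> \<in> ?T. \<Phi> \<sigma> = f}"
        hence \<sigma>: "\<sigma> permutes R" "\<Phi> \<sigma> = f" by auto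
        have p: "pinv s \<circ> \<sigma> permutes R" by (rule permutes_compose[OF \<sigma>(1) iR])
        have "f ((pinv s \<circ> \<sigma>) x) = f x" if "x \<in> V" for x
        proof -
          have "f ((pinv s \<circ> \<sigma>) x) = f1 (\<sigma> x)"
            using fs[OF RV[OF p that]] permutes_inverses(1)[OF sR] by simp
          also have "\<dots> = f x" unfolding \<sigma>(2)[symmetric] using that by (simp add: \<Phi>_def)
          finally show ?thesis .
        qed
        thus "pinv s \<circ> \<sigma> \<in> {\<rho>. \<rho> permutes R \<and> fixes_word V \<rho> f}" using p by (simp add: fixes_word_def)
      qed
    qed (use permutes_inverses[OF sR] in \<open>auto simp: fun_eq_iff\<close>)
    thus ?thesis by (rule bij_betw_same_card)
  qed
  have "(\<Sum>f \<in> ?W. card {\<rho>. \<rho> permutes R \<and> fixes_word V \<rho> f}) = (\<Sum>f \<in> ?W. \<Sum>\<sigma> \<in> {\<sigma> \<in> ?T. \<Phi> \<sigma> = f}. 1)"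
    using fibre by (intro sum.cong) auto
  also have "\<dots> = (\<Sum>\<sigma> \<in> ?T. 1)"
    by (rule sum.group[OF finT finW]) (use \<Phi>W in blast)
  also have "\<dots> = card (\<Union>q \<in> {q \<in> R. f1 q = h p}. {\<sigma>. \<sigma> permutes R \<and> \<sigma> p = q})"
    using permutes_in_image R(2) by (simp, intro arg_cong[of _ _ card]) (auto simp: permutes_in_image)
  also have "\<dots> = (\<Sum>q \<in> {q \<in> R. f1 q = h p}. card {\<sigma>. \<sigma> permutes R \<and> \<sigma> p = q})"
    using R finite_permutations[OF R(1)] by (intro card_UN_disjoint) auto
  also have "\<dots> = (\<Sum>q \<in> {q \<in> R. f1 q = h p}. fact (card R - 1))"
    by (rule sum.cong) (use card_permutes_mapsto[OF R(1,2)] in auto)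
  also have "\<dots> = card {q \<in> R. f1 q = h p} * fact (card (V - C))" unfolding cR by simp
  \<comment> \<open>Since \<open>h\<close> is injective, \<open>p\<close> is the only point of
    \<open>C\<close> with colour \<open>h p\<close>; all positions of this colour therefore lie in
    the row.\<close>
  also have "{q \<in> R. f1 q = h p} = {q \<in> V. restrict f1 V q = h p}"
    using h(2) C f1C by (auto simp: R_def inj_on_def)
  also have "card \<dots> = count A (h p)"
    by (rule count_words[OF V restrict_in_words[OF V f1A]])
  finally show ?thesis unfolding R_def by (simp only: mult.commute)
qed

lemma prod_diff_eq_fact_binomial: "prod ((-) m) {0..<r} = fact r * (m choose r)" for m r :: nat
proof (induction r)
  case (Suc r)
  have "Suc r * (m choose Suc r) = m * ((m - 1) choose r)" using times_binomial_minus1_eq[of "Suc r" m] by simp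
  also have "\<dots> = (m - r) * (m choose r)" by (simp add: binomial_absorb_comp)
  finally have e: "(m - r) * (m choose r) = Suc r * (m choose Suc r)" ..
  have "prod ((-) m) {0..<Suc r} = fact r * ((m - r) * (m choose r))" using Suc by simp
  also have "\<dots> = fact (Suc r) * (m choose Suc r)" unfolding e by (simp add: algebra_simps)
  finally show ?case .
qed simp

lemma card_inj_funcset:
  "finite S \<Longrightarrow> finite K \<Longrightarrow> card {h \<in> S \<rightarrow>\<^sub>E K. inj_on h S} = fact (card S) * (card K choose card S)"
  using card_inj_on_subset_funcset[of S K S] by (simp add: prod_diff_eq_fact_binomial)

lemma card_inj_funcset_fixed_value:
  assumes S: "finite S" "p \<in> S" and K: "finite K" "c \<in> K"
  shows "card {h \<in> S \<rightarrow>\<^sub>E K. inj_on h S \<and> h p = c} = fact (card S - 1) * ((card K - 1) choose (card S - 1))"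
proof -
  have "bij_betw (\<lambda>h. restrict h (S - {p})) {h \<in> S \<rightarrow>\<^sub>E K. inj_on h S \<and> h p = c}
          {h \<in> (S - {p}) \<rightarrow>\<^sub>E (K - {c}). inj_on h (S - {p})}"
  proof (rule bij_betwI[where g = "\<lambda>h. h(p := c)"])
    show "(\<lambda>h. restrict h (S - {p})) \<in> {h \<in> S \<rightarrow>\<^sub>E K. inj_on h S \<and> h p = c}
          \<rightarrow> {h \<in> (S - {p}) \<rightarrow>\<^sub>E (K - {c}). inj_on h (S - {p})}"
      using S by (auto simp: inj_on_def PiE_def Pi_def)
    show "(\<lambda>h. h(p := c)) \<in> {h \<in> (S - {p}) \<rightarrow>\<^sub>E (K - {c}). inj_on h (S - {p})}
          \<rightarrow> {h \<in> S \<rightarrow>\<^sub>E K. inj_on h S \<and> h p = c}"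
      using S K by (auto simp: inj_on_def PiE_def Pi_def extensional_def)
  qed (use S in \<open>auto simp: fun_eq_iff PiE_def extensional_def\<close>)
  hence "card {h \<in> S \<rightarrow>\<^sub>E K. inj_on h S \<and> h p = c} = card {h \<in> (S - {p}) \<rightarrow>\<^sub>E (K - {c}). inj_on h (S - {p})}"
    by (rule bij_betw_same_card)
  also have "\<dots> = fact (card S - 1) * ((card K - 1) choose (card S - 1))"
    using card_inj_funcset[of "S - {p}" "K - {c}"] S K by simp
  finally show ?thesis .
qed

text \<open>For each word the row sum and the column sum separate. The column sum keeps only words
  injective on \<open>C\<close>; the row sum yields \<open>count A (h p)\<close>, which adds up to
  \<open>card V\<close> over the colours of the corner, and the other column entries are distinct
  and different from that colour. With r = \<open>card C - 1\<close> and n = \<open>card V\<close>,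
  the product n (n - 1 - r)! r! is the hook length product, and the binomial coefficient is the
  Kostka number.\<close>

lemma sum_num_fixed_words_hook_coeff:
  assumes V: "finite V" and C: "C \<subseteq> V" "p \<in> C" and A: "size A = card V"
  shows "(\<Sum>v | v permutes V. num_fixed_words V A v * hook_coeff V p C v)
    = of_nat (card V * fact (card (V - C)) * fact (card C - 1) * ((card (set_mset A) - 1) choose (card C - 1)))"
proof -
  let ?R = "{\<rho>. \<rho> permutes insert p (V - C)}" and ?C = "{\<gamma>. \<gamma> permutes C}"
  let ?K = "set_mset A" and ?H = "{h \<in> C \<rightarrow>\<^sub>E set_mset A. inj_on h C}"
  have finC: "finite C" using V C finite_subset by blast
  have finR: "finite ?R" using V by (intro finite_permutations) simp
  have finCC: "finite ?C" by (rule finite_permutations[OF finC])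
  have finW: "finite (words V A)" by (rule finite_words[OF V])
  have finH: "finite ?H" using finC by (simp add: finite_PiE)
  have nfw: "num_fixed_words V A v = (\<Sum>f\<in>words V A. if fixes_word V v f then 1 else 0)" for v
    using finW by (simp add: num_fixed_words_def sum.If_cases Int_def)
  have "(\<Sum>v | v permutes V. num_fixed_words V A v * hook_coeff V p C v)
      = (\<Sum>\<rho>\<in>?R. \<Sum>\<gamma>\<in>?C. num_fixed_words V A (\<rho> \<circ> \<gamma>) * of_int (sign \<gamma>))"
    by (rule sum_mult_hook_coeff[OF V C])
  also have "\<dots> = (\<Sum>\<rho>\<in>?R. \<Sum>\<gamma>\<in>?C. \<Sum>f\<in>words V A. if fixes_word V (\<rho> \<circ> \<gamma>) f then of_int (sign \<gamma>) else 0)"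
    unfolding nfw sum_distrib_right by (intro sum.cong refl) simp
  also have "\<dots> = (\<Sum>f\<in>words V A. \<Sum>\<rho>\<in>?R. \<Sum>\<gamma>\<in>?C. if fixes_word V (\<rho> \<circ> \<gamma>) f then of_int (sign \<gamma>) else 0)"
    by (subst sum.swap[of _ "words V A"]) (intro sum.cong refl sum.swap)
  also have "\<dots> = (\<Sum>f\<in>words V A. if inj_on f C
      then of_nat (card {\<rho>. \<rho> permutes insert p (V - C) \<and> fixes_word V \<rho> f}) else 0)"
  proof (rule sum.cong[OF refl])
    fix f
    have "(\<Sum>\<rho>\<in>?R. \<Sum>\<gamma>\<in>?C. if fixes_word V (\<rho> \<circ> \<gamma>) f then of_int (sign \<gamma>) else (0::rat))
        = (\<Sum>\<rho>\<in>?R. \<Sum>\<gamma>\<in>?C. (if fixes_word V \<rho> f then 1 else 0) * (if fixes_word V \<gamma> f then of_int (sign \<gamma>) else 0))"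
      by (intro sum.cong refl) (use fixes_word_hook_product[OF V C] in auto)
    also have "\<dots> = (\<Sum>\<rho>\<in>?R. if fixes_word V \<rho> f then 1 else 0) * (\<Sum>\<gamma>\<in>?C. if fixes_word V \<gamma> f then of_int (sign \<gamma>) else 0)"
      by (simp add: sum_product)
    also have "(\<Sum>\<rho>\<in>?R. if fixes_word V \<rho> f then 1 else (0::rat)) = of_nat (card {\<rho>. \<rho> permutes insert p (V - C) \<and> fixes_word V \<rho> f})"
      using finR by (simp add: sum.If_cases Int_def)
    also have "(\<Sum>\<gamma>\<in>?C. if fixes_word V \<gamma> f then of_int (sign \<gamma>) else (0::rat)) = (if inj_on f C then 1 else 0)"
      using finCC signed_stabilizer_sum[OF finC C(1), of f] by (simp add: sum.If_cases Int_def)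
    also have "of_nat (card {\<rho>. \<rho> permutes insert p (V - C) \<and> fixes_word V \<rho> f}) * (if inj_on f C then 1 else 0 :: rat)
      = (if inj_on f C then of_nat (card {\<rho>. \<rho> permutes insert p (V - C) \<and> fixes_word V \<rho> f}) else 0)"
      by simp
    finally show "(\<Sum>\<rho>\<in>?R. \<Sum>\<gamma>\<in>?C. if fixes_word V (\<rho> \<circ> \<gamma>) f then of_int (sign \<gamma>) else (0::rat))
      = (if inj_on f C then of_nat (card {\<rho>. \<rho> permutes insert p (V - C) \<and> fixes_word V \<rho> f}) else 0)" .
  qed
  also have "\<dots> = (\<Sum>f\<in>{f \<in> words V A. inj_on f C}.
      of_nat (card {\<rho>. \<rho> permutes insert p (V - C) \<and> fixes_word V \<rho> f}))"
    using finW by (simp add: sum.inter_filter)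
  also have "\<dots> = (\<Sum>h\<in>?H. \<Sum>f\<in>{f \<in> {f \<in> words V A. inj_on f C}. restrict f C = h}.
      of_nat (card {\<rho>. \<rho> permutes insert p (V - C) \<and> fixes_word V \<rho> f}))"
    by (rule sum.group[symmetric]) (use finW finH words_range[OF V, of _ A] C in auto)
  also have "\<dots> = (\<Sum>h\<in>?H. of_nat (fact (card (V - C)) * count A (h p)))"
  proof (rule sum.cong[OF refl])
    fix h assume h: "h \<in> ?H"
    have "{f \<in> {f \<in> words V A. inj_on f C}. restrict f C = h} = {f \<in> words V A. restrict f C = h}"
    proof (intro equalityI subsetI)
      fix f assume f: "f \<in> {f \<in> words V A. restrict f C = h}"
      hence "inj_on (restrict f C) C" using h by simp
      thus "f \<in> {f \<in> {f \<in> words V A. inj_on f C}. restrict f C = h}" using f by simp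
    qed auto
    thus "(\<Sum>f\<in>{f \<in> {f \<in> words V A. inj_on f C}. restrict f C = h}.
      of_nat (card {\<rho>. \<rho> permutes insert p (V - C) \<and> fixes_word V \<rho> f}))
      = of_nat (fact (card (V - C)) * count A (h p))"
      using sum_row_stabilizers[OF V C A, of h] h by (simp flip: of_nat_sum)
  qed
  also have "\<dots> = of_nat (fact (card (V - C)) * (\<Sum>h\<in>?H. count A (h p)))"
    by (simp add: sum_distrib_left)
  also have "(\<Sum>h\<in>?H. count A (h p)) = (\<Sum>c\<in>?K. \<Sum>h\<in>{h \<in> ?H. h p = c}. count A (h p))"
    by (rule sum.group[symmetric]) (use finH C in \<open>auto simp: PiE_def Pi_def\<close>)
  also have "\<dots> = (\<Sum>c\<in>?K. count A c * (fact (card C - 1) * ((card ?K - 1) choose (card C - 1))))"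
  proof (rule sum.cong[OF refl])
    fix c assume c: "c \<in> ?K"
    have "{h \<in> ?H. h p = c} = {h \<in> C \<rightarrow>\<^sub>E ?K. inj_on h C \<and> h p = c}" by auto
    thus "(\<Sum>h\<in>{h \<in> ?H. h p = c}. count A (h p)) = count A c * (fact (card C - 1) * ((card ?K - 1) choose (card C - 1)))"
      using card_inj_funcset_fixed_value[OF finC C(2) _ c] by simp
  qed
  also have "\<dots> = card V * (fact (card C - 1) * ((card ?K - 1) choose (card C - 1)))"
    by (simp add: A[symmetric] size_multiset_overloaded_eq sum_distrib_right)
  finally show ?thesis by (simp add: mult_ac)
qed

section \<open>Convolution sums\<close>

text \<open>The sum of \<open>\<Theta>\<close> over all products with one factor per weight
  function, weighted by the product of the weights; \<open>conv_sum_lists\<close> gives the closed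
  form. With the target as a parameter of the recursion, an induction can absorb the first factor
  into it.\<close>

primrec conv_sum :: "('g, 'b) monoid_scheme \<Rightarrow> ('g \<Rightarrow> rat) list \<Rightarrow> ('g \<Rightarrow> rat) \<Rightarrow> rat" where
  "conv_sum G [] \<Theta> = \<Theta> (one G)"
| "conv_sum G (z # zs) \<Theta> = (\<Sum>u\<in>carrier G. z u * conv_sum G zs (\<lambda>g. \<Theta> (mult G u g)))"

context monoid begin

lemma conv_sum_cong:
  assumes "\<And>g. g \<in> carrier G \<Longrightarrow> \<Theta> g = \<Theta>' g"
  shows "conv_sum G zs \<Theta> = conv_sum G zs \<Theta>'"
  using assms
proof (induction zs arbitrary: \<Theta> \<Theta>')
  case (Cons z zs)
  have "conv_sum G zs (\<lambda>g. \<Theta> (u \<otimes> g)) = conv_sum G zs (\<lambda>g. \<Theta>' (u \<otimes> g))" if "u \<in> carrier G" for u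
    by (rule Cons.IH) (use Cons.prems that in simp)
  thus ?case by simp
qed simp

lemma conv_sum_sum:
  "conv_sum G zs (\<lambda>g. \<Sum>i\<in>I. \<Theta> i g) = (\<Sum>i\<in>I. conv_sum G zs (\<Theta> i))"
  by (induction zs arbitrary: \<Theta>) (simp_all add: sum_distrib_left sum.swap[of _ I])

lemma conv_sum_cmult: "conv_sum G zs (\<lambda>g. c * \<Theta> g) = c * conv_sum G zs \<Theta>"
  by (induction zs arbitrary: \<Theta>) (simp_all add: sum_distrib_left mult_ac)

text \<open>Every product with nonzero weight stays in the submonoid \<open>H\<close>, where the
  target vanishes.\<close>

lemma conv_sum_eq_0:
  assumes "\<And>z u. z \<in> set zs \<Longrightarrow> u \<in> carrier G \<Longrightarrow> u \<notin> H \<Longrightarrow> z u = 0"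
    and "\<one> \<in> H" and "\<And>x y. x \<in> H \<Longrightarrow> x \<in> carrier G \<Longrightarrow> y \<in> H \<Longrightarrow> y \<in> carrier G \<Longrightarrow> x \<otimes> y \<in> H"
    and "\<And>g. g \<in> H \<Longrightarrow> g \<in> carrier G \<Longrightarrow> \<Theta> g = 0"
  shows "conv_sum G zs \<Theta> = 0"
  using assms(1,4)
proof (induction zs arbitrary: \<Theta>)
  case (Cons z zs)
  have "z u * conv_sum G zs (\<lambda>g. \<Theta> (u \<otimes> g)) = 0" if u: "u \<in> carrier G" for u
  proof (cases "u \<in> H")
    case True
    have "conv_sum G zs (\<lambda>g. \<Theta> (u \<otimes> g)) = 0"
      by (rule Cons.IH) (use Cons.prems assms(3) True u in auto)
    thus ?thesis by simp
  qed (use Cons.prems u in simp)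
  thus ?case by simp
qed (use assms(2) in simp)

lemma conv_sum_lists:
  assumes fin: "finite (carrier G)"
  shows "conv_sum G zs \<Theta> = (\<Sum>us | length us = length zs \<and> set us \<subseteq> carrier G.
           (\<Prod>i<length zs. (zs ! i) (us ! i)) * \<Theta> (foldr (\<otimes>) us \<one>))"
proof (induction zs arbitrary: \<Theta>)
  case (Cons z zs)
  let ?L = "\<lambda>m. {us. length us = m \<and> set us \<subseteq> carrier G}"
  have "conv_sum G (z # zs) \<Theta> = (\<Sum>u\<in>carrier G. \<Sum>us\<in>?L (length zs).
      z u * ((\<Prod>i<length zs. (zs ! i) (us ! i)) * \<Theta> (u \<otimes> foldr (\<otimes>) us \<one>)))"
    by (simp add: Cons.IH sum_distrib_left)
  also have "\<dots> = (\<Sum>x\<in>carrier G \<times> ?L (length zs).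
      z (fst x) * ((\<Prod>i<length zs. (zs ! i) (snd x ! i)) * \<Theta> (fst x \<otimes> foldr (\<otimes>) (snd x) \<one>)))"
    by (simp add: sum.cartesian_product split_def)
  also have "\<dots> = (\<Sum>us\<in>?L (length (z # zs)).
      (\<Prod>i<length (z # zs). ((z # zs) ! i) (us ! i)) * \<Theta> (foldr (\<otimes>) us \<one>))"
    by (rule sum.reindex_bij_witness[of _ "\<lambda>us. (hd us, tl us)" "\<lambda>x. fst x # snd x"])
      (auto simp: length_Suc_conv prod.lessThan_Suc_shift simp del: prod.lessThan_Suc)
  finally show ?case .
next
  case Nil
  have "{us. length us = length [] \<and> set us \<subseteq> carrier G} = {[]}" by auto
  thus ?case by simp
qed

end

text \<open>Conjugating all factors at once conjugates their product and leaves the class functions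
  that weight them unchanged.\<close>

lemma (in group) conv_sum_conj:
  assumes "\<And>z x g. z \<in> set zs \<Longrightarrow> x \<in> carrier G \<Longrightarrow> g \<in> carrier G \<Longrightarrow> z (x \<otimes> g \<otimes> inv x) = z g"
    and x: "x \<in> carrier G"
  shows "conv_sum G zs (\<lambda>g. \<Theta> (x \<otimes> g \<otimes> inv x)) = conv_sum G zs \<Theta>"
proof -
  have c: "inv x \<otimes> (x \<otimes> y) = y" "x \<otimes> (inv x \<otimes> y) = y" if "y \<in> carrier G" for y
    using that x by (simp_all add: m_assoc[symmetric])
  show ?thesis using assms(1)
  proof (induction zs arbitrary: \<Theta>)
    case (Cons z zs)
    have "conv_sum G zs (\<lambda>g. \<Theta> (x \<otimes> (u \<otimes> g) \<otimes> inv x)) = conv_sum G zs (\<lambda>g. \<Theta> ((x \<otimes> u \<otimes> inv x) \<otimes> g))"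
      if u: "u \<in> carrier G" for u
    proof -
      have "conv_sum G zs (\<lambda>g. \<Theta> (x \<otimes> (u \<otimes> g) \<otimes> inv x))
          = conv_sum G zs (\<lambda>g. \<Theta> ((x \<otimes> u \<otimes> inv x) \<otimes> (x \<otimes> g \<otimes> inv x)))"
        by (rule conv_sum_cong) (use x u in \<open>simp add: m_assoc c\<close>)
      also have "\<dots> = conv_sum G zs (\<lambda>g. \<Theta> ((x \<otimes> u \<otimes> inv x) \<otimes> g))"
        using Cons.IH[of "\<lambda>h. \<Theta> ((x \<otimes> u \<otimes> inv x) \<otimes> h)"] Cons.prems by simp
      finally show ?thesis .
    qed
    hence "conv_sum G (z # zs) (\<lambda>g. \<Theta> (x \<otimes> g \<otimes> inv x))
        = (\<Sum>u\<in>carrier G. z (x \<otimes> u \<otimes> inv x) * conv_sum G zs (\<lambda>g. \<Theta> ((x \<otimes> u \<otimes> inv x) \<otimes> g)))"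
      using Cons.prems[of z x] x by simp
    also have "\<dots> = (\<Sum>u\<in>carrier G. z u * conv_sum G zs (\<lambda>g. \<Theta> (u \<otimes> g)))"
      by (rule sum.reindex_bij_witness[of _ "\<lambda>u. inv x \<otimes> u \<otimes> x" "\<lambda>u. x \<otimes> u \<otimes> inv x"])
        (use x in \<open>auto simp: m_assoc c\<close>)
    finally show ?case by simp
  qed (use x in simp)
qed

section \<open>Factorizations of long cycles in the symmetric group\<close>

definition perm_group :: "'a set \<Rightarrow> ('a \<Rightarrow> 'a) monoid" where
  "perm_group V = \<lparr>carrier = {\<pi>. \<pi> permutes V}, mult = (\<circ>), one = id\<rparr>"

lemma perm_group_simps [simp]:
  "carrier (perm_group V) = {\<pi>. \<pi> permutes V}" "mult (perm_group V) = (\<circ>)" "one (perm_group V) = id"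
  by (simp_all add: perm_group_def)

lemma monoid_perm_group: "monoid (perm_group V)"
  by (unfold_locales) (auto simp: permutes_compose permutes_id comp_assoc)

text \<open>The function \<open>hook_coeff\<close> is a common eigenvector for convolution with
  class functions, so every factor contributes one scalar. The left factor \<open>u\<close> is there
  for the induction, which moves the first group element into it.\<close>

lemma conv_sum_hook_coeff:
  assumes V: "finite V" and C: "C \<subseteq> V" "p \<in> C"
    and cls: "\<And>z x g. z \<in> set zs \<Longrightarrow> x permutes V \<Longrightarrow> g permutes V \<Longrightarrow> z (x \<circ> g \<circ> pinv x) = z g"
    and u: "u permutes V"
  shows "conv_sum (perm_group V) zs (\<lambda>g. hook_coeff V p C (u \<circ> g))
    = hook_coeff V p C u * (\<Prod>z\<leftarrow>zs. \<Sum>v | v permutes V. z v * hook_coeff V p C v)"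
  using cls u
proof (induction zs arbitrary: u)
  case (Cons z zs)
  have "conv_sum (perm_group V) (z # zs) (\<lambda>g. hook_coeff V p C (u \<circ> g))
      = (\<Sum>v | v permutes V. z v * conv_sum (perm_group V) zs (\<lambda>g. hook_coeff V p C ((u \<circ> v) \<circ> g)))"
    by (simp add: comp_assoc)
  also have "\<dots> = (\<Sum>v | v permutes V. z v * hook_coeff V p C (u \<circ> v)) *
      (\<Prod>z\<leftarrow>zs. \<Sum>v | v permutes V. z v * hook_coeff V p C v)"
    unfolding sum_distrib_right
  proof (rule sum.cong[OF refl])
    fix v assume "v \<in> {v. v permutes V}"
    hence "u \<circ> v permutes V" using Cons.prems(2) by (auto intro: permutes_compose)
    moreover have "z' (x \<circ> g \<circ> pinv x) = z' g" if "z' \<in> set zs" "x permutes V" "g permutes V" for z' x g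
      by (rule Cons.prems(1)) (use that in simp_all)
    ultimately have "conv_sum (perm_group V) zs (\<lambda>g. hook_coeff V p C ((u \<circ> v) \<circ> g))
      = hook_coeff V p C (u \<circ> v) * (\<Prod>z\<leftarrow>zs. \<Sum>v | v permutes V. z v * hook_coeff V p C v)"
      by (intro Cons.IH)
    thus "z v * conv_sum (perm_group V) zs (\<lambda>g. hook_coeff V p C ((u \<circ> v) \<circ> g))
      = z v * hook_coeff V p C (u \<circ> v) * (\<Prod>z\<leftarrow>zs. \<Sum>v | v permutes V. z v * hook_coeff V p C v)"
      by (simp only: mult.assoc)
  qed
  also have "(\<Sum>v | v permutes V. z v * hook_coeff V p C (u \<circ> v))
      = hook_coeff V p C u * (\<Sum>v | v permutes V. z v * hook_coeff V p C v)"
    by (rule class_sum_hook_coeff[OF V C Cons.prems(1) Cons.prems(2)]) simp_all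
  finally show ?case by (simp add: mult.assoc)
qed simp

text \<open>The sum over leg lengths \<open>r\<close>: the binomial coefficient in front counts the
  columns of size \<open>r + 1\<close> through the corner, and each entry of \<open>ls\<close>, a
  number of colours, contributes its hook scalar divided by n!.\<close>

definition hook_sum :: "nat \<Rightarrow> nat list \<Rightarrow> rat" where
  "hook_sum n ls = (\<Sum>r<n. (-1) ^ r * of_nat ((n - 1) choose r) *
     (\<Prod>l\<leftarrow>ls. of_nat ((l - 1) choose r) / of_nat ((n - 1) choose r)))"

lemma sum_subsets_by_card:
  fixes F :: "nat \<Rightarrow> rat"
  assumes V: "finite V" "p \<in> V"
  shows "(\<Sum>C | C \<subseteq> V \<and> p \<in> C. F (card C - 1)) = (\<Sum>r<card V. of_nat ((card V - 1) choose r) * F r)"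
proof -
  have "(\<Sum>C | C \<subseteq> V \<and> p \<in> C. F (card C - 1)) = (\<Sum>S\<in>Pow (V - {p}). F (card S))"
    by (rule sum.reindex_bij_witness[of _ "insert p" "\<lambda>C. C - {p}"])
      (use V finite_subset in \<open>auto simp: card_insert_if\<close>)
  also have "\<dots> = (\<Sum>r<card V. \<Sum>S\<in>{S \<in> Pow (V - {p}). card S = r}. F (card S))"
  proof (rule sum.group[symmetric])
    have "card S < card V" if "S \<subseteq> V - {p}" for S
      by (rule psubset_card_mono[OF V(1)]) (use that V in blast)
    thus "card ` Pow (V - {p}) \<subseteq> {..<card V}" by auto
  qed (use V in auto)
  also have "\<dots> = (\<Sum>r<card V. of_nat ((card V - 1) choose r) * F r)"
  proof (rule sum.cong[OF refl])
    fix r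
    have "card {S \<in> Pow (V - {p}). card S = r} = (card V - 1) choose r"
      using n_subsets[of "V - {p}" r] V by simp
    thus "(\<Sum>S\<in>{S \<in> Pow (V - {p}). card S = r}. F (card S)) = of_nat ((card V - 1) choose r) * F r"
      by simp
  qed
  finally show ?thesis .
qed

text \<open>The indicator function of the long cycles is replaced by hook coefficients, on which
  each fixed-word count acts by its scalar. The factor \<open>card V\<close> on the left is the
  value of the alternating hook sum on a long cycle, up to sign.\<close>

lemma single_cycle_conv_sum:
  assumes V: "finite V" "V \<noteq> {}" and As: "\<And>A. A \<in> set As \<Longrightarrow> size A = card V"
  shows "of_nat (card V) * conv_sum (perm_group V) (map (num_fixed_words V) As)
           (\<lambda>g. if single_cycle V g then 1 else 0)
       = fact (card V) ^ length As * hook_sum (card V) (map (\<lambda>A. card (set_mset A)) As)"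
proof -
  interpret monoid "perm_group V" by (rule monoid_perm_group)
  obtain p where p: "p \<in> V" using V by blast
  define n where "n = card V"
  have n: "n > 0" using V by (auto simp: n_def card_gt_0_iff)
  let ?T = "conv_sum (perm_group V) (map (num_fixed_words V) As)"
  let ?Cs = "{C. C \<subseteq> V \<and> p \<in> C}"
  define \<kappa> where "\<kappa> r A = (of_nat (n * fact (n - 1 - r) * fact r * ((card (set_mset A) - 1) choose r)) :: rat)"
    for r and A :: "'b multiset"
  \<comment> \<open>The two evaluations of the alternating hook sum say together that it is -n times
    the indicator function of single cycles.\<close>
  have "- of_nat n * ?T (\<lambda>g. if single_cycle V g then 1 else 0)
      = ?T (\<lambda>g. \<Sum>C\<in>?Cs. (-1) ^ card C * hook_coeff V p C g)"
    unfolding conv_sum_cmult[symmetric]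
    by (rule conv_sum_cong)
      (use sum_hook_coeff_not_single_cycle[OF V(1) _ p] sum_hook_coeff_single_cycle[OF V(1) p]
        in \<open>auto simp: n_def\<close>)
  also have "\<dots> = (\<Sum>C\<in>?Cs. (-1) ^ card C * ?T (hook_coeff V p C))"
    by (simp add: conv_sum_sum conv_sum_cmult)
  also have "\<dots> = (\<Sum>C\<in>?Cs. - ((-1) ^ (card C - 1) * (\<Prod>A\<leftarrow>As. \<kappa> (card C - 1) A)))"
  proof (rule sum.cong[OF refl])
    fix C assume "C \<in> ?Cs"
    hence C: "C \<subseteq> V" "p \<in> C" by auto
    have finC: "finite C" using C V finite_subset by blast
    have c0: "card C > 0" using C finC by (auto simp: card_gt_0_iff)
    have cVC: "card (V - C) = n - 1 - (card C - 1)"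
      using C finC c0 by (simp add: card_Diff_subset n_def)
    have "?T (hook_coeff V p C) = ?T (\<lambda>g. hook_coeff V p C (id \<circ> g))" by simp
    also have "\<dots> = (\<Prod>z\<leftarrow>map (num_fixed_words V) As. \<Sum>v | v permutes V. z v * hook_coeff V p C v)"
      by (subst conv_sum_hook_coeff[OF V(1) C])
        (use num_fixed_words_conj[OF V(1)] in \<open>auto simp: hook_coeff_id[OF V(1) C] permutes_id\<close>)
    also have "\<dots> = (\<Prod>A\<leftarrow>As. \<kappa> (card C - 1) A)"
      unfolding map_map
      by (intro arg_cong[of _ _ prod_list] map_cong refl)
        (simp add: sum_num_fixed_words_hook_coeff[OF V(1) C As] \<kappa>_def cVC n_def)
    finally show "(-1) ^ card C * ?T (hook_coeff V p C)
        = - ((-1) ^ (card C - 1) * (\<Prod>A\<leftarrow>As. \<kappa> (card C - 1) A))"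
      using c0 by (cases "card C") auto
  qed
  also have "\<dots> = - (\<Sum>r<n. of_nat ((n - 1) choose r) * ((-1) ^ r * (\<Prod>A\<leftarrow>As. \<kappa> r A)))"
    unfolding sum_negf n_def
    by (subst sum_subsets_by_card[OF V(1) p, of "\<lambda>r. (-1) ^ r * (\<Prod>A\<leftarrow>As. \<kappa> r A)"]) simp
  also have "(\<Sum>r<n. of_nat ((n - 1) choose r) * ((-1) ^ r * (\<Prod>A\<leftarrow>As. \<kappa> r A)))
     = fact n ^ length As * hook_sum n (map (\<lambda>A. card (set_mset A)) As)"
    unfolding hook_sum_def sum_distrib_left
  proof (rule sum.cong[OF refl])
    fix r assume "r \<in> {..<n}"
    hence r: "r \<le> n - 1" by simp
    have fn: "(fact n :: rat) = of_nat n * fact (n - 1)" using n by (simp add: fact_reduce)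
    \<comment> \<open>The hook length product is n! divided by the dimension (n - 1 choose
      r).\<close>
    have k: "\<kappa> r A = fact n * (of_nat ((card (set_mset A) - 1) choose r) / of_nat ((n - 1) choose r))" for A :: "'b multiset"
    proof -
      have "of_nat (fact r * fact (n - 1 - r) * ((n - 1) choose r)) = (of_nat (fact (n - 1)) :: rat)"
        unfolding binomial_fact_lemma[OF r] ..
      hence "fact (n - 1) = fact r * fact (n - 1 - r) * (of_nat ((n - 1) choose r) :: rat)" by simp
      moreover have "of_nat ((n - 1) choose r) \<noteq> (0 :: rat)" using r by simp
      ultimately show ?thesis unfolding \<kappa>_def fn by (simp add: field_simps)
    qed
    have "(\<Prod>A\<leftarrow>As. \<kappa> r A) = fact n ^ length As *
       (\<Prod>l\<leftarrow>map (\<lambda>A. card (set_mset A)) As. of_nat ((l - 1) choose r) / of_nat ((n - 1) choose r))"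
      unfolding k by (induction As) simp_all
    thus "of_nat ((n - 1) choose r) * ((-1) ^ r * (\<Prod>A\<leftarrow>As. \<kappa> r A))
      = fact n ^ length As * ((-1) ^ r * of_nat ((n - 1) choose r) *
         (\<Prod>l\<leftarrow>map (\<lambda>A. card (set_mset A)) As. of_nat ((l - 1) choose r) / of_nat ((n - 1) choose r)))"
      by (simp only: mult_ac)
  qed
  finally show ?thesis by (simp add: n_def)
qed

text \<open>This is the case of one factor and a one-letter alphabet: every permutation fixes the
  only word, and only the leg \<open>r = 0\<close> survives in the hook sum.\<close>

lemma card_single_cycles:
  assumes V: "finite V" "V \<noteq> {}"
  shows "card {g. single_cycle V g} = fact (card V - 1)"
proof -
  let ?A = "replicate_mset (card V) ()"
  have n: "card V > 0" using V by (auto simp: card_gt_0_iff)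
  have w: "{f \<in> words V ?A. fixes_word V g f} = {\<lambda>x\<in>V. ()}" for g
  proof -
    have "image_mset f (mset_set V) = ?A" for f :: "'a \<Rightarrow> unit"
    proof -
      have "f = (\<lambda>_. ())" by auto
      thus ?thesis by (simp add: image_mset_const_eq)
    qed
    thus ?thesis by (auto simp: words_def fixes_word_def fun_eq_iff)
  qed
  have fin: "finite {g. g permutes V}" by (rule finite_permutations[OF V(1)])
  have sub: "{g. g permutes V \<and> single_cycle V g} = {g. single_cycle V g}"
    by (auto simp: single_cycle_def)
  have "hook_sum (card V) [1] = (\<Sum>r\<in>{0::nat}. 1)"
    unfolding hook_sum_def by (intro sum.mono_neutral_cong_right) (use n in auto)
  hence "of_nat (card V) * (\<Sum>g | g permutes V. if single_cycle V g then 1 else 0) = (fact (card V) :: rat)"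
    using single_cycle_conv_sum[OF V, of "[?A]"] n by (simp add: num_fixed_words_def w)
  hence "of_nat (card V * card {g. single_cycle V g}) = (of_nat (fact (card V)) :: rat)"
    using fin by (simp add: sum.If_cases Int_def sub)
  hence "card V * card {g. single_cycle V g} = card V * fact (card V - 1)"
    using n by (simp add: fact_reduce flip: of_nat_mult)
  thus ?thesis using n by simp
qed

section \<open>Weighted fixed words in $G(d,1,n)$\<close>

lemma Gd1n_simps:
  "carrier (Gd1n d n) = {\<pi>. \<pi> permutes {..<n}} \<times> {a. (\<forall>i<n. a i < d) \<and> (\<forall>i\<ge>n. a i = 0)}"
  "mult (Gd1n d n) u v = (fst u \<circ> fst v, \<lambda>i. (snd u (fst v i) + snd v i) mod d)"
  "one (Gd1n d n) = (id, \<lambda>_. 0)"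
  by (auto simp: Gd1n_def split_def)

definition exponent_vectors :: "nat \<Rightarrow> nat \<Rightarrow> (nat \<Rightarrow> nat) set" where
  "exponent_vectors d n = {a. (\<forall>i<n. a i < d) \<and> (\<forall>i\<ge>n. a i = 0)}"

lemma carrier_Gd1n: "carrier (Gd1n d n) = {\<pi>. \<pi> permutes {..<n}} \<times> exponent_vectors d n"
  by (simp add: Gd1n_simps exponent_vectors_def)

text \<open>Exponent vectors are 0 outside the index range, extensional functions are undefined
  there; a summand that looks only at indices below \<open>n\<close> does not notice the
  difference.\<close>

lemma sum_exponent_vectors:
  assumes "\<And>a a'. (\<And>i. i < n \<Longrightarrow> a i = a' i) \<Longrightarrow> F a = F a'"
  shows "(\<Sum>a\<in>exponent_vectors d n. F a) = (\<Sum>a\<in>{..<n} \<rightarrow>\<^sub>E {..<d}. F a)"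
  by (rule sum.reindex_bij_witness[of _ "\<lambda>a i. if i < n then a i else 0" "\<lambda>a. restrict a {..<n}"])
    (auto simp: exponent_vectors_def PiE_def extensional_def fun_eq_iff intro!: assms)

lemma finite_exponent_vectors: "finite (exponent_vectors d n)"
proof (rule finite_subset)
  show "exponent_vectors d n \<subseteq> {a. \<forall>i. (i \<in> {..<n} \<longrightarrow> a i \<in> {..<d}) \<and> (i \<notin> {..<n} \<longrightarrow> a i = 0)}"
    by (auto simp: exponent_vectors_def)
qed (rule finite_set_of_finite_funs, simp_all)

lemma add_mod_unique:
  fixes d S w :: nat
  assumes w: "w < d"
  shows "\<exists>!v. v < d \<and> (v + S) mod d = w"
proof (rule ex1I[of _ "(w + (d - S mod d)) mod d"])
  have "((w + (d - S mod d)) mod d + S) mod d = ((w + (d - S mod d)) + S mod d) mod d"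
    by (metis mod_add_left_eq mod_add_right_eq)
  also have "(w + (d - S mod d)) + S mod d = w + d" using w mod_less_divisor[of d S] by linarith
  finally show "(w + (d - S mod d)) mod d < d \<and> ((w + (d - S mod d)) mod d + S) mod d = w"
    using w by simp
next
  fix v assume v: "v < d \<and> (v + S) mod d = w"
  have "(w + (d - S mod d)) mod d = ((v + S) + (d - S mod d)) mod d" using v by (metis mod_add_left_eq)
  also have "\<dots> = (v + (d - S mod d) + S mod d) mod d"
    by (metis add.commute add.left_commute mod_add_right_eq)
  also have "v + (d - S mod d) + S mod d = v + d" using w mod_less_divisor[of d S] by linarith
  finally show "v = (w + (d - S mod d)) mod d" using v by simp
qed

text \<open>All values but the one at a chosen point \<open>p\<close> are free, and that one is
  determined modulo \<open>d\<close>.\<close>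

lemma card_funcset_sum_mod:
  fixes d w :: nat
  assumes C: "finite C" "C \<noteq> {}" and w: "w < d"
  shows "card {b \<in> C \<rightarrow>\<^sub>E {..<d}. (\<Sum>x\<in>C. b x) mod d = w} = d ^ (card C - 1)"
proof -
  obtain p where p: "p \<in> C" using C by blast
  define v where "v S = (THE v. v < d \<and> (v + S) mod d = w)" for S
  have v: "v S < d" "(v S + S) mod d = w" for S
    using theI'[OF add_mod_unique[OF w]] by (auto simp: v_def)
  have vu: "x = v S" if "x < d" "(x + S) mod d = w" for x S
    using add_mod_unique[OF w, of S] v[of S] that by blast
  have S: "(\<Sum>x\<in>C. b x) = b p + (\<Sum>x\<in>C - {p}. b x)" for b :: "'a \<Rightarrow> nat"
    using C p by (simp add: sum.remove)
  have cg: "(\<Sum>x\<in>C - {p}. b x) = (\<Sum>x\<in>C - {p}. b' x)" if "\<And>x. x \<in> C - {p} \<Longrightarrow> b x = b' x"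
    for b b' :: "'a \<Rightarrow> nat" using that by (rule sum.cong[OF refl])
  have "bij_betw (\<lambda>b. restrict b (C - {p})) {b \<in> C \<rightarrow>\<^sub>E {..<d}. (\<Sum>x\<in>C. b x) mod d = w}
      ((C - {p}) \<rightarrow>\<^sub>E {..<d})"
  proof (rule bij_betwI[where g = "\<lambda>b. b(p := v (\<Sum>x\<in>C - {p}. b x))"])
    show "(\<lambda>b. restrict b (C - {p})) \<in> {b \<in> C \<rightarrow>\<^sub>E {..<d}. (\<Sum>x\<in>C. b x) mod d = w} \<rightarrow> ((C - {p}) \<rightarrow>\<^sub>E {..<d})"
      by (auto simp: PiE_def Pi_def extensional_def)
    show "(\<lambda>b. b(p := v (\<Sum>x\<in>C - {p}. b x))) \<in> ((C - {p}) \<rightarrow>\<^sub>E {..<d})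
        \<rightarrow> {b \<in> C \<rightarrow>\<^sub>E {..<d}. (\<Sum>x\<in>C. b x) mod d = w}"
    proof
      fix b assume b: "b \<in> (C - {p}) \<rightarrow>\<^sub>E {..<d}"
      let ?s = "\<Sum>x\<in>C - {p}. b x"
      have "(\<Sum>x\<in>C. (b(p := v ?s)) x) = v ?s + ?s"
        unfolding S by simp
      thus "b(p := v ?s) \<in> {b \<in> C \<rightarrow>\<^sub>E {..<d}. (\<Sum>x\<in>C. b x) mod d = w}"
        using b v p by (auto simp: PiE_def extensional_def)
    qed
    fix b assume "b \<in> {b \<in> C \<rightarrow>\<^sub>E {..<d}. (\<Sum>x\<in>C. b x) mod d = w}"
    hence b: "b \<in> C \<rightarrow>\<^sub>E {..<d}" "(b p + (\<Sum>x\<in>C - {p}. b x)) mod d = w" by (auto simp: S)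
    have "(\<Sum>x\<in>C - {p}. restrict b (C - {p}) x) = (\<Sum>x\<in>C - {p}. b x)" by (rule cg) simp
    moreover have "b p = v (\<Sum>x\<in>C - {p}. b x)" by (rule vu) (use b p in auto)
    ultimately show "(restrict b (C - {p}))(p := v (\<Sum>x\<in>C - {p}. restrict b (C - {p}) x)) = b"
      using b by (auto simp: fun_eq_iff PiE_def extensional_def)
  next
    fix b assume b: "b \<in> (C - {p}) \<rightarrow>\<^sub>E {..<d}"
    thus "restrict (b(p := v (\<Sum>x\<in>C - {p}. b x))) (C - {p}) = b"
      by (auto simp: fun_eq_iff PiE_def extensional_def)
  qed
  thus ?thesis using C p by (simp add: bij_betw_same_card card_funcsetE)
qed

text \<open>Each factor sees only the values on its own block, and the blocks can be filled
  independently.\<close>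

lemma sum_prod_partition:
  fixes F :: "'a set \<Rightarrow> ('a \<Rightarrow> 'b) \<Rightarrow> 'c :: comm_semiring_1"
  assumes "finite \<C>" and "\<And>C. C \<in> \<C> \<Longrightarrow> finite C" and "disjoint \<C>"
    and "\<And>C a a'. C \<in> \<C> \<Longrightarrow> (\<And>x. x \<in> C \<Longrightarrow> a x = a' x) \<Longrightarrow> F C a = F C a'"
  shows "(\<Sum>a\<in>(\<Union>\<C>) \<rightarrow>\<^sub>E B. \<Prod>C\<in>\<C>. F C a) = (\<Prod>C\<in>\<C>. \<Sum>a\<in>C \<rightarrow>\<^sub>E B. F C a)"
  using assms
proof (induction \<C> rule: finite_induct)
  case (insert C \<C>)
  let ?U = "\<Union>\<C>"
  have dis: "C \<inter> ?U = {}" using insert.prems(2) insert.hyps(2) by (fastforce simp: disjoint_def)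
  have IH: "(\<Sum>a\<in>?U \<rightarrow>\<^sub>E B. \<Prod>C\<in>\<C>. F C a) = (\<Prod>C\<in>\<C>. \<Sum>a\<in>C \<rightarrow>\<^sub>E B. F C a)"
  proof (rule insert.IH)
    show "disjoint \<C>" using insert.prems(2) by (simp add: disjoint_def)
    show "finite D" if "D \<in> \<C>" for D using insert.prems(1) that by simp
    show "F D a = F D a'" if "D \<in> \<C>" "\<And>x. x \<in> D \<Longrightarrow> a x = a' x" for D a a'
      by (rule insert.prems(3)) (use that in auto)
  qed
  have "(\<Sum>a\<in>(\<Union>(insert C \<C>)) \<rightarrow>\<^sub>E B. \<Prod>D\<in>insert C \<C>. F D a)
      = (\<Sum>(b, a)\<in>(C \<rightarrow>\<^sub>E B) \<times> (?U \<rightarrow>\<^sub>E B). F C b * (\<Prod>D\<in>\<C>. F D a))"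
  proof (rule sum.reindex_bij_witness[of _ "\<lambda>(b, a) x. if x \<in> C then b x else a x"
        "\<lambda>a. (restrict a C, restrict a ?U)"], goal_cases)
    case (3 x)
    obtain b a where x: "x = (b, a)" by (cases x)
    show ?case using 3 dis unfolding x by (auto simp: fun_eq_iff PiE_def extensional_def)
  next
    case (5 a)
    have "F C (restrict a C) = F C a" by (rule insert.prems(3)) auto
    moreover have "F D (restrict a ?U) = F D a" if "D \<in> \<C>" for D
      by (rule insert.prems(3)) (use that in auto)
    ultimately show ?case using insert.hyps by simp
  qed (auto simp: fun_eq_iff PiE_def Pi_def extensional_def)
  also have "\<dots> = (\<Sum>b\<in>C \<rightarrow>\<^sub>E B. F C b) * (\<Sum>a\<in>?U \<rightarrow>\<^sub>E B. \<Prod>D\<in>\<C>. F D a)"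
    by (simp add: sum_product sum.cartesian_product split_def)
  finally show ?case using insert.hyps IH by simp
qed simp

section \<open>Cycles of the permutation part\<close>

context
  fixes \<pi> :: "nat \<Rightarrow> nat" and n :: nat
  assumes perm: "\<pi> permutes {..<n}"
begin

lemma self_in_orbit: "x \<in> orbit \<pi> x"
  using permutation_self_in_orbit permutes_imp_permutation[OF finite_lessThan perm] by metis

lemma orbit_eq: "y \<in> orbit \<pi> x \<Longrightarrow> orbit \<pi> y = orbit \<pi> x"
  using cyclic_on_orbit[OF perm finite_lessThan] orbit_cyclic_eq3 by metis

lemma orbit_sub: "x < n \<Longrightarrow> orbit \<pi> x \<subseteq> {..<n}"
  using permutes_orbit_subset[OF perm] by simp

lemma Union_orbits: "\<Union>(orbit \<pi> ` {..<n}) = {..<n}"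
  using orbit_sub self_in_orbit by blast

lemma disjoint_orbits: "disjoint (orbit \<pi> ` {..<n})"
  unfolding disjoint_def
proof (intro ballI impI)
  fix A B assume "A \<in> orbit \<pi> ` {..<n}" "B \<in> orbit \<pi> ` {..<n}" and ne: "A \<noteq> B"
  then obtain x y where xy: "A = orbit \<pi> x" "B = orbit \<pi> y" by blast
  show "A \<inter> B = {}"
  proof (rule ccontr)
    assume "A \<inter> B \<noteq> {}"
    then obtain z where "z \<in> orbit \<pi> x" "z \<in> orbit \<pi> y" using xy by blast
    hence "A = B" using orbit_eq xy by metis
    thus False using ne by blast
  qed
qed

lemma finite_in_orbits: "C \<in> orbit \<pi> ` {..<n} \<Longrightarrow> finite C"
  using orbit_sub finite_subset by blast

lemma orbits_ne: "C \<in> orbit \<pi> ` {..<n} \<Longrightarrow> C \<noteq> {}"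
  using self_in_orbit by blast

lemma sum_orbits: "(\<Sum>C\<in>orbit \<pi> ` {..<n}. sum F C) = sum F {..<n}"
proof -
  have "sum F (\<Union>(orbit \<pi> ` {..<n})) = (\<Sum>C\<in>orbit \<pi> ` {..<n}. sum F C)"
    using finite_in_orbits disjoint_orbits
    by (subst sum.Union_disjoint) (auto simp: disjoint_def)
  thus ?thesis by (simp add: Union_orbits)
qed

lemma fixed_word_orbit:
  assumes f: "fixes_word {..<n} \<pi> f" and x: "x < n" and y: "y \<in> orbit \<pi> x"
  shows "f y = f x"
  using y
proof induction
  case base thus ?case using f x by (simp add: fixes_word_def)
next
  case (step y)
  hence "y < n" using orbit_sub[OF x] by blast
  thus ?case using step f by (simp add: fixes_word_def)
qed

end

text \<open>The weight with which a colouring of the cycles occurs when the product of specialised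
  power sums is multiplied out. Colour 0, the variable set to 1, is open to every cycle; the factor
  \<open>of_nat d\<close> comes from the \<open>d\<close> copies of each variable.\<close>

definition word_weight :: "nat \<Rightarrow> nat \<Rightarrow> gelem \<Rightarrow> (nat \<Rightarrow> nat) \<Rightarrow> rat" where
  "word_weight d n u f = (\<Prod>C\<in>orbit (fst u) ` {..<n}.
     if \<forall>x\<in>C. f x = 0 then 1 else if cycle_weight d u C = 0 then of_nat d else 0)"

definition weighted_fixed_words :: "nat \<Rightarrow> nat \<Rightarrow> nat multiset \<Rightarrow> gelem \<Rightarrow> rat" where
  "weighted_fixed_words d n A u =
     (\<Sum>f | f \<in> words {..<n} A \<and> fixes_word {..<n} (fst u) f. word_weight d n u f)"

text \<open>The factor \<open>d\<close> of a coloured cycle exactly compensates that one exponent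
  vector in \<open>d\<close> gives it weight 0, so each cycle \<open>C\<close> contributes
  \<open>d ^ card C\<close> whatever its colour.\<close>

lemma sum_word_weight:
  assumes \<pi>: "\<pi> permutes {..<n}" and d: "d > 0"
  shows "(\<Sum>a\<in>exponent_vectors d n. word_weight d n (\<pi>, a) f) = of_nat d ^ n"
proof -
  let ?O = "orbit \<pi> ` {..<n}"
  define F where "F C a = (if \<forall>x\<in>C. f x = 0 then 1
      else if (\<Sum>i\<in>C. a i) mod d = 0 then of_nat d else (0 :: rat))" for C and a :: "nat \<Rightarrow> nat"
  have Fc: "F C a = F C a'" if "\<And>x. x \<in> C \<Longrightarrow> a x = a' x" for C a a'
    using sum.cong[OF refl that, of C] by (simp add: F_def)
  have ww: "word_weight d n (\<pi>, a) f = (\<Prod>C\<in>?O. F C a)" for a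
    unfolding word_weight_def F_def cycle_weight_def fst_conv snd_conv ..
  have "(\<Sum>a\<in>exponent_vectors d n. word_weight d n (\<pi>, a) f) = (\<Sum>a\<in>{..<n} \<rightarrow>\<^sub>E {..<d}. \<Prod>C\<in>?O. F C a)"
    unfolding ww
  proof (rule sum_exponent_vectors)
    fix a a' :: "nat \<Rightarrow> nat" assume "\<And>i. i < n \<Longrightarrow> a i = a' i"
    thus "(\<Prod>C\<in>?O. F C a) = (\<Prod>C\<in>?O. F C a')"
      using orbit_sub[OF \<pi>] by (intro prod.cong refl Fc) blast
  qed
  also have "\<dots> = (\<Sum>a\<in>\<Union>?O \<rightarrow>\<^sub>E {..<d}. \<Prod>C\<in>?O. F C a)" by (simp add: Union_orbits[OF \<pi>])
  also have "\<dots> = (\<Prod>C\<in>?O. \<Sum>a\<in>C \<rightarrow>\<^sub>E {..<d}. F C a)"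
    by (rule sum_prod_partition[OF _ finite_in_orbits[OF \<pi>] disjoint_orbits[OF \<pi>] Fc]) simp_all
  also have "\<dots> = (\<Prod>C\<in>?O. of_nat d ^ card C)"
  proof (rule prod.cong[OF refl])
    fix C assume C: "C \<in> ?O"
    have fin: "finite C" and ne: "C \<noteq> {}" using finite_in_orbits[OF \<pi> C] orbits_ne[OF \<pi> C] by auto
    have c: "card C > 0" using fin ne by (simp add: card_gt_0_iff)
    have finP: "finite (C \<rightarrow>\<^sub>E {..<d})" using fin by (simp add: finite_PiE)
    show "(\<Sum>a\<in>C \<rightarrow>\<^sub>E {..<d}. F C a) = of_nat d ^ card C"
    proof (cases "\<forall>x\<in>C. f x = 0")
      case True
      thus ?thesis using fin by (simp add: F_def card_funcsetE)
    next
      case False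
      have "(\<Sum>a\<in>C \<rightarrow>\<^sub>E {..<d}. F C a) = (\<Sum>a\<in>{a \<in> C \<rightarrow>\<^sub>E {..<d}. (\<Sum>i\<in>C. a i) mod d = 0}. of_nat d)"
        unfolding sum.inter_filter[OF finP] by (rule sum.cong) (use False in \<open>auto simp: F_def\<close>)
      also have "\<dots> = of_nat (d ^ (card C - 1)) * of_nat d"
        using card_funcset_sum_mod[OF fin ne d] by simp
      also have "\<dots> = of_nat d ^ card C" using c by (cases "card C") simp_all
      finally show ?thesis .
    qed
  qed
  also have "\<dots> = of_nat d ^ (\<Sum>C\<in>?O. card C)" by (simp add: power_sum)
  also have "(\<Sum>C\<in>?O. card C) = n" using sum_orbits[OF \<pi>, of "\<lambda>_. 1 :: nat"] by simp
  finally show ?thesis .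
qed

lemma sum_weighted_fixed_words:
  assumes "\<pi> permutes {..<n}" "d > 0"
  shows "(\<Sum>a\<in>exponent_vectors d n. weighted_fixed_words d n A (\<pi>, a))
    = of_nat d ^ n * num_fixed_words {..<n} A \<pi>"
  unfolding weighted_fixed_words_def fst_conv
  by (subst sum.swap) (simp add: sum_word_weight[OF assms] num_fixed_words_def)

text \<open>A homomorphism to the integers modulo \<open>d\<close>, and by
  \<open>single_cycles_conjugate\<close> a complete conjugacy invariant among elements whose
  permutation part is a long cycle.\<close>

definition total_weight :: "nat \<Rightarrow> nat \<Rightarrow> gelem \<Rightarrow> nat" where
  "total_weight d n u = (\<Sum>i<n. snd u i) mod d"

lemma total_weight_mult:
  assumes "v \<in> carrier (Gd1n d n)"
  shows "total_weight d n (mult (Gd1n d n) u v) = (total_weight d n u + total_weight d n v) mod d"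
proof -
  have v: "fst v permutes {..<n}" using assms by (auto simp: Gd1n_simps)
  have "(\<Sum>i<n. snd u (fst v i)) = (\<Sum>i<n. snd u i)"
    using sum.permute[OF v, of "snd u"] by (simp add: comp_def)
  moreover have "total_weight d n (mult (Gd1n d n) u v) = (\<Sum>i<n. snd u (fst v i) + snd v i) mod d"
    by (simp add: total_weight_def Gd1n_simps mod_sum_eq)
  ultimately show ?thesis by (simp add: total_weight_def sum.distrib mod_add_eq)
qed

text \<open>Position \<open>p\<close> has colour \<open>0\<close>, so no weight condition is imposed on its cycle and the exponent
  at \<open>p\<close> may be shifted freely.\<close>

lemma sum_word_weight_shift:
  assumes \<pi>: "\<pi> permutes {..<n}" and d: "d > 0"
    and f: "fixes_word {..<n} \<pi> f" and p: "p < n" "f p = 0"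
  shows "(\<Sum>a\<in>exponent_vectors d n. word_weight d n (\<pi>, a) f * y (total_weight d n (\<pi>, a)))
       = (\<Sum>a\<in>exponent_vectors d n. word_weight d n (\<pi>, a) f * y ((total_weight d n (\<pi>, a) + 1) mod d))"
proof -
  define s where "s a = a(p := (a p + 1) mod d)" for a :: "nat \<Rightarrow> nat"
  define t where "t a = a(p := (a p + (d - 1)) mod d)" for a :: "nat \<Rightarrow> nat"
  have tot: "total_weight d n (\<pi>, s a) = (total_weight d n (\<pi>, a) + 1) mod d" for a
  proof -
    have "(\<Sum>i<n. s a i) = (a p + 1) mod d + (\<Sum>i\<in>{..<n} - {p}. a i)"
      using p(1) by (simp add: s_def sum.remove[of "{..<n}" p])
    moreover have "(\<Sum>i<n. a i) = a p + (\<Sum>i\<in>{..<n} - {p}. a i)"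
      using p(1) by (simp add: sum.remove[of "{..<n}" p])
    ultimately show ?thesis
      by (simp add: total_weight_def mod_simps add.commute add.left_commute)
  qed
  have ww: "word_weight d n (\<pi>, s a) f = word_weight d n (\<pi>, a) f" for a
    unfolding word_weight_def fst_conv
  proof (rule prod.cong[OF refl])
    fix C assume "C \<in> orbit \<pi> ` {..<n}"
    then obtain x where x: "x < n" "C = orbit \<pi> x" by blast
    show "(if \<forall>x\<in>C. f x = 0 then 1 else if cycle_weight d (\<pi>, s a) C = 0 then of_nat d else 0)
        = (if \<forall>x\<in>C. f x = 0 then 1 else if cycle_weight d (\<pi>, a) C = 0 then of_nat d else (0 :: rat))"
    proof (cases "p \<in> C")
      case True
      hence "f p = f x" using fixed_word_orbit[OF \<pi> f x(1)] x by simp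
      hence "\<forall>x\<in>C. f x = 0" using fixed_word_orbit[OF \<pi> f x(1)] x p by simp
      thus ?thesis by simp
    next
      case False
      hence "(\<Sum>i\<in>C. s a i) = (\<Sum>i\<in>C. a i)" by (intro sum.cong) (auto simp: s_def)
      thus ?thesis by (simp add: cycle_weight_def)
    qed
  qed
  have "(\<Sum>a\<in>exponent_vectors d n. word_weight d n (\<pi>, a) f * y (total_weight d n (\<pi>, a)))
      = (\<Sum>a\<in>exponent_vectors d n. word_weight d n (\<pi>, s a) f * y (total_weight d n (\<pi>, s a)))"
  proof (rule sum.reindex_bij_witness[of _ s t])
    fix a assume "a \<in> exponent_vectors d n"
    hence a: "\<And>i. i < n \<Longrightarrow> a i < d" "\<And>i. i \<ge> n \<Longrightarrow> a i = 0" by (auto simp: exponent_vectors_def)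
    have ap: "a p < d" using a p by simp
    have e1: "((a p + (d - 1)) mod d + 1) mod d = a p" and e2: "((a p + 1) mod d + (d - 1)) mod d = a p"
      unfolding mod_add_left_eq using d ap by simp_all
    show st: "s (t a) = a" unfolding s_def t_def fun_upd_same fun_upd_upd e1 fun_upd_triv ..
    show "t (s a) = a" unfolding s_def t_def fun_upd_same fun_upd_upd e2 fun_upd_triv ..
    show "t a \<in> exponent_vectors d n" "s a \<in> exponent_vectors d n"
      using a p d by (auto simp: s_def t_def exponent_vectors_def)
    show "word_weight d n (\<pi>, s (t a)) f * y (total_weight d n (\<pi>, s (t a)))
      = word_weight d n (\<pi>, a) f * y (total_weight d n (\<pi>, a))" by (simp only: st)
  qed
  thus ?thesis by (simp add: ww tot)
qed

lemma sum_carrier_Gd1n: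
  "(\<Sum>u\<in>carrier (Gd1n d n). F u) = (\<Sum>\<pi> | \<pi> permutes {..<n}. \<Sum>a\<in>exponent_vectors d n. F (\<pi>, a))"
  by (simp add: carrier_Gd1n sum.cartesian_product)

lemma sum_weighted_fixed_words_shift:
  assumes \<pi>: "\<pi> permutes {..<n}" and d: "d > 0" and A: "0 \<in># A"
  shows "(\<Sum>a\<in>exponent_vectors d n. weighted_fixed_words d n A (\<pi>, a) * y (total_weight d n (\<pi>, a)))
       = (\<Sum>a\<in>exponent_vectors d n. weighted_fixed_words d n A (\<pi>, a) * y ((total_weight d n (\<pi>, a) + 1) mod d))"
  unfolding weighted_fixed_words_def sum_distrib_right fst_conv
proof (subst (1 2) sum.swap, rule sum.cong[OF refl])
  fix f assume "f \<in> {f. f \<in> words {..<n} A \<and> fixes_word {..<n} \<pi> f}"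
  hence f: "f \<in> words {..<n} A" "fixes_word {..<n} \<pi> f" by auto
  have "0 \<in> f ` {..<n}" using A f(1) by (auto simp: words_def)
  then obtain p where "p < n" "f p = 0" by (metis imageE lessThan_iff)
  thus "(\<Sum>a\<in>exponent_vectors d n. word_weight d n (\<pi>, a) f * y (total_weight d n (\<pi>, a)))
       = (\<Sum>a\<in>exponent_vectors d n. word_weight d n (\<pi>, a) f * y ((total_weight d n (\<pi>, a) + 1) mod d))"
    by (rule sum_word_weight_shift[OF \<pi> d f(2)])
qed

text \<open>One factor with a position of colour 0 suffices, since shifting its weight shifts the
  weight of the whole product. The induction runs along the list until such a factor comes
  first.\<close>

lemma conv_sum_shift:
  assumes d: "d > 0" and A: "\<exists>A\<in>set As. 0 \<in># A"
  shows "conv_sum (Gd1n d n) (map (weighted_fixed_words d n) As) (\<lambda>g. \<Xi> (fst g) (total_weight d n g))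
       = conv_sum (Gd1n d n) (map (weighted_fixed_words d n) As)
           (\<lambda>g. \<Xi> (fst g) ((total_weight d n g + 1) mod d))"
proof -
  interpret group "Gd1n d n" by (rule group_Gd1n) (use d in simp)
  show ?thesis using A
  proof (induction As arbitrary: \<Xi>)
    case (Cons A As)
    let ?w = "total_weight d n" and ?cs = "conv_sum (Gd1n d n) (map (weighted_fixed_words d n) As)"
    \<comment> \<open>The sum over the remaining factors once the permutation part
      \<open>\<pi>\<close> and the total weight \<open>w\<close> of the first factor are
      known.\<close>
    define Y where "Y \<Xi> \<pi> w = ?cs (\<lambda>g. \<Xi> (\<pi> \<circ> fst g) ((w + ?w g) mod d))"
      for \<Xi> :: "(nat \<Rightarrow> nat) \<Rightarrow> nat \<Rightarrow> rat" and \<pi> w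
    have Y: "conv_sum (Gd1n d n) (map (weighted_fixed_words d n) (A # As)) (\<lambda>g. \<Xi> (fst g) (?w g))
        = (\<Sum>u\<in>carrier (Gd1n d n). weighted_fixed_words d n A u * Y \<Xi> (fst u) (?w u))" for \<Xi>
      unfolding conv_sum.simps list.map Y_def
      by (intro sum.cong refl arg_cong2[of _ _ _ _ "(*)"] conv_sum_cong)
        (simp add: total_weight_mult, simp add: Gd1n_simps)
    have Y': "Y (\<lambda>\<pi> w. \<Xi> \<pi> ((w + 1) mod d)) \<pi> w = Y \<Xi> \<pi> ((w + 1) mod d)" for \<pi> w
      unfolding Y_def by (intro conv_sum_cong) (simp add: mod_simps)
    have "(\<Sum>u\<in>carrier (Gd1n d n). weighted_fixed_words d n A u * Y \<Xi> (fst u) (?w u))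
        = (\<Sum>u\<in>carrier (Gd1n d n). weighted_fixed_words d n A u * Y (\<lambda>\<pi> w. \<Xi> \<pi> ((w + 1) mod d)) (fst u) (?w u))"
    proof (cases "0 \<in># A")
      case True
      thus ?thesis
        unfolding sum_carrier_Gd1n Y' fst_conv
        by (intro sum.cong refl sum_weighted_fixed_words_shift) (use d in auto)
    next
      case False
      hence ex: "\<exists>A\<in>set As. 0 \<in># A" using Cons.prems by simp
      have "Y \<Xi> \<pi> w = Y (\<lambda>\<pi> w. \<Xi> \<pi> ((w + 1) mod d)) \<pi> w" for \<pi> w
        using Cons.IH[OF ex, of "\<lambda>\<sigma> v. \<Xi> (\<pi> \<circ> \<sigma>) ((w + v) mod d)"] unfolding Y_def
        by (simp add: mod_simps)
      thus ?thesis by simp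
    qed
    thus ?case using Y[of \<Xi>] Y[of "\<lambda>\<pi> w. \<Xi> \<pi> ((w + 1) mod d)"] by simp
  qed simp
qed

text \<open>A target that does not see the exponents lets every exponent vector be summed out on its
  own, which contributes \<open>d ^ n\<close> per factor.\<close>

lemma conv_sum_perm_part:
  assumes d: "d > 0"
  shows "conv_sum (Gd1n d n) (map (weighted_fixed_words d n) As) (\<lambda>g. \<Xi> (fst g))
    = of_nat d ^ (n * length As) * conv_sum (perm_group {..<n}) (map (num_fixed_words {..<n}) As) \<Xi>"
proof (induction As arbitrary: \<Xi>)
  case (Cons A As)
  let ?cs = "conv_sum (Gd1n d n) (map (weighted_fixed_words d n) As)"
  let ?ps = "conv_sum (perm_group {..<n}) (map (num_fixed_words {..<n}) As)"
  have "conv_sum (Gd1n d n) (map (weighted_fixed_words d n) (A # As)) (\<lambda>g. \<Xi> (fst g))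
      = (\<Sum>u\<in>carrier (Gd1n d n). weighted_fixed_words d n A u * ?cs (\<lambda>g. \<Xi> (fst u \<circ> fst g)))"
    by (simp add: Gd1n_simps(2))
  also have "\<dots> = (\<Sum>\<pi> | \<pi> permutes {..<n}. (\<Sum>a\<in>exponent_vectors d n. weighted_fixed_words d n A (\<pi>, a)) *
      (of_nat d ^ (n * length As) * ?ps (\<lambda>\<sigma>. \<Xi> (\<pi> \<circ> \<sigma>))))"
    by (simp add: sum_carrier_Gd1n sum_distrib_right Cons.IH[of "\<lambda>\<sigma>. \<Xi> (_ \<circ> \<sigma>)"])
  also have "\<dots> = (\<Sum>\<pi> | \<pi> permutes {..<n}. of_nat d ^ (n * length (A # As)) *
      (num_fixed_words {..<n} A \<pi> * ?ps (\<lambda>\<sigma>. \<Xi> (\<pi> \<circ> \<sigma>))))"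
    by (intro sum.cong refl) (simp add: sum_weighted_fixed_words[OF _ d] power_add)
  finally show ?case by (simp add: sum_distrib_left)
qed (simp add: Gd1n_simps)

text \<open>If the total weight is nonzero, so is the weight of some cycle; without colour 0 this
  cycle has a nonzero colour and makes every word weight vanish.\<close>

lemma weighted_fixed_words_eq_0:
  assumes u: "u \<in> carrier (Gd1n d n)" and w: "total_weight d n u \<noteq> 0" and A: "0 \<notin># A"
  shows "weighted_fixed_words d n A u = 0"
  unfolding weighted_fixed_words_def
proof (rule sum.neutral, rule ballI)
  fix f assume "f \<in> {f. f \<in> words {..<n} A \<and> fixes_word {..<n} (fst u) f}"
  hence f: "f \<in> words {..<n} A" by auto
  have \<pi>: "fst u permutes {..<n}" using u by (auto simp: carrier_Gd1n)
  let ?O = "orbit (fst u) ` {..<n}"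
  have "\<exists>C\<in>?O. cycle_weight d u C \<noteq> 0"
  proof (rule ccontr)
    assume "\<not> (\<exists>C\<in>?O. cycle_weight d u C \<noteq> 0)"
    hence "(\<Sum>C\<in>?O. cycle_weight d u C) = 0" by simp
    hence "(\<Sum>C\<in>?O. sum (snd u) C) mod d = 0" unfolding cycle_weight_def by (metis mod_0 mod_sum_eq)
    thus False using w sum_orbits[OF \<pi>, of "snd u"] by (simp add: total_weight_def)
  qed
  then obtain C where C: "C \<in> ?O" "cycle_weight d u C \<noteq> 0" by blast
  then obtain x where x: "x \<in> C" using orbits_ne[OF \<pi>] by blast
  have "x < n" using x C orbit_sub[OF \<pi>] by blast
  hence "f x \<in># A" using words_range[of "{..<n}" f A x] f by simp
  hence "f x \<noteq> 0" using A by metis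
  hence "(if \<forall>x\<in>C. f x = 0 then 1 else if cycle_weight d u C = 0 then of_nat d else 0) = (0 :: rat)"
    using x C by auto
  thus "word_weight d n u f = 0" unfolding word_weight_def
    by (intro prod_zero bexI[OF _ C(1)]) simp_all
qed

lemma total_weight_one: "total_weight d n (one (Gd1n d n)) = 0"
  by (simp add: total_weight_def Gd1n_simps)

lemma conv_sum_weight_0:
  assumes d: "d > 0" and A: "\<And>A. A \<in> set As \<Longrightarrow> 0 \<notin># A" and c: "total_weight d n c \<noteq> 0"
  shows "conv_sum (Gd1n d n) (map (weighted_fixed_words d n) As) (\<lambda>g. if g = c then 1 else 0) = 0"
proof -
  interpret group "Gd1n d n" by (rule group_Gd1n) (use d in simp)
  show ?thesis
    by (rule conv_sum_eq_0[of _ "{g. total_weight d n g = 0}"])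
      (use A c weighted_fixed_words_eq_0 in \<open>auto simp: total_weight_one total_weight_mult\<close>)
qed

text \<open>The conjugator is built by walking along both cycles from 0: \<open>\<sigma>\<close>
  matches the positions reached after the same number of steps, and \<open>b\<close> accumulates the
  differences of the exponents met on the way.\<close>

lemma single_cycles_conjugate:
  assumes d: "d > 0" and n: "n > 0"
    and c: "c \<in> carrier (Gd1n d n)" "single_cycle {..<n} (fst c)"
    and c': "c' \<in> carrier (Gd1n d n)" "single_cycle {..<n} (fst c')"
    and w: "total_weight d n c = total_weight d n c'"
  shows "\<exists>x\<in>carrier (Gd1n d n). mult (Gd1n d n) c' x = mult (Gd1n d n) x c"
proof -
  define s where "s i = (fst c ^^ i) 0" for i
  define s' where "s' i = (fst c' ^^ i) 0" for i
  have bij: "bij_betw s {..<n} {..<n}" "s n = s 0"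
    using single_cycle_enum[OF _ c(2), of 0] n by (auto simp: s_def[abs_def])
  have bij': "bij_betw s' {..<n} {..<n}" "s' n = s' 0"
    using single_cycle_enum[OF _ c'(2), of 0] n by (auto simp: s'_def[abs_def])
  define t where "t = the_inv_into {..<n} s"
  have inj: "inj_on s {..<n}" using bij by (simp add: bij_betw_def)
  have ts: "t (s j) = j" if "j < n" for j
    using the_inv_into_f_f[OF inj] that by (simp add: t_def)
  have tb: "bij_betw t {..<n} {..<n}" unfolding t_def by (rule bij_betw_the_inv_into[OF bij(1)])
  have sn: "s j < n" "s' j < n" if "j < n" for j
    using bij(1) bij'(1) that by (auto simp: bij_betw_def)
  define \<sigma> where "\<sigma> i = (if i < n then s' (t i) else i)" for i
  \<comment> \<open>The summand \<open>d - snd c (s l)\<close> stands for subtraction modulo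
    \<open>d\<close> and stays within the natural numbers.\<close>
  define B where "B j = (\<Sum>l<j. snd c' (s' l) + (d - snd c (s l)))" for j
  define b where "b i = (if i < n then B (t i) mod d else 0)" for i
  have cd: "snd c i < d" if "i < n" for i using c that by (auto simp: Gd1n_simps)
  have "bij_betw (s' \<circ> t) {..<n} {..<n}" by (rule bij_betw_trans[OF tb bij'(1)])
  hence "bij_betw \<sigma> {..<n} {..<n}" by (subst bij_betw_cong[where g = "s' \<circ> t"]) (auto simp: \<sigma>_def)
  hence \<sigma>: "\<sigma> permutes {..<n}" by (rule bij_imp_permutes) (simp add: \<sigma>_def)
  have x: "(\<sigma>, b) \<in> carrier (Gd1n d n)" using \<sigma> d by (auto simp: Gd1n_simps b_def)
  have \<sigma>s: "\<sigma> (s j) = s' j" if "j \<le> n" for j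
    using that ts[of j] ts[of 0] sn[of j] sn[of 0] bij(2) bij'(2) n
    by (cases "j = n") (auto simp: \<sigma>_def)
  have "(\<Sum>l<n. snd c (s l)) = (\<Sum>i<n. snd c i)" by (rule sum.reindex_bij_betw[OF bij(1)])
  moreover have "(\<Sum>l<n. snd c' (s' l)) = (\<Sum>i<n. snd c' i)" by (rule sum.reindex_bij_betw[OF bij'(1)])
  moreover have "B n + (\<Sum>l<n. snd c (s l)) = (\<Sum>l<n. snd c' (s' l)) + n * d"
  proof -
    have "B n + (\<Sum>l<n. snd c (s l)) = (\<Sum>l<n. snd c' (s' l) + d)"
      unfolding B_def sum.distrib[symmetric]
    proof (rule sum.cong[OF refl])
      fix l assume "l \<in> {..<n}"
      hence "snd c (s l) < d" using cd sn by simp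
      thus "snd c' (s' l) + (d - snd c (s l)) + snd c (s l) = snd c' (s' l) + d" by simp
    qed
    thus ?thesis by (simp add: sum.distrib)
  qed
  \<comment> \<open>Equality of the total weights is exactly the condition for \<open>b\<close> to
    close up after one full turn.\<close>
  ultimately have "(B n + (\<Sum>i<n. snd c i)) mod d = (0 + (\<Sum>i<n. snd c i)) mod d"
    using w by (simp add: total_weight_def)
  hence Bn: "B n mod d = 0"
    using cong_add_rcancel_nat[of "B n" _ 0 d] by (simp add: cong_def)
  have bs: "b (s j) = B j mod d" if "j \<le> n" for j
    using that ts[of j] ts[of 0] sn[of j] sn[of 0] bij(2) Bn n
    by (cases "j = n") (auto simp: b_def B_def)
  have cs: "fst c (s j) = s (Suc j)" "fst c' (s' j) = s' (Suc j)" for j by (simp_all add: s_def s'_def)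
  have out: "fst c i = i" "fst c' i = i" "snd c i = 0" "snd c' i = 0" if "i \<ge> n" for i
    using c(1) c'(1) that by (auto simp: Gd1n_simps permutes_not_in)
  have "(fst c' (\<sigma> i), (snd c' (\<sigma> i) + b i) mod d) = (\<sigma> (fst c i), (b (fst c i) + snd c i) mod d)" for i
  proof (cases "i < n")
    case True
    then obtain j where j: "j < n" "i = s j" using bij(1) by (auto simp: bij_betw_def)
    have "(b (s (Suc j)) + snd c (s j)) mod d = (B j + snd c' (s' j) + (d - snd c (s j)) + snd c (s j)) mod d"
      using j by (simp add: bs B_def mod_simps add.assoc)
    also have "B j + snd c' (s' j) + (d - snd c (s j)) + snd c (s j) = B j + snd c' (s' j) + d"
      using cd[OF sn(1)[OF j(1)]] by simp
    finally show ?thesis using j by (simp add: \<sigma>s cs bs mod_simps add.commute)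
  next
    case False
    thus ?thesis by (simp add: out \<sigma>_def b_def)
  qed
  hence "mult (Gd1n d n) c' (\<sigma>, b) = mult (Gd1n d n) (\<sigma>, b) c"
    by (auto simp: Gd1n_simps fun_eq_iff)
  thus ?thesis using x by blast
qed

lemma card_exponent_vectors_weight:
  assumes "n > 0" "w < d"
  shows "card {a \<in> exponent_vectors d n. (\<Sum>i<n. a i) mod d = w} = d ^ (n - 1)"
proof -
  have "(\<Sum>a\<in>exponent_vectors d n. if (\<Sum>i<n. a i) mod d = w then 1 else 0)
      = (\<Sum>a\<in>{..<n} \<rightarrow>\<^sub>E {..<d}. if (\<Sum>i<n. a i) mod d = w then 1 else (0::nat))"
    by (rule sum_exponent_vectors) (metis lessThan_iff sum.cong)
  hence "card {a \<in> exponent_vectors d n. (\<Sum>i<n. a i) mod d = w}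
      = card {a \<in> {..<n} \<rightarrow>\<^sub>E {..<d}. (\<Sum>i<n. a i) mod d = w}"
    using finite_exponent_vectors[of d n] by (simp add: sum.If_cases Int_def finite_PiE)
  thus ?thesis using card_funcset_sum_mod[of "{..<n}" w d] assms by auto
qed

lemma order_Gd1n: "order (Gd1n d n) = d ^ n * fact n"
proof -
  have "(\<Sum>a\<in>exponent_vectors d n. 1) = (\<Sum>a\<in>{..<n} \<rightarrow>\<^sub>E {..<d}. 1 :: nat)"
    by (rule sum_exponent_vectors) simp
  hence "card (exponent_vectors d n) = d ^ n" by (simp add: card_funcsetE)
  thus ?thesis by (simp add: order_def carrier_Gd1n card_cartesian_product card_permutations)
qed

text \<open>The count is the same for all members of the conjugacy class \<open>K\<close> of
  \<open>c\<close>, and by the shift argument the total over single cycles of a given weight does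
  not depend on the weight. Adding up all \<open>d\<close> weights leaves a target that depends on
  the permutation part alone.\<close>

lemma conv_sum_single_cycle_element:
  assumes d: "d > 0" and n: "n > 0" and As: "As \<noteq> []" "\<And>A. A \<in> set As \<Longrightarrow> size A = n"
    and ex0: "\<exists>A\<in>set As. 0 \<in># A"
    and cls: "\<And>A x g. A \<in> set As \<Longrightarrow> x \<in> carrier (Gd1n d n) \<Longrightarrow> g \<in> carrier (Gd1n d n) \<Longrightarrow>
      weighted_fixed_words d n A (x \<otimes>\<^bsub>Gd1n d n\<^esub> g \<otimes>\<^bsub>Gd1n d n\<^esub> inv\<^bsub>Gd1n d n\<^esub> x) = weighted_fixed_words d n A g"
    and c: "c \<in> carrier (Gd1n d n)" "single_cycle {..<n} (fst c)"
  shows "conv_sum (Gd1n d n) (map (weighted_fixed_words d n) As) (\<lambda>g. if g = c then 1 else 0)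
    = of_nat (order (Gd1n d n) ^ (length As - 1)) * hook_sum n (map (\<lambda>A. card (set_mset A)) As)"
proof -
  interpret group "Gd1n d n" by (rule group_Gd1n) (use d in simp)
  let ?G = "Gd1n d n" and ?w = "total_weight d n"
  let ?T = "conv_sum ?G (map (weighted_fixed_words d n) As)"
  define N where "N = ?T (\<lambda>g. if g = c then 1 else 0)"
  define K where "K = {g \<in> carrier ?G. single_cycle {..<n} (fst g) \<and> ?w g = ?w c}"
  have finK: "finite K" unfolding K_def using finite_carrier_Gd1n by simp
  have const: "?T (\<lambda>g. if g = c' then 1 else 0) = N" if c': "c' \<in> K" for c'
  proof -
    obtain x where x: "x \<in> carrier ?G" "c' \<otimes>\<^bsub>?G\<^esub> x = x \<otimes>\<^bsub>?G\<^esub> c"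
      using single_cycles_conjugate[OF d n c, of c'] c' by (auto simp: K_def)
    have c'x: "c' = x \<otimes>\<^bsub>?G\<^esub> c \<otimes>\<^bsub>?G\<^esub> inv\<^bsub>?G\<^esub> x"
      using x c(1) c' by (metis (no_types, lifting) K_def inv_solve_right' m_closed mem_Collect_eq)
    have "?T (\<lambda>g. if g = c' then 1 else 0)
        = ?T (\<lambda>g. if x \<otimes>\<^bsub>?G\<^esub> g \<otimes>\<^bsub>?G\<^esub> inv\<^bsub>?G\<^esub> x = c' then 1 else 0)"
    proof (rule conv_sum_conj[symmetric, OF _ x(1)])
      fix z y g assume z: "z \<in> set (map (weighted_fixed_words d n) As)" and yg: "y \<in> carrier ?G" "g \<in> carrier ?G"
      then obtain A where A: "A \<in> set As" "z = weighted_fixed_words d n A" by auto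
      show "z (y \<otimes>\<^bsub>?G\<^esub> g \<otimes>\<^bsub>?G\<^esub> inv\<^bsub>?G\<^esub> y) = z g" unfolding A(2) by (rule cls[OF A(1) yg])
    qed
    also have "\<dots> = N" unfolding N_def
      by (rule conv_sum_cong) (use x c(1) c'x in auto)
    finally show ?thesis .
  qed
  have "of_nat (card K) * N = (\<Sum>c'\<in>K. ?T (\<lambda>g. if g = c' then 1 else 0))"
    by (simp add: const)
  also have "\<dots> = ?T (\<lambda>g. \<Sum>c'\<in>K. if g = c' then 1 else 0)" by (simp add: conv_sum_sum)
  also have "\<dots> = ?T (\<lambda>g. if single_cycle {..<n} (fst g) \<and> ?w g = ?w c then 1 else 0)"
    by (rule conv_sum_cong) (use finK in \<open>auto simp: K_def\<close>)
  finally have KN: "of_nat (card K) * N = ?T (\<lambda>g. if single_cycle {..<n} (fst g) \<and> ?w g = ?w c then 1 else 0)" .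
  define \<Xi> where "\<Xi> v = ?T (\<lambda>g. if single_cycle {..<n} (fst g) \<and> ?w g = v then 1 else 0)" for v
  have wd: "?w g < d" for g using d by (simp add: total_weight_def)
  have step: "\<Xi> v = \<Xi> (Suc v)" if "Suc v < d" for v
  proof -
    have "\<Xi> (Suc v) = ?T (\<lambda>g. if single_cycle {..<n} (fst g) \<and> (?w g + 1) mod d = Suc v then 1 else 0)"
      unfolding \<Xi>_def
      by (rule conv_sum_shift[OF d ex0, of n "\<lambda>\<pi> w. if single_cycle {..<n} \<pi> \<and> w = Suc v then 1 else 0"])
    also have "\<dots> = \<Xi> v" unfolding \<Xi>_def
    proof (rule conv_sum_cong)
      fix g
      have "(?w g + 1) mod d = Suc v \<longleftrightarrow> ?w g = v"
        using wd[of g] that by (cases "?w g + 1 = d") auto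
      thus "(if single_cycle {..<n} (fst g) \<and> (?w g + 1) mod d = Suc v then 1 else 0)
        = (if single_cycle {..<n} (fst g) \<and> ?w g = v then 1 else (0::rat))" by simp
    qed
    finally show ?thesis ..
  qed
  have "v < d \<longrightarrow> \<Xi> v = \<Xi> 0" for v by (induction v) (use step in auto)
  hence eqd: "\<Xi> v = \<Xi> (?w c)" if "v < d" for v using that wd[of c] by metis
  have "of_nat d * \<Xi> (?w c) = (\<Sum>v<d. \<Xi> v)" using eqd by simp
  also have "\<dots> = ?T (\<lambda>g. \<Sum>v<d. if single_cycle {..<n} (fst g) \<and> ?w g = v then 1 else 0)"
    by (simp add: \<Xi>_def conv_sum_sum)
  also have "\<dots> = ?T (\<lambda>g. if single_cycle {..<n} (fst g) then 1 else 0)"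
    by (rule conv_sum_cong) (use wd in auto)
  also have "\<dots> = of_nat d ^ (n * length As) * conv_sum (perm_group {..<n}) (map (num_fixed_words {..<n}) As)
      (\<lambda>\<pi>. if single_cycle {..<n} \<pi> then 1 else 0)"
    by (rule conv_sum_perm_part[OF d])
  finally have "of_nat n * (of_nat d * \<Xi> (?w c)) = of_nat d ^ (n * length As) * (fact n ^ length As *
      hook_sum n (map (\<lambda>A. card (set_mset A)) As))"
    using single_cycle_conv_sum[of "{..<n}" As] As(2) n by (auto simp: mult_ac)
  hence eq: "of_nat n * of_nat d * of_nat (card K) * N
      = (of_nat d ^ n * fact n) ^ length As * hook_sum n (map (\<lambda>A. card (set_mset A)) As)"
    unfolding \<Xi>_def KN[symmetric] by (simp add: power_mult power_mult_distrib mult_ac)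
  have "K = {\<pi>. single_cycle {..<n} \<pi>} \<times> {a \<in> exponent_vectors d n. (\<Sum>i<n. a i) mod d = ?w c}"
  proof (rule Set.set_eqI)
    fix g :: gelem
    have "fst g permutes {..<n}" if "single_cycle {..<n} (fst g)" using that by (simp add: single_cycle_def)
    thus "g \<in> K \<longleftrightarrow> g \<in> {\<pi>. single_cycle {..<n} \<pi>} \<times> {a \<in> exponent_vectors d n. (\<Sum>i<n. a i) mod d = ?w c}"
      unfolding K_def carrier_Gd1n total_weight_def[of d n g] mem_Times_iff mem_Collect_eq by blast
  qed
  hence "card K = fact (n - 1) * d ^ (n - 1)"
    using card_single_cycles[of "{..<n}"] n card_exponent_vectors_weight[OF n wd]
    by (auto simp: card_cartesian_product)
  \<comment> \<open>Here n d |K| is the order of the group, which cancels one of the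
    \<open>length As\<close> powers of it.\<close>
  hence "of_nat n * of_nat d * of_nat (card K) = (of_nat d ^ n * fact n :: rat)"
    using n by (cases n) (simp_all add: mult_ac)
  hence "(of_nat d ^ n * fact n) * N = (of_nat d ^ n * fact n) *
      ((of_nat d ^ n * fact n) ^ (length As - 1) * hook_sum n (map (\<lambda>A. card (set_mset A)) As))"
    using eq As(1) by (cases As) (simp_all add: mult_ac)
  moreover have "of_nat d ^ n * fact n \<noteq> (0 :: rat)" using d by simp
  ultimately have "N = (of_nat d ^ n * fact n) ^ (length As - 1) * hook_sum n (map (\<lambda>A. card (set_mset A)) As)"
    using d by simp
  thus ?thesis by (simp add: N_def order_Gd1n)
qed

section \<open>Conjugation invariance of the weight-zero cycle type\<close>

lemma orbit_conjugate:
  assumes "\<And>i. v (\<sigma> i) = \<sigma> (\<pi> i)"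
  shows "orbit v (\<sigma> x) = \<sigma> ` orbit \<pi> x"
proof -
  have "(v ^^ m) (\<sigma> x) = \<sigma> ((\<pi> ^^ m) x)" for m by (induction m) (simp_all add: assms)
  thus ?thesis by (auto simp: orbit_altdef)
qed

text \<open>Conjugation by \<open>x\<close> carries a cycle \<open>C\<close> to its image under
  \<open>\<sigma>\<close>. The exponents change by differences of \<open>snd x\<close> at
  neighbouring points of the cycle, and these sum to zero over \<open>C\<close>.\<close>

lemma weight0_cycle_type_conj:
  assumes d: "d > 0" and x: "x \<in> carrier (Gd1n d n)" and u: "u \<in> carrier (Gd1n d n)"
  shows "weight0_cycle_type d n (x \<otimes>\<^bsub>Gd1n d n\<^esub> u \<otimes>\<^bsub>Gd1n d n\<^esub> inv\<^bsub>Gd1n d n\<^esub> x) = weight0_cycle_type d n u"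
proof -
  interpret group "Gd1n d n" by (rule group_Gd1n) (use d in simp)
  let ?G = "Gd1n d n"
  define v where "v = x \<otimes>\<^bsub>?G\<^esub> u \<otimes>\<^bsub>?G\<^esub> inv\<^bsub>?G\<^esub> x"
  have vx: "v \<otimes>\<^bsub>?G\<^esub> x = x \<otimes>\<^bsub>?G\<^esub> u" using x u by (simp add: v_def m_assoc)
  define \<sigma> where "\<sigma> = fst x"
  have \<sigma>: "\<sigma> permutes {..<n}" using x by (auto simp: \<sigma>_def Gd1n_simps)
  have \<pi>: "fst u permutes {..<n}" using u by (auto simp: Gd1n_simps)
  have f: "fst v (\<sigma> i) = \<sigma> (fst u i)" for i
    using vx by (auto simp: Gd1n_simps \<sigma>_def fun_eq_iff)
  have s: "(snd v (\<sigma> i) + snd x i) mod d = (snd x (fst u i) + snd u i) mod d" for i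
    using vx by (auto simp: Gd1n_simps \<sigma>_def fun_eq_iff)
  let ?O = "\<lambda>u. orbit (fst u) ` {..<n}"
  have orb: "?O v = (`) \<sigma> ` ?O u"
  proof -
    have "?O v = (\<lambda>i. orbit (fst v) (\<sigma> i)) ` {..<n}"
      using permutes_image[OF \<sigma>] by (metis image_image)
    thus ?thesis by (simp add: orbit_conjugate[where v = "fst v" and \<sigma> = \<sigma> and \<pi> = "fst u", OF f] image_image)
  qed
  have injC: "inj_on \<sigma> C" for C using permutes_inj_on[OF \<sigma>] .
  have wt: "cycle_weight d v (\<sigma> ` C) = cycle_weight d u C" if C: "C \<in> ?O u" for C
  proof -
    obtain y where y: "C = orbit (fst u) y" using C by blast
    have fin: "finite C" by (rule finite_in_orbits[OF \<pi> C])
    have "fst u ` C \<subseteq> C" unfolding y by (auto intro: orbit.intros)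
    hence im: "fst u ` C = C" by (rule permutes_image_subset_eq[OF fin \<pi>])
    have b: "(\<Sum>i\<in>C. snd x (fst u i)) = (\<Sum>i\<in>C. snd x i)"
      using sum.reindex[OF permutes_inj_on[OF \<pi>, of C], of "snd x"] by (simp add: im comp_def)
    have "(\<Sum>i\<in>C. snd v (\<sigma> i) + snd x i) mod d = (\<Sum>i\<in>C. snd x (fst u i) + snd u i) mod d"
      by (metis (mono_tags, lifting) mod_sum_eq s sum.cong)
    hence "((\<Sum>i\<in>C. snd v (\<sigma> i)) + (\<Sum>i\<in>C. snd x i)) mod d = ((\<Sum>i\<in>C. snd u i) + (\<Sum>i\<in>C. snd x i)) mod d"
      by (simp add: sum.distrib b add.commute)
    hence "(\<Sum>i\<in>C. snd v (\<sigma> i)) mod d = (\<Sum>i\<in>C. snd u i) mod d"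
      using cong_add_rcancel_nat by (simp add: cong_def)
    thus ?thesis using sum.reindex[OF injC, of "snd v" C] by (simp add: cycle_weight_def comp_def)
  qed
  have "{C \<in> ?O v. cycle_weight d v C = 0} = (`) \<sigma> ` {C \<in> ?O u. cycle_weight d u C = 0}"
    unfolding orb using wt by auto
  moreover have "inj_on ((`) \<sigma>) {C \<in> ?O u. cycle_weight d u C = 0}"
    using permutes_inj[OF \<sigma>] by (auto simp: inj_on_def inj_image_eq_iff)
  ultimately have "mset_set {C \<in> ?O v. cycle_weight d v C = 0}
      = image_mset ((`) \<sigma>) (mset_set {C \<in> ?O u. cycle_weight d u C = 0})"
    by (simp add: image_mset_mset_set)
  thus ?thesis unfolding v_def[symmetric] weight0_cycle_type_def
    by (simp add: multiset.map_comp comp_def card_image[OF injC])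
qed

section \<open>Coxeter elements are single cycles of nonzero weight\<close>

lemma cis_root_power_eq_iff:
  assumes m: "m > 0"
  shows "cis (2 * pi / real m) ^ i = cis (2 * pi / real m) ^ j \<longleftrightarrow> [i = j] (mod m)"
proof -
  have *: "cis (2 * pi / real m) ^ i = cis (2 * pi / real m) ^ j \<longleftrightarrow> [i = j] (mod m)" if "j \<le> i" for i j
  proof -
    let ?z = "cis (2 * pi / real m)"
    have "?z ^ i = ?z ^ j \<longleftrightarrow> ?z ^ (i - j) = 1"
    proof -
      have "?z ^ i = ?z ^ (i - j) * ?z ^ j" using that by (simp flip: power_add)
      thus ?thesis by (simp add: cis_neq_zero)
    qed
    also have "?z ^ (i - j) = 1 \<longleftrightarrow> m dvd (i - j)"
    proof
      assume "m dvd (i - j)"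
      then obtain q where q: "i - j = m * q" by auto
      have "?z ^ m = 1" using m by (simp add: DeMoivre)
      thus "?z ^ (i - j) = 1" by (simp add: q power_mult)
    next
      assume "?z ^ (i - j) = 1"
      hence "cis (real (i - j) * (2 * pi / real m)) = 1" by (simp only: DeMoivre)
      hence "cos (real (i - j) * (2 * pi / real m)) = 1" by (metis cis.sel(1) one_complex.sel(1))
      then obtain q :: int where "real (i - j) * (2 * pi / real m) = of_int q * (2 * pi)"
        by (auto simp: cos_one_2pi_int)
      hence "real (i - j) = of_int q * real m" using m by (simp add: field_simps)
      hence "int (i - j) = q * int m" by (metis of_int_eq_iff of_int_mult of_int_of_nat_eq)
      hence "int m dvd int (i - j)" by simp
      thus "m dvd (i - j)" by simp
    qed
    also have "\<dots> \<longleftrightarrow> [i = j] (mod m)" using that by (simp add: cong_altdef_nat)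
    finally show ?thesis .
  qed
  show ?thesis using *[of j i] *[of i j] by (cases "j \<le> i") (auto simp: cong_sym_eq)
qed

lemma cis_root_power_mod: "d > 0 \<Longrightarrow> cis (2 * pi / real d) ^ (k mod d) = cis (2 * pi / real d) ^ k"
  by (simp add: cis_root_power_eq_iff)

text \<open>The eigenvector equation coordinate by coordinate, indexed by the source position
  \<open>x\<close>, so that no inverse permutation shows up.\<close>

definition acts_by :: "nat \<Rightarrow> nat \<Rightarrow> gelem \<Rightarrow> complex vec \<Rightarrow> complex \<Rightarrow> bool" where
  "acts_by d n g v z \<longleftrightarrow> (\<forall>x<n. cis (2 * pi / real d) ^ snd g x * v $ x = z * v $ fst g x)"

lemma gmat_mult_vec_index:
  assumes g: "g \<in> carrier (Gd1n d n)" and v: "v \<in> carrier_vec n" and x: "x < n"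
  shows "(gmat d n g *\<^sub>v v) $ fst g x = cis (2 * pi / real d) ^ snd g x * v $ x"
proof -
  have \<pi>: "fst g permutes {..<n}" using g by (auto simp: Gd1n_simps)
  have "fst g x < n" using permutes_in_image[OF \<pi>, of x] x by simp
  hence "(gmat d n g *\<^sub>v v) $ fst g x
      = (\<Sum>s = 0..<n. (if fst g x = fst g s then cis (2 * pi / real d) ^ snd g s else 0) * v $ s)"
    using v by (simp add: gmat_def scalar_prod_def)
  also have "\<dots> = (\<Sum>s\<in>{x}. cis (2 * pi / real d) ^ snd g s * v $ s)"
    using x permutes_inj[OF \<pi>] by (intro sum.mono_neutral_cong_right) (auto simp: inj_eq)
  finally show ?thesis by simp
qed

lemma gmat_eigen_iff_acts_by:
  assumes g: "g \<in> carrier (Gd1n d n)" and v: "v \<in> carrier_vec n"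
  shows "gmat d n g *\<^sub>v v = z \<cdot>\<^sub>v v \<longleftrightarrow> acts_by d n g v z"
proof -
  have \<pi>: "fst g permutes {..<n}" using g by (auto simp: Gd1n_simps)
  have lt: "fst g x < n" if "x < n" for x using permutes_in_image[OF \<pi>, of x] that by simp
  have dim: "dim_vec (gmat d n g *\<^sub>v v) = n" "dim_vec (z \<cdot>\<^sub>v v) = n" using v by (simp_all add: gmat_def)
  have "gmat d n g *\<^sub>v v = z \<cdot>\<^sub>v v \<longleftrightarrow> (\<forall>r<n. (gmat d n g *\<^sub>v v) $ r = z * v $ r)"
    using v dim by (auto simp: vec_eq_iff)
  also have "\<dots> \<longleftrightarrow> (\<forall>x<n. (gmat d n g *\<^sub>v v) $ fst g x = z * v $ fst g x)"
  proof (intro iffI allI impI)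
    fix r assume H: "\<forall>x<n. (gmat d n g *\<^sub>v v) $ fst g x = z * v $ fst g x" and r: "r < n"
    have "pinv (fst g) r < n" using permutes_in_image[OF permutes_inv[OF \<pi>], of r] r by simp
    thus "(gmat d n g *\<^sub>v v) $ r = z * v $ r"
      using H permutes_inverses(1)[OF \<pi>, of r] by metis
  qed (use lt in auto)
  also have "\<dots> \<longleftrightarrow> acts_by d n g v z"
    by (simp add: acts_by_def gmat_mult_vec_index[OF g v])
  finally show ?thesis .
qed

lemma fixed_space_iff_acts_by:
  assumes g: "g \<in> carrier (Gd1n d n)"
  shows "v \<in> fixed_space d n g \<longleftrightarrow> v \<in> carrier_vec n \<and> acts_by d n g v 1"
proof -
  have G: "gmat d n g \<in> carrier_mat n n" by (simp add: gmat_def)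
  have "(gmat d n g - 1\<^sub>m n) *\<^sub>v v = 0\<^sub>v n \<longleftrightarrow> gmat d n g *\<^sub>v v = 1 \<cdot>\<^sub>v v" if v: "v \<in> carrier_vec n"
  proof -
    have e: "(gmat d n g - 1\<^sub>m n) *\<^sub>v v = gmat d n g *\<^sub>v v - v"
      using minus_mult_distrib_mat_vec[OF G one_carrier_mat v] v by simp
    have "gmat d n g *\<^sub>v v \<in> carrier_vec n" using G v by simp
    thus ?thesis unfolding e using v carrier_matD(1)[OF G] by (auto simp: vec_eq_iff)
  qed
  moreover have "v \<in> fixed_space d n g \<longleftrightarrow> v \<in> carrier_vec n \<and> (gmat d n g - 1\<^sub>m n) *\<^sub>v v = 0\<^sub>v n"
    using G by (simp add: fixed_space_def mat_kernel_def)
  ultimately show ?thesis using gmat_eigen_iff_acts_by[OF g, of v 1] by blast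
qed

lemma Gd1n_pow:
  assumes d: "d > 0" and c: "c \<in> carrier (Gd1n d n)"
  shows "fst (c [^]\<^bsub>Gd1n d n\<^esub> m) = (fst c ^^ m)"
    and "snd (c [^]\<^bsub>Gd1n d n\<^esub> m) x = (\<Sum>j<m. snd c ((fst c ^^ j) x)) mod d"
proof -
  interpret group "Gd1n d n" by (rule group_Gd1n) (use d in simp)
  show "fst (c [^]\<^bsub>Gd1n d n\<^esub> m) = (fst c ^^ m)"
    by (induction m) (simp_all add: Gd1n_simps(2,3) funpow_swap1 comp_def fun_eq_iff)
  show "snd (c [^]\<^bsub>Gd1n d n\<^esub> m) x = (\<Sum>j<m. snd c ((fst c ^^ j) x)) mod d"
  proof (induction m arbitrary: x)
    case (Suc m)
    have "snd (c [^]\<^bsub>Gd1n d n\<^esub> Suc m) x = (snd (c [^]\<^bsub>Gd1n d n\<^esub> m) (fst c x) + snd c x) mod d"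
      by (simp add: Gd1n_simps(2))
    also have "\<dots> = (snd c x + (\<Sum>j<m. snd c ((fst c ^^ j) (fst c x)))) mod d"
      by (simp add: Suc.IH mod_simps add.commute)
    also have "snd c x + (\<Sum>j<m. snd c ((fst c ^^ j) (fst c x))) = (\<Sum>j<Suc m. snd c ((fst c ^^ j) x))"
      by (simp add: sum.lessThan_Suc_shift funpow_swap1 del: sum.lessThan_Suc)
    finally show ?case .
  qed (simp add: Gd1n_simps(3))
qed

lemma acts_by_pow:
  assumes d: "d > 0" and c: "c \<in> carrier (Gd1n d n)" and v: "acts_by d n c v z"
  shows "acts_by d n (c [^]\<^bsub>Gd1n d n\<^esub> m) v (z ^ m)"
proof -
  interpret group "Gd1n d n" by (rule group_Gd1n) (use d in simp)
  have \<pi>: "fst c permutes {..<n}" using c by (auto simp: Gd1n_simps)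
  show ?thesis
  proof (induction m)
    case 0 show ?case by (simp add: acts_by_def Gd1n_simps(3))
  next
    case (Suc m)
    let ?p = "c [^]\<^bsub>Gd1n d n\<^esub> m" and ?z = "cis (2 * pi / real d)"
    show ?case unfolding acts_by_def
    proof (intro allI impI)
      fix x assume x: "x < n"
      have px: "fst c x < n" using permutes_in_image[OF \<pi>, of x] x by simp
      have "?z ^ snd (c [^]\<^bsub>Gd1n d n\<^esub> Suc m) x * v $ x = ?z ^ snd ?p (fst c x) * (?z ^ snd c x * v $ x)"
        using d by (simp add: Gd1n_simps(2) cis_root_power_mod power_add)
      also have "\<dots> = z * (?z ^ snd ?p (fst c x) * v $ fst c x)" using v x by (simp add: acts_by_def)
      also have "\<dots> = z ^ Suc m * v $ fst ?p (fst c x)" using Suc px by (simp add: acts_by_def)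
      finally show "?z ^ snd (c [^]\<^bsub>Gd1n d n\<^esub> Suc m) x * v $ x = z ^ Suc m * v $ fst (c [^]\<^bsub>Gd1n d n\<^esub> Suc m) x"
        by (simp add: Gd1n_simps(2))
    qed
  qed
qed

text \<open>The kernel alone determines \<open>kernel_dim\<close>, so an echelon matrix with the
  same kernel can be supplied by hand instead of being computed from \<open>A\<close>.\<close>

lemma kernel_dim_row_echelon:
  assumes "B \<in> carrier_mat n n" "pivot_fun B f n" "A \<in> carrier_mat n n" "mat_kernel A = mat_kernel B"
  shows "kernel_dim A = n - card {i. i < n \<and> row B i \<noteq> 0\<^sub>v n}"
proof -
  have "row_echelon_form B" using assms by (auto simp: row_echelon_form_def)
  moreover have "kernel_dim A = kernel.dim n B" unfolding kernel_dim_def using assms by simp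
  ultimately show ?thesis using find_base_vectors(6)[of B n n] assms by simp
qed

text \<open>The reflection in the hyperplane \<open>v\<^sub>y = \<zeta>\<^sup>e v\<^sub>x\<close>.\<close>

lemma swap_reflection:
  assumes d: "d > 0" and xy: "x < y" "y < n" and e: "e < d"
  shows "\<exists>t. is_reflection d n t \<and>
    (\<forall>v\<in>carrier_vec n. cis (2 * pi / real d) ^ e * v $ x = v $ y \<longrightarrow> v \<in> fixed_space d n t)"
proof -
  let ?z = "cis (2 * pi / real d)"
  \<comment> \<open>The exponents at \<open>x\<close> and \<open>y\<close> cancel modulo
    \<open>d\<close>, so the equations at these two positions both amount to the equation of the
    hyperplane.\<close>
  define t where "t = (transpose x y, \<lambda>i. if i = x then e else if i = y then (d - e) mod d else 0)"
  have tp: "transpose x y permutes {..<n}" by (rule permutes_swap_id) (use xy in auto)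
  have t: "t \<in> carrier (Gd1n d n)" using tp d e xy by (auto simp: t_def Gd1n_simps)
  have inv: "?z ^ ((d - e) mod d) * ?z ^ e = 1"
  proof -
    have "?z ^ ((d - e) mod d) * ?z ^ e = ?z ^ d"
      using e by (simp add: cis_root_power_mod[OF d] flip: power_add)
    also have "\<dots> = ?z ^ 0" by (subst cis_root_power_eq_iff[OF d]) (simp add: cong_def)
    finally show ?thesis by simp
  qed
  have act: "acts_by d n t v 1 \<longleftrightarrow> ?z ^ e * v $ x = v $ y" for v
  proof
    assume "acts_by d n t v 1"
    hence "?z ^ snd t x * v $ x = 1 * v $ fst t x" using xy by (simp add: acts_by_def)
    thus "?z ^ e * v $ x = v $ y" by (simp add: t_def)
  next
    assume A: "?z ^ e * v $ x = v $ y"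
    have B: "?z ^ ((d - e) mod d) * v $ y = v $ x"
    proof -
      have "?z ^ ((d - e) mod d) * v $ y = (?z ^ ((d - e) mod d) * ?z ^ e) * v $ x"
        by (simp add: A[symmetric] mult.assoc)
      thus ?thesis by (simp only: inv mult_1)
    qed
    show "acts_by d n t v 1" unfolding acts_by_def
    proof (intro allI impI)
      fix w assume "w < n"
      consider "w = x" | "w = y" "w \<noteq> x" | "w \<noteq> x" "w \<noteq> y" by blast
      thus "?z ^ snd t w * v $ w = 1 * v $ fst t w"
        by cases (use A B in \<open>auto simp: t_def\<close>)
    qed
  qed
  have fs: "fixed_space d n t = {v \<in> carrier_vec n. ?z ^ e * v $ x = v $ y}"
    using fixed_space_iff_acts_by[OF t] act by auto
  define w where "w = ?z ^ ((d - e) mod d)"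
  \<comment> \<open>A matrix with one nonzero row, already in echelon form, whose kernel is the
    hyperplane; its pivot sits at \<open>x\<close> because \<open>x < y\<close>.\<close>
  define B where "B = mat n n (\<lambda>(i, j). if i = 0 then (if j = x then 1 else if j = y then - w else 0) else 0)"
  have B: "B \<in> carrier_mat n n" by (simp add: B_def)
  have piv: "pivot_fun B (\<lambda>i. if i = 0 then x else n) n"
    by (rule pivot_funI[where nr = n]) (use xy in \<open>auto simp: B_def split: if_splits\<close>)
  have Bv: "B *\<^sub>v v = 0\<^sub>v n \<longleftrightarrow> v $ x - w * v $ y = 0" if v: "v \<in> carrier_vec n" for v
  proof -
    have n0: "0 < n" using xy by simp
    have "(B *\<^sub>v v) $ 0 = (\<Sum>j = 0..<n. (if j = x then 1 else if j = y then - w else 0) * v $ j)"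
      using v n0 by (simp add: B_def scalar_prod_def)
    also have "\<dots> = (\<Sum>j\<in>{x, y}. (if j = x then 1 else if j = y then - w else 0) * v $ j)"
      using xy by (intro sum.mono_neutral_right) auto
    also have "\<dots> = v $ x - w * v $ y" using xy by simp
    finally have 0: "(B *\<^sub>v v) $ 0 = v $ x - w * v $ y" .
    have i: "(B *\<^sub>v v) $ i = 0" if "i < n" "i \<noteq> 0" for i
      using v that by (simp add: B_def scalar_prod_def)
    have dB: "dim_vec (B *\<^sub>v v) = n" by (simp add: B_def)
    show ?thesis
    proof
      assume "B *\<^sub>v v = 0\<^sub>v n"
      hence "(B *\<^sub>v v) $ 0 = 0\<^sub>v n $ 0" by (rule arg_cong)
      thus "v $ x - w * v $ y = 0" using 0 n0 by simp
    next
      assume "v $ x - w * v $ y = 0"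
      hence "(B *\<^sub>v v) $ j = 0" if "j < n" for j using that i 0 by (cases "j = 0") auto
      thus "B *\<^sub>v v = 0\<^sub>v n" using dB by (intro eq_vecI) auto
    qed
  qed
  have rel: "?z ^ e * a = b \<longleftrightarrow> a - w * b = 0" for a b
  proof
    assume "?z ^ e * a = b"
    hence "w * b = (w * ?z ^ e) * a" by (simp add: mult.assoc)
    thus "a - w * b = 0" using inv by (simp add: w_def)
  next
    assume "a - w * b = 0"
    hence "?z ^ e * a = (w * ?z ^ e) * b" by (simp add: mult_ac)
    thus "?z ^ e * a = b" using inv by (simp add: w_def)
  qed
  have "mat_kernel (gmat d n t - 1\<^sub>m n) = mat_kernel B"
    using fs Bv rel B by (auto simp: fixed_space_def mat_kernel_def)
  hence "kernel_dim (gmat d n t - 1\<^sub>m n) = n - card {i. i < n \<and> row B i \<noteq> 0\<^sub>v n}"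
    by (intro kernel_dim_row_echelon[OF B piv]) (auto simp: gmat_def)
  also have "{i. i < n \<and> row B i \<noteq> 0\<^sub>v n} = {0}"
  proof -
    have "row B i = 0\<^sub>v n" if "i < n" "i \<noteq> 0" for i using that by (intro eq_vecI) (auto simp: B_def)
    moreover have "row B 0 \<noteq> 0\<^sub>v n"
    proof
      assume "row B 0 = 0\<^sub>v n"
      hence "row B 0 $ x = 0\<^sub>v n $ x" by (rule arg_cong)
      thus False using xy by (simp add: B_def)
    qed
    ultimately show ?thesis using xy by auto
  qed
  finally have "is_reflection d n t" unfolding is_reflection_def using t xy by simp
  thus ?thesis using fs by (intro exI[of _ t]) auto
qed

text \<open>A full cycle of total weight 1 multiplies the vector of powers of \<open>w\<close> by
  \<open>z\<close>, a primitive root of unity of order nd, which gives the bound on the order.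
  Regularity holds because the ratio of two different coordinates is never a d-th root of
  unity.\<close>

lemma regular_element_exists:
  assumes d: "d \<ge> 2" and n: "n \<ge> 1"
  shows "\<exists>g. regular_element d n g \<and> n * d \<le> group.ord (Gd1n d n) g"
proof -
  interpret group "Gd1n d n" by (rule group_Gd1n) (use d in simp)
  let ?G = "Gd1n d n"
  let ?\<zeta> = "cis (2 * pi / real d)"
  define z where "z = cis (2 * pi / real (n * d))"
  define w where "w = cis (- (2 * pi / real (n * d)))"
  have nd: "n * d > 0" using d n by simp
  have zw: "z * w = 1" by (simp add: z_def w_def cis_mult)
  have z\<zeta>: "z ^ n = ?\<zeta>" using n d by (simp add: z_def DeMoivre)
  have zwp: "z ^ k * w ^ k = 1" for k using zw by (simp flip: power_mult_distrib)
  define g where "g = (\<lambda>i. if i < n then (if Suc i = n then 0 else Suc i) else i, \<lambda>i. if Suc i = n then 1 else (0::nat))"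
  have "fst g permutes {..<n}"
  proof (rule bij_imp_permutes)
    have inj: "inj_on (fst g) {..<n}" by (auto simp: inj_on_def g_def split: if_splits)
    moreover have "fst g ` {..<n} \<subseteq> {..<n}" by (auto simp: g_def)
    ultimately show "bij_betw (fst g) {..<n} {..<n}"
      by (simp add: bij_betw_def endo_inj_surj)
  qed (simp add: g_def)
  hence gG: "g \<in> carrier ?G" using d by (auto simp: Gd1n_simps g_def)
  define v where "v = vec n (\<lambda>x. w ^ x)"
  have v: "v \<in> carrier_vec n" by (simp add: v_def)
  have act: "acts_by d n g v z" unfolding acts_by_def
  proof (intro allI impI)
    fix x assume x: "x < n"
    show "?\<zeta> ^ snd g x * v $ x = z * v $ fst g x"
    proof (cases "Suc x = n")
      case True
      have "?\<zeta> * w ^ x = z * (z ^ x * w ^ x)" by (simp add: z\<zeta>[symmetric] True[symmetric])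
      thus ?thesis using x True n by (simp add: g_def v_def zwp)
    next
      case False
      hence "Suc x < n" using x by simp
      moreover have "w ^ x = z * w ^ Suc x" using zw by (simp add: mult.assoc[symmetric])
      ultimately show ?thesis using x False by (simp add: g_def v_def)
    qed
  qed
  have v0: "v $ 0 = 1" using n by (simp add: v_def)
  have ev: "eigenvector (gmat d n g) v z"
  proof -
    have "v \<noteq> 0\<^sub>v n" using v0 n by auto
    thus ?thesis using v act gmat_eigen_iff_acts_by[OF gG v, of z]
      by (simp add: eigenvector_def gmat_def)
  qed
  have noref: "v \<notin> fixed_space d n t" if t: "is_reflection d n t" for t
  proof
    assume "v \<in> fixed_space d n t"
    moreover have tG: "t \<in> carrier ?G" using t by (simp add: is_reflection_def)
    ultimately have a: "acts_by d n t v 1" using fixed_space_iff_acts_by by blast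
    have \<pi>: "fst t permutes {..<n}" using tG by (auto simp: Gd1n_simps)
    \<comment> \<open>An element of the group that fixes \<open>v\<close> turns out to be the
      identity; its fixed space is the whole space, so it is no reflection.\<close>
    have tx: "fst t x = x \<and> snd t x = 0" if x: "x < n" for x
    proof -
      define y where "y = fst t x"
      have y: "y < n" using permutes_in_image[OF \<pi>, of x] x by (simp add: y_def)
      have "?\<zeta> ^ snd t x * w ^ x = w ^ y" using a x y by (simp add: acts_by_def v_def y_def)
      hence "z ^ (n * snd t x) * w ^ x = w ^ y" by (simp add: power_mult z\<zeta>)
      hence "(z ^ (n * snd t x) * w ^ x) * (z ^ x * z ^ y) = w ^ y * (z ^ x * z ^ y)" by simp
      moreover have "(z ^ (n * snd t x) * w ^ x) * (z ^ x * z ^ y) = z ^ (n * snd t x + y) * (z ^ x * w ^ x)"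
        by (simp add: power_add mult_ac)
      moreover have "w ^ y * (z ^ x * z ^ y) = z ^ x * (z ^ y * w ^ y)" by (simp add: mult_ac)
      ultimately have "z ^ (n * snd t x + y) = z ^ x" by (simp add: zwp)
      hence c: "[n * snd t x + y = x] (mod n * d)"
        unfolding z_def by (simp only: cis_root_power_eq_iff[OF nd])
      hence "[n * snd t x + y = x] (mod n)" by (rule cong_modulus_mult_nat)
      hence "[y = x] (mod n)" by (simp add: cong_def)
      hence yx: "y = x" using x y by (simp add: cong_less_modulus_unique_nat)
      hence "[n * snd t x + x = 0 + x] (mod n * d)" using c by simp
      hence "[n * snd t x = 0] (mod n * d)" by (simp only: cong_add_rcancel_nat)
      hence "n * d dvd n * snd t x" by (simp add: cong_0_iff)
      hence "d dvd snd t x" using n by simp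
      moreover have "snd t x < d" using tG x by (auto simp: Gd1n_simps)
      ultimately have "snd t x = 0" by (metis dvd_imp_le not_gr_zero not_le)
      thus ?thesis using yx by (simp add: y_def)
    qed
    have "gmat d n t = 1\<^sub>m n"
      by (rule eq_matI) (auto simp: gmat_def tx)
    hence "gmat d n t - 1\<^sub>m n = 0\<^sub>m n n" by simp
    moreover have "kernel_dim (0\<^sub>m n n :: complex mat) = n - card {i. i < n \<and> row (0\<^sub>m n n :: complex mat) i \<noteq> 0\<^sub>v n}"
      by (rule kernel_dim_row_echelon[where f = "\<lambda>_. n"]) (auto intro: pivot_funI[where nr = n])
    moreover have "{i. i < n \<and> row (0\<^sub>m n n :: complex mat) i \<noteq> 0\<^sub>v n} = {}" by auto
    ultimately show False using t by (simp add: is_reflection_def)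
  qed
  have "regular_element d n g" unfolding regular_element_def using gG ev noref by blast
  moreover have "n * d \<le> ord g"
  proof -
    have "acts_by d n (g [^]\<^bsub>?G\<^esub> ord g) v (z ^ ord g)" using acts_by_pow[OF _ gG act] d by simp
    moreover have "g [^]\<^bsub>?G\<^esub> ord g = \<one>\<^bsub>?G\<^esub>" using gG by (rule pow_ord_eq_1)
    ultimately have "v $ 0 = z ^ ord g * v $ 0" using n by (auto simp: acts_by_def Gd1n_simps(3))
    hence "z ^ ord g = z ^ 0" using v0 by simp
    hence "n * d dvd ord g" unfolding z_def cis_root_power_eq_iff[OF nd] by (simp add: cong_0_iff)
    moreover have "ord g > 0" using ord_ge_1[OF finite_carrier_Gd1n gG] by simp
    ultimately show ?thesis by (rule dvd_imp_le)
  qed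
  ultimately show ?thesis by blast
qed

text \<open>Maximality and \<open>regular_element_exists\<close> give order at least nd. If the
  eigenvector is nonzero at a point on a cycle of length l, the order divides ld, which forces l =
  n. If the total weight were zero, the order would divide n, contradicting \<open_placeholder> d at
  least 2.\<close>

lemma coxeter_element_properties:
  assumes d: "d \<ge> 2" and n: "n \<ge> 1" and c: "coxeter_element d n c"
  shows "c \<in> carrier (Gd1n d n)" and "single_cycle {..<n} (fst c)" and "total_weight d n c \<noteq> 0"
proof -
  interpret group "Gd1n d n" by (rule group_Gd1n) (use d in simp)
  let ?G = "Gd1n d n" and ?\<zeta> = "cis (2 * pi / real d)"
  have d0: "d > 0" using d by simp
  have reg: "regular_element d n c" and ord: "ord c = Max (regular_integers d n)"
    using c by (auto simp: coxeter_element_def)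
  show cG: "c \<in> carrier ?G" using reg by (simp add: regular_element_def)
  have \<pi>: "fst c permutes {..<n}" using cG by (auto simp: Gd1n_simps)
  obtain g where g: "regular_element d n g" "n * d \<le> ord g" using regular_element_exists[OF d n] by blast
  have "ord g \<le> ord c" unfolding ord
    by (rule Max_ge[OF finite_regular_integers]) (use g in \<open>unfold regular_integers_def, blast\<close>)
  hence nd: "n * d \<le> ord c" using g by simp
  obtain v z where ev: "eigenvector (gmat d n c) v z"
    and noref: "\<And>t. is_reflection d n t \<Longrightarrow> v \<notin> fixed_space d n t"
    using reg by (auto simp: regular_element_def)
  have v: "v \<in> carrier_vec n" and v0: "v \<noteq> 0\<^sub>v n" and act: "acts_by d n c v z"
  proof -
    show "v \<in> carrier_vec n" "v \<noteq> 0\<^sub>v n" using ev by (auto simp: eigenvector_def gmat_def)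
    thus "acts_by d n c v z" using ev gmat_eigen_iff_acts_by[OF cG] by (auto simp: eigenvector_def)
  qed
  obtain i where i: "i < n" "v $ i \<noteq> 0" using v v0 by (metis carrier_vecD eq_vecI index_zero_vec)
  have norel0: "v $ y \<noteq> ?\<zeta> ^ k * v $ x" if xy: "x < y" "y < n" for x y k
  proof
    assume A: "v $ y = ?\<zeta> ^ k * v $ x"
    obtain t where t: "is_reflection d n t"
      "\<forall>v\<in>carrier_vec n. ?\<zeta> ^ (k mod d) * v $ x = v $ y \<longrightarrow> v \<in> fixed_space d n t"
      using swap_reflection[OF d0 xy, of "k mod d"] d0 by auto
    have "?\<zeta> ^ (k mod d) * v $ x = v $ y" by (simp add: A cis_root_power_mod[OF d0])
    thus False using noref[OF t(1)] t(2) v by blast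
  qed
  \<comment> \<open>The previous fact covers only \<open>x < y\<close>; the other order follows by
    inverting the root of unity.\<close>
  have norel: "y = x" if "x < n" "y < n" "v $ y = ?\<zeta> ^ k * v $ x" for x y k
  proof (rule ccontr)
    assume "y \<noteq> x"
    moreover have False if "y < x"
    proof -
      have "?\<zeta> ^ (d - k mod d) * ?\<zeta> ^ (k mod d) = ?\<zeta> ^ d"
        using d0 by (simp flip: power_add)
      also have "\<dots> = ?\<zeta> ^ 0" by (subst cis_root_power_eq_iff[OF d0]) (simp add: cong_def)
      finally have "?\<zeta> ^ (d - k mod d) * ?\<zeta> ^ k = 1" by (simp add: cis_root_power_mod[OF d0])
      hence "v $ x = ?\<zeta> ^ (d - k mod d) * v $ y"
        by (metis \<open>v $ y = ?\<zeta> ^ k * v $ x\<close> mult.assoc mult_1)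
      thus False using norel0[OF \<open>y < x\<close> \<open>x < n\<close>] by blast
    qed
    ultimately show False using norel0[of x y k] that by (meson linorder_neqE_nat)
  qed
  define l where "l = card (orbit (fst c) i)"
  have iO: "i \<in> orbit (fst c) i" by (rule self_in_orbit[OF \<pi>])
  have sub: "orbit (fst c) i \<subseteq> {..<n}" by (rule orbit_sub[OF \<pi> i(1)])
  have l_dist: "l = funpow_dist1 (fst c) i i"
    unfolding l_def orbit_conv_funpow_dist1[OF iO] card_image[OF inj_on_funpow_dist1[OF iO]] by simp
  have li: "(fst c ^^ l) i = i" unfolding l_dist by (rule funpow_dist1_prop[OF iO])
  have l0: "l > 0" by (simp add: l_dist)
  have actl: "acts_by d n (c [^]\<^bsub>?G\<^esub> l) v (z ^ l)" by (rule acts_by_pow[OF d0 cG act])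
  define b where "b = snd (c [^]\<^bsub>?G\<^esub> l)"
  have fl: "fst (c [^]\<^bsub>?G\<^esub> l) = fst c ^^ l" by (rule Gd1n_pow(1)[OF d0 cG])
  have bv: "?\<zeta> ^ b x * v $ x = z ^ l * v $ ((fst c ^^ l) x)" if "x < n" for x
    using actl that by (simp add: acts_by_def b_def fl)
  \<comment> \<open>After \<open>l\<close> steps the cycle is back at \<open>i\<close>; since
    \<open>v $ i\<close> is nonzero, \<open>z ^ l\<close> must be a power of the d-th root of
    unity.\<close>
  have zl: "z ^ l = ?\<zeta> ^ b i" using bv[OF i(1)] i(2) by (simp add: li)
  have pl: "c [^]\<^bsub>?G\<^esub> l \<in> carrier ?G" using cG by simp
  have \<pi>l: "(fst c ^^ l) permutes {..<n}" using pl unfolding fl[symmetric] by (auto simp: Gd1n_simps)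
  \<comment> \<open>The coordinates at \<open>x\<close> and at its image under the l-th power now
    differ by a power of the d-th root of unity, which \<open>norel\<close> permits only for equal
    positions.\<close>
  have idl: "(fst c ^^ l) x = x" for x
  proof (cases "x < n")
    case True
    let ?y = "(fst c ^^ l) x"
    have y: "?y < n" using permutes_in_image[OF \<pi>l, of x] True by simp
    have "b i < d" using pl i(1) by (auto simp: Gd1n_simps b_def)
    hence "?\<zeta> ^ (d - b i) * ?\<zeta> ^ b i = ?\<zeta> ^ d" by (simp flip: power_add)
    also have "\<dots> = ?\<zeta> ^ 0" by (subst cis_root_power_eq_iff[OF d0]) (simp add: cong_def)
    finally have one: "?\<zeta> ^ (d - b i) * ?\<zeta> ^ b i = 1" by simp
    have "v $ ?y = (?\<zeta> ^ (d - b i) * ?\<zeta> ^ b i) * v $ ?y" by (simp only: one mult_1)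
    also have "\<dots> = ?\<zeta> ^ (d - b i) * (?\<zeta> ^ b x * v $ x)" using bv[OF True] zl by (simp add: mult.assoc)
    also have "\<dots> = ?\<zeta> ^ (d - b i + b x) * v $ x" by (simp add: power_add)
    finally show ?thesis using norel[OF True y] by blast
  next
    case False thus ?thesis using permutes_not_in[OF \<pi>l] by simp
  qed
  have outside: "snd (c [^]\<^bsub>?G\<^esub> m) x = 0" if "x \<ge> n" for m :: nat and x
  proof -
    have "c [^]\<^bsub>?G\<^esub> m \<in> carrier ?G" using cG by simp
    thus ?thesis using that by (auto simp: Gd1n_simps)
  qed
  \<comment> \<open>The l-th power of \<open>c\<close> is diagonal with d-th roots of unity as
    entries, so its d-th power is trivial.\<close>
  have "c [^]\<^bsub>?G\<^esub> (l * d) = (c [^]\<^bsub>?G\<^esub> l) [^]\<^bsub>?G\<^esub> d" using cG by (simp add: nat_pow_pow)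
  also have "\<dots> = \<one>\<^bsub>?G\<^esub>"
  proof (rule prod_eqI)
    have idpow: "((fst (c [^]\<^bsub>?G\<^esub> l)) ^^ m) x = x" for m x by (induction m) (simp_all add: fl idl)
    show "fst ((c [^]\<^bsub>?G\<^esub> l) [^]\<^bsub>?G\<^esub> d) = fst \<one>\<^bsub>?G\<^esub>"
      unfolding Gd1n_pow(1)[OF d0 pl] by (auto simp: fun_eq_iff idpow Gd1n_simps(3))
    show "snd ((c [^]\<^bsub>?G\<^esub> l) [^]\<^bsub>?G\<^esub> d) = snd \<one>\<^bsub>?G\<^esub>"
      by (rule ext) (simp add: Gd1n_pow(2)[OF d0 pl] idpow Gd1n_simps(3))
  qed
  finally have "ord c dvd l * d" using pow_eq_id[OF cG] by simp
  hence "ord c \<le> l * d" using l0 d0 by (intro dvd_imp_le) auto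
  hence "n * d \<le> l * d" using nd by (rule order_trans[rotated])
  hence "n \<le> l" using d0 by simp
  hence orb: "orbit (fst c) i = {..<n}"
    using sub by (intro card_subset_eq) (auto simp: l_def intro!: antisym dest: card_mono[OF finite_lessThan])
  show sc: "single_cycle {..<n} (fst c)" unfolding single_cycle_def
  proof (intro conjI allI impI \<pi>)
    show "{..<n} \<noteq> {}" using n by (auto simp: lessThan_empty_iff)
    fix A assume A: "A \<subseteq> {..<n}" "A \<noteq> {}" "fst c ` A \<subseteq> A"
    then obtain y where y: "y \<in> A" by blast
    have "orbit (fst c) y \<subseteq> A"
    proof
      fix w assume "w \<in> orbit (fst c) y" thus "w \<in> A" by induction (use y A in auto)
    qed
    moreover have "orbit (fst c) y = {..<n}" using orbit_eq[OF \<pi>, of y i] y A orb by auto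
    ultimately show "A = {..<n}" using A by blast
  qed
  show "total_weight d n c \<noteq> 0"
  proof
    assume w0: "total_weight d n c = 0"
    \<comment> \<open>Along a full cycle, every entry of the exponent vector of the n-th power is
      the total weight.\<close>
    have "c [^]\<^bsub>?G\<^esub> n = \<one>\<^bsub>?G\<^esub>"
    proof (rule prod_eqI)
      have idn: "(fst c ^^ n) x = x" for x
      proof (cases "x < n")
        case True thus ?thesis using single_cycle_enum(2)[OF _ sc, of x] by simp
      next
        case False
        have "(fst c ^^ m) x = x" for m using False permutes_not_in[OF \<pi>, of x] by (induction m) auto
        thus ?thesis .
      qed
      show "fst (c [^]\<^bsub>?G\<^esub> n) = fst \<one>\<^bsub>?G\<^esub>"
        unfolding Gd1n_pow(1)[OF d0 cG] by (auto simp: fun_eq_iff idn Gd1n_simps(3))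
      show "snd (c [^]\<^bsub>?G\<^esub> n) = snd \<one>\<^bsub>?G\<^esub>"
      proof
        fix x
        have "snd (c [^]\<^bsub>?G\<^esub> n) x = 0"
        proof (cases "x < n")
          case True
          have "bij_betw (\<lambda>j. (fst c ^^ j) x) {..<n} {..<n}"
            using single_cycle_enum(1)[OF _ sc, of x] True by simp
          hence "(\<Sum>j<n. snd c ((fst c ^^ j) x)) = (\<Sum>j<n. snd c j)" by (rule sum.reindex_bij_betw)
          thus ?thesis using w0 by (simp add: Gd1n_pow(2)[OF d0 cG] total_weight_def)
        next
          case False thus ?thesis using outside by simp
        qed
        thus "snd (c [^]\<^bsub>?G\<^esub> n) x = snd \<one>\<^bsub>?G\<^esub> x" by (simp add: Gd1n_simps(3))
      qed
    qed
    hence "ord c dvd n" using pow_eq_id[OF cG] by simp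
    hence "ord c \<le> n" using n by (intro dvd_imp_le) auto
    hence "n * d \<le> n" using nd by (rule order_trans[rotated])
    thus False using n d by simp
  qed
qed

section \<open>The coefficients $M$\<close>

lemma prod_single:
  "finite I \<Longrightarrow> (\<Prod>i\<in>I. Poly_Mapping.single (m i) (a i)) = Poly_Mapping.single (\<Sum>i\<in>I. m i) (\<Prod>i\<in>I. a i)"
  for m :: "'i \<Rightarrow> 'b :: comm_monoid_add" and a :: "'i \<Rightarrow> 'c :: comm_semiring_1"
  by (induction I rule: finite_induct) (simp_all add: mult_single)

lemma xvar_power: "xvar i ^ j = Poly_Mapping.single (Poly_Mapping.single i j) 1"
  by (induction j) (simp_all add: xvar_def mult_single flip: single_add)

text \<open>The sum runs up to \<open>N\<close> for every \<open>r\<close>, so that products over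
  the variables can be expanded over one common index range.\<close>

lemma xvar_binomial_expansion:
  assumes "r \<le> N"
  shows "xvar i ^ r * (1 + xvar i) ^ (N - r)
    = (\<Sum>j\<le>N. Poly_Mapping.single (Poly_Mapping.single i j) (if r \<le> j then int ((N - r) choose (j - r)) else 0))"
proof -
  have of_nat_mult_xvar: "of_nat a * xvar i ^ j = Poly_Mapping.single (Poly_Mapping.single i j) (int a)" for a j
    unfolding xvar_power by (metis add_0 mult.right_neutral mult_single single_of_nat)
  have "xvar i ^ r * (1 + xvar i) ^ (N - r)
      = (\<Sum>j\<le>N - r. of_nat ((N - r) choose j) * xvar i ^ (j + r))"
    unfolding add.commute[of 1] binomial_ring
    by (simp add: sum_distrib_left power_add mult_ac)
  also have "\<dots> = (\<Sum>j\<in>{r..N}. of_nat ((N - r) choose (j - r)) * xvar i ^ j)"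
    by (rule sum.reindex_bij_witness[of _ "\<lambda>j. j - r" "\<lambda>j. j + r"]) (use assms in auto)
  also have "\<dots> = (\<Sum>j\<le>N. Poly_Mapping.single (Poly_Mapping.single i j)
      (if r \<le> j then int ((N - r) choose (j - r)) else 0))"
    unfolding of_nat_mult_xvar by (rule sum.mono_neutral_cong_left) auto
  finally show ?thesis .
qed

lemma sum_single_eq_iff:
  fixes g h :: "nat \<Rightarrow> nat"
  shows "(\<Sum>i<k. Poly_Mapping.single i (g i)) = (\<Sum>i<k. Poly_Mapping.single i (h i)) \<longleftrightarrow> (\<forall>i<k. g i = h i)"
proof -
  have "Poly_Mapping.lookup (\<Sum>i<k. Poly_Mapping.single i (g i)) j = (if j < k then g j else 0)" for j and g :: "nat \<Rightarrow> nat"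
  proof -
    have "Poly_Mapping.lookup (\<Sum>i<k. Poly_Mapping.single i (g i)) j = (\<Sum>i<k. if i = j then g i else 0)"
      by (simp add: lookup_sum lookup_single when_def)
    thus ?thesis by simp
  qed
  thus ?thesis by (auto simp: poly_mapping_eq_iff fun_eq_iff)
qed

lemma lookup_prod_xvar_expansion:
  fixes p :: "nat \<Rightarrow> nat" and N :: nat
  assumes "\<And>i. i < k \<Longrightarrow> p i \<le> N"
  shows "Poly_Mapping.lookup (\<Prod>i<k. \<Sum>j\<le>N. Poly_Mapping.single (Poly_Mapping.single i j) (a j))
    (\<Sum>i<k. Poly_Mapping.single i (p i)) = (\<Prod>i<k. a (p i) :: int)"
proof -
  let ?m = "\<Sum>i<k. Poly_Mapping.single i (p i)"
  have "(\<Prod>i<k. \<Sum>j\<le>N. Poly_Mapping.single (Poly_Mapping.single i j) (a j))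
      = (\<Sum>g\<in>{..<k} \<rightarrow>\<^sub>E {..N}. Poly_Mapping.single (\<Sum>i<k. Poly_Mapping.single i (g i)) (\<Prod>i<k. a (g i)))"
    by (subst prod_sum_PiE) (simp_all add: prod_single)
  hence "Poly_Mapping.lookup (\<Prod>i<k. \<Sum>j\<le>N. Poly_Mapping.single (Poly_Mapping.single i j) (a j)) ?m
      = (\<Sum>g\<in>{..<k} \<rightarrow>\<^sub>E {..N}. if (\<forall>i<k. g i = p i) then (\<Prod>i<k. a (g i)) else 0)"
    by (simp add: lookup_sum lookup_single when_def sum_single_eq_iff)
  also have "\<dots> = (\<Sum>g\<in>{restrict p {..<k}}. \<Prod>i<k. a (p i))"
  proof (rule sum.mono_neutral_cong_right)
    show "finite ({..<k} \<rightarrow>\<^sub>E {..N})" by (simp add: finite_PiE)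
    show "{restrict p {..<k}} \<subseteq> {..<k} \<rightarrow>\<^sub>E {..N}" using assms by auto
    show "\<forall>g\<in>({..<k} \<rightarrow>\<^sub>E {..N}) - {restrict p {..<k}}. (if \<forall>i<k. g i = p i then \<Prod>i<k. a (g i) else 0) = 0"
    proof
      fix g assume g: "g \<in> ({..<k} \<rightarrow>\<^sub>E {..N}) - {restrict p {..<k}}"
      have "\<not> (\<forall>i<k. g i = p i)"
      proof
        assume "\<forall>i<k. g i = p i"
        hence "g = restrict p {..<k}" using g by (auto simp: fun_eq_iff PiE_def extensional_def)
        thus False using g by blast
      qed
      thus "(if \<forall>i<k. g i = p i then \<Prod>i<k. a (g i) else 0) = 0" by (rule if_not_P)
    qed
  qed auto
  finally show ?thesis by simp
qed

text \<open>Each term of the binomial expansion of the N-th power is a product of one-variable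
  polynomials \<open>xvar i ^ r * (1 + xvar i) ^ (N - r)\<close>, so its coefficients factor over
  the variables.\<close>

lemma Mcoeff_expansion:
  assumes "\<And>p. p \<in> set ps \<Longrightarrow> p \<le> N"
  shows "Mcoeff N (map int ps)
    = (\<Sum>r\<le>N. (-1) ^ r * int (N choose r) * (\<Prod>i<length ps. if r \<le> ps ! i then int ((N - r) choose (ps ! i - r)) else 0))"
proof -
  let ?k = "length ps"
  let ?m = "\<Sum>i<?k. Poly_Mapping.single i (ps ! i)"
  let ?X = "\<Prod>i<?k. xvar i" and ?Y = "\<Prod>i<?k. 1 + xvar i"
  let ?b = "\<lambda>r j. if r \<le> j then int ((N - r) choose (j - r)) else 0"
  have "(?Y - ?X) ^ N = (\<Sum>r\<le>N. of_nat (N choose r) * (- ?X) ^ r * ?Y ^ (N - r))"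
    unfolding diff_conv_add_uminus add.commute[of ?Y] by (rule binomial_ring)
  also have "\<dots> = (\<Sum>r\<le>N. Poly_Mapping.single 0 ((-1) ^ r * int (N choose r)) *
      (\<Prod>i<?k. \<Sum>j\<le>N. Poly_Mapping.single (Poly_Mapping.single i j) (?b r j)))"
  proof (rule sum.cong[OF refl])
    fix r assume "r \<in> {..N}"
    hence r: "r \<le> N" by simp
    have "(\<Prod>i<?k. \<Sum>j\<le>N. Poly_Mapping.single (Poly_Mapping.single i j) (?b r j)) = ?X ^ r * ?Y ^ (N - r)"
      by (simp add: xvar_binomial_expansion[OF r, symmetric] prod.distrib prod_power_distrib)
    moreover have "Poly_Mapping.single (0 :: nat \<Rightarrow>\<^sub>0 nat) ((-1) ^ r * int (N choose r)) = (-1) ^ r * of_nat (N choose r)"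
    proof -
      have "Poly_Mapping.single (0 :: nat \<Rightarrow>\<^sub>0 nat) ((-1) ^ r * int (N choose r)) = of_int ((-1) ^ r * int (N choose r))"
        by (metis of_int_eq_id id_apply single_of_int)
      thus ?thesis by simp
    qed
    moreover have "(- ?X) ^ r = (-1) ^ r * ?X ^ r" by (rule power_minus)
    ultimately show "of_nat (N choose r) * (- ?X) ^ r * ?Y ^ (N - r)
      = Poly_Mapping.single 0 ((-1) ^ r * int (N choose r)) *
        (\<Prod>i<?k. \<Sum>j\<le>N. Poly_Mapping.single (Poly_Mapping.single i j) (?b r j))"
      by (simp only: mult_ac)
  qed
  finally have e: "(?Y - ?X) ^ N = (\<Sum>r\<le>N. Poly_Mapping.single 0 ((-1) ^ r * int (N choose r)) *
      (\<Prod>i<?k. \<Sum>j\<le>N. Poly_Mapping.single (Poly_Mapping.single i j) (?b r j)))" .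
  have sc: "Poly_Mapping.lookup (Poly_Mapping.single 0 a * q) m = a * Poly_Mapping.lookup q m"
    for a :: int and q :: "(nat \<Rightarrow>\<^sub>0 nat) \<Rightarrow>\<^sub>0 int" and m
    by (simp add: mult_map_scale_conv_mult[symmetric] map.rep_eq when_def)
  have "Mcoeff N (map int ps) = Poly_Mapping.lookup ((?Y - ?X) ^ N) ?m"
    by (auto simp: Mcoeff_def Let_def)
  also have "\<dots> = (\<Sum>r\<le>N. (-1) ^ r * int (N choose r) * (\<Prod>i<?k. ?b r (ps ! i)))"
    unfolding e lookup_sum sc
    by (intro sum.cong refl arg_cong2[of _ _ _ _ "(*)"] lookup_prod_xvar_expansion) (use assms in auto)
  finally show ?thesis .
qed

text \<open>The identity (N choose p) (p choose r) = (N choose r) (N - r choose p - r) turns each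
  factor into a normalised hook scalar. The shift by \<open>Suc\<close> passes from n - 1 and q - 1
  to n and the number q of colours.\<close>

lemma Mcoeff_eq_hook_sum:
  assumes "\<And>p. p \<in> set ps \<Longrightarrow> p \<le> N"
  shows "of_int (Mcoeff N (map int ps)) / (\<Prod>i<length ps. of_nat (N choose (ps ! i))) = hook_sum (Suc N) (map Suc ps)"
proof -
  have q: "(if r \<le> p then of_nat ((N - r) choose (p - r)) else 0) / of_nat (N choose p)
      = (of_nat (p choose r) / of_nat (N choose r) :: rat)" if "p \<le> N" "r \<le> N" for p r
  proof (cases "r \<le> p")
    case True
    have "of_nat ((N choose p) * (p choose r)) = (of_nat ((N choose r) * ((N - r) choose (p - r))) :: rat)"
      using choose_mult[OF True that(1)] by simp
    moreover have "of_nat (N choose p) \<noteq> (0 :: rat)" "of_nat (N choose r) \<noteq> (0 :: rat)" using that by auto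
    ultimately show ?thesis using True by (simp add: field_simps)
  qed simp
  have pl: "(\<Prod>l\<leftarrow>map Suc ps. f l) = (\<Prod>i<length ps. f (Suc (ps ! i)))" for f :: "nat \<Rightarrow> rat"
    by (simp add: prod.list_conv_set_nth atLeast0LessThan)
  have M: "Mcoeff N (map int ps)
    = (\<Sum>r\<le>N. (-1) ^ r * int (N choose r) * (\<Prod>i<length ps. if r \<le> ps ! i then int ((N - r) choose (ps ! i - r)) else 0))"
    by (rule Mcoeff_expansion) (rule assms)
  have "of_int (Mcoeff N (map int ps)) / (\<Prod>i<length ps. of_nat (N choose (ps ! i)))
      = (\<Sum>r\<le>N. (-1) ^ r * of_nat (N choose r) *
          (\<Prod>i<length ps. (if r \<le> ps ! i then of_nat ((N - r) choose (ps ! i - r)) else 0) / of_nat (N choose (ps ! i))) :: rat)"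
    unfolding M sum_divide_distrib of_int_sum prod_dividef
    by (intro sum.cong refl) (simp add: if_distrib[of of_int] cong: if_cong)
  also have "\<dots> = (\<Sum>r\<le>N. (-1) ^ r * of_nat (N choose r) *
          (\<Prod>i<length ps. of_nat ((ps ! i) choose r) / of_nat (N choose r)))"
    by (intro sum.cong refl arg_cong2[of _ _ _ _ "(*)"] prod.cong q) (use assms in auto)
  also have "\<dots> = hook_sum (Suc N) (map Suc ps)"
    unfolding hook_sum_def pl lessThan_Suc_atMost by simp
  finally show ?thesis .
qed

section \<open>Coefficients of formal power series\<close>

lemma coeff_ms_times:
  "coeff_ms (f * g) m = (\<Sum>(p, q) \<in> {(p, q). p + q = m}. coeff_ms f p * coeff_ms g q)"
  by (simp add: times_mseries.rep_eq)

lemma coeff_ms_one: "coeff_ms 1 m = (if m = 0 then 1 else 0)"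
  by (simp add: one_mseries.rep_eq)

lemma coeff_ms_sum: "coeff_ms (\<Sum>i\<in>I. F i) m = (\<Sum>i\<in>I. coeff_ms (F i) m)"
  by (induction I rule: infinite_finite_induct) (simp_all add: zero_mseries.rep_eq plus_mseries.rep_eq)

lemma coeff_ms_of_nat_mult: "coeff_ms (of_nat a * f) m = of_nat a * coeff_ms f m"
  by (induction a) (simp_all add: zero_mseries.rep_eq plus_mseries.rep_eq distrib_right)

lemma coeff_ms_monomial_mult:
  assumes f: "\<And>p. coeff_ms f p = (if p = p0 then c else 0)"
  shows "coeff_ms (f * g) m = (\<Sum>q | p0 + q = m. c * coeff_ms g q)"
proof -
  have fin: "finite {q. p0 + q = m}"
    by (rule finite_subset[of _ "snd ` {(p, q). p + q = m}"]) (use finite_splittings in force)+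
  have "coeff_ms (f * g) m = (\<Sum>x \<in> {(p, q). p + q = m}. coeff_ms f (fst x) * coeff_ms g (snd x))"
    by (simp add: coeff_ms_times split_def)
  also have "\<dots> = (\<Sum>x \<in> Pair p0 ` {q. p0 + q = m}. coeff_ms f (fst x) * coeff_ms g (snd x))"
    by (rule sum.mono_neutral_right) (auto simp: finite_splittings f)
  also have "\<dots> = (\<Sum>q | p0 + q = m. c * coeff_ms g q)"
    by (subst sum.reindex) (auto simp: f inj_on_def)
  finally show ?thesis .
qed

lemma coeff_ms_const_mult: "coeff_ms (const_ms c * f) m = c * coeff_ms f m"
  by (subst coeff_ms_monomial_mult[of _ 0 c]) (simp_all add: const_ms.rep_eq)

lemma coeff_ms_monomial_prod:
  assumes "finite I" "\<And>i p. i \<in> I \<Longrightarrow> coeff_ms (F i) p = (if p = P i then 1 else 0)"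
  shows "coeff_ms (\<Prod>i\<in>I. F i) m = (if m = (\<Sum>i\<in>I. P i) then 1 else 0)"
  using assms
proof (induction I arbitrary: m rule: finite_induct)
  case (insert i I)
  have "coeff_ms (\<Prod>i\<in>insert i I. F i) m = (\<Sum>q | P i + q = m. 1 * coeff_ms (\<Prod>i\<in>I. F i) q)"
    using insert.hyps by (simp, subst coeff_ms_monomial_mult[of _ "P i" 1]) (use insert.prems in auto)
  also have "\<dots> = (\<Sum>q | P i + q = m. if q = (\<Sum>i\<in>I. P i) then 1 else 0)"
    using insert by simp
  also have "\<dots> = (if m = (\<Sum>i\<in>insert i I. P i) then 1 else 0)"
  proof -
    have "finite {q. P i + q = m}"
      by (rule finite_subset[of _ "snd ` {(p, q). p + q = m}"]) (use finite_splittings in force)+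
    thus ?thesis using insert.hyps by auto
  qed
  finally show ?case .
qed (simp add: coeff_ms_one)

lemma coeff_ms_var_power:
  "coeff_ms (var_ms v ^ r) m = (if m = Poly_Mapping.single v r then 1 else (0 :: 'a :: comm_ring_1))"
proof -
  have e: "(\<Sum>i<r. Poly_Mapping.single v (1::nat)) = Poly_Mapping.single v r"
    by (induction r) (simp_all flip: single_add)
  have "coeff_ms (\<Prod>i<r. var_ms v) m = (if m = (\<Sum>i<r. Poly_Mapping.single v 1) then 1 else (0 :: 'a))"
    by (rule coeff_ms_monomial_prod) (simp_all add: var_ms.rep_eq)
  thus ?thesis by (simp only: e prod_constant card_lessThan)
qed

section \<open>Separating the sets of variables\<close>

definition in_row :: "'i \<Rightarrow> ('i \<times> 'j, 'a :: zero) mseries \<Rightarrow> bool" where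
  "in_row i F \<longleftrightarrow> (\<forall>m. coeff_ms F m \<noteq> 0 \<longrightarrow> fst ` Poly_Mapping.keys m \<subseteq> {i})"

lift_definition restrict_mon :: "'v set \<Rightarrow> ('v \<Rightarrow>\<^sub>0 nat) \<Rightarrow> ('v \<Rightarrow>\<^sub>0 nat)"
  is "\<lambda>S m v. if v \<in> S then m v else 0"
  by (auto intro: finite_subset)

abbreviation row_mon :: "'i \<Rightarrow> ('i \<times> 'j \<Rightarrow>\<^sub>0 nat) \<Rightarrow> ('i \<times> 'j \<Rightarrow>\<^sub>0 nat)" where
  "row_mon i \<equiv> restrict_mon {v. fst v = i}"

lemma lookup_restrict_mon:
  "Poly_Mapping.lookup (restrict_mon S m) v = (if v \<in> S then Poly_Mapping.lookup m v else 0)"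
  by transfer simp

lemma keys_restrict_mon: "Poly_Mapping.keys (restrict_mon S m) = Poly_Mapping.keys m \<inter> S"
  by (auto simp: in_keys_iff lookup_restrict_mon split: if_splits)

lemma keys_add_nat: "Poly_Mapping.keys (p + q) = Poly_Mapping.keys p \<union> Poly_Mapping.keys (q :: 'v \<Rightarrow>\<^sub>0 nat)"
  by (auto simp: in_keys_iff lookup_add)

text \<open>The only splitting of \<open>m\<close> that can contribute is the one into its parts
  over the individual sets of variables.\<close>

lemma coeff_ms_prod_rows:
  fixes F :: "nat \<Rightarrow> (nat \<times> 'j, 'a :: comm_ring_1) mseries"
  assumes "\<And>i. i < k \<Longrightarrow> in_row i (F i)"
  shows "coeff_ms (\<Prod>i<k. F i) m =
    (if fst ` Poly_Mapping.keys m \<subseteq> {..<k} then \<Prod>i<k. coeff_ms (F i) (row_mon i m) else 0)"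
  using assms
proof (induction k arbitrary: m)
  case 0 show ?case by (simp add: coeff_ms_one)
next
  case (Suc k)
  let ?P = "\<Prod>i<k. F i" and ?S = "{(p, q). p + q = m}"
  let ?p = "restrict_mon {v. fst v < k} m" and ?q = "row_mon k m"
  have IH: "coeff_ms ?P p = (if fst ` Poly_Mapping.keys p \<subseteq> {..<k} then \<Prod>i<k. coeff_ms (F i) (row_mon i p) else 0)" for p
    using Suc by simp
  have c: "coeff_ms (\<Prod>i<Suc k. F i) m = (\<Sum>(p, q) \<in> ?S. coeff_ms ?P p * coeff_ms (F k) q)"
    by (simp add: coeff_ms_times)
  have supp: "fst ` Poly_Mapping.keys m \<subseteq> {..<Suc k} \<and> p = ?p \<and> q = ?q"
    if pq: "p + q = m" "coeff_ms ?P p \<noteq> 0" "coeff_ms (F k) q \<noteq> 0" for p q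
  proof -
    have kp: "fst ` Poly_Mapping.keys p \<subseteq> {..<k}" using pq IH[of p] by (auto split: if_splits)
    have kq: "fst ` Poly_Mapping.keys q \<subseteq> {k}" using pq Suc.prems[of k] by (simp add: in_row_def)
    have p0: "Poly_Mapping.lookup p v = 0" if "fst v \<ge> k" for v
      using kp that by (metis image_eqI in_keys_iff lessThan_iff not_le subsetD)
    have q0: "Poly_Mapping.lookup q v = 0" if "fst v \<noteq> k" for v
      using kq that by (metis image_eqI in_keys_iff singletonD subsetD)
    have "fst ` Poly_Mapping.keys m \<subseteq> {..<Suc k}"
      using kp kq unfolding pq(1)[symmetric] keys_add_nat by force
    moreover have "p = ?p" unfolding pq(1)[symmetric]
      by (rule poly_mapping_eqI) (auto simp: lookup_restrict_mon lookup_add p0 q0)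
    moreover have "q = ?q" unfolding pq(1)[symmetric]
      by (rule poly_mapping_eqI) (auto simp: lookup_restrict_mon lookup_add p0 q0)
    ultimately show ?thesis by blast
  qed
  show ?case
  proof (cases "fst ` Poly_Mapping.keys m \<subseteq> {..<Suc k}")
    case False
    hence "(\<Sum>(p, q) \<in> ?S. coeff_ms ?P p * coeff_ms (F k) q) = 0"
      using supp by (intro sum.neutral) force
    thus ?thesis using False by (simp only: c if_False)
  next
    case True
    have m: "?p + ?q = m"
    proof (rule poly_mapping_eqI)
      fix v
      have "fst v < Suc k" if "Poly_Mapping.lookup m v \<noteq> 0"
        using True that by (metis image_eqI in_keys_iff lessThan_iff subsetD)
      thus "Poly_Mapping.lookup (?p + ?q) v = Poly_Mapping.lookup m v"
        by (auto simp: lookup_add lookup_restrict_mon less_Suc_eq)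
    qed
    have "(\<Sum>(p, q) \<in> ?S. coeff_ms ?P p * coeff_ms (F k) q) = (\<Sum>(p, q) \<in> {(?p, ?q)}. coeff_ms ?P p * coeff_ms (F k) q)"
    proof (rule sum.mono_neutral_right[OF finite_splittings])
      show "{(?p, ?q)} \<subseteq> ?S" using m by simp
      show "\<forall>x\<in>?S - {(?p, ?q)}. (case x of (p, q) \<Rightarrow> coeff_ms ?P p * coeff_ms (F k) q) = 0"
      proof
        fix x assume "x \<in> ?S - {(?p, ?q)}"
        then obtain p q where x: "x = (p, q)" "p + q = m" "\<not> (p = ?p \<and> q = ?q)" by auto
        hence "coeff_ms ?P p = 0 \<or> coeff_ms (F k) q = 0" using supp[of p q] by blast
        thus "(case x of (p, q) \<Rightarrow> coeff_ms ?P p * coeff_ms (F k) q) = 0" using x(1) by auto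
      qed
    qed
    also have "\<dots> = coeff_ms ?P ?p * coeff_ms (F k) ?q" by simp
    also have "coeff_ms ?P ?p = (\<Prod>i<k. coeff_ms (F i) (row_mon i m))"
    proof -
      have "row_mon i ?p = row_mon i m" if "i < k" for i
        by (rule poly_mapping_eqI) (use that in \<open>auto simp: lookup_restrict_mon\<close>)
      moreover have "fst ` Poly_Mapping.keys ?p \<subseteq> {..<k}" by (auto simp: keys_restrict_mon)
      ultimately show ?thesis using IH[of ?p] by simp
    qed
    finally show ?thesis using True c by simp
  qed
qed

lemma coeff_ms_sum_ms:
  assumes "finite I" "\<And>i. i \<notin> I \<Longrightarrow> coeff_ms (F i) m = 0"
  shows "coeff_ms (sum_ms F) m = (\<Sum>i\<in>I. coeff_ms (F i) m)"
  unfolding sum_ms.rep_eq by (rule Sum_any.expand_superset) (use assms in auto)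

text \<open>The exponent contributed by \<open>s\<close> positions of colour \<open>c\<close>; colour \<open>0\<close> stands for the
  variable specialised to \<open>1\<close>.\<close>

definition colour_mon :: "nat \<Rightarrow> nat \<Rightarrow> nat \<Rightarrow> (nat \<times> nat \<Rightarrow>\<^sub>0 nat)" where
  "colour_mon i c s = (case c of 0 \<Rightarrow> 0 | Suc j \<Rightarrow> Poly_Mapping.single (i, j) s)"

text \<open>Here \<open>K\<close> is any finite set of colours containing 0 and those that occur in
  \<open>m\<close>; leaving it open lets one \<open>K\<close> serve all cycles and all monomials
  that divide a given one.\<close>

lemma coeff_ms_power_sum:
  assumes r: "r > 0" and d: "d > 0"
    and K: "finite K" "0 \<in> K" "\<And>j. (i, j) \<in> Poly_Mapping.keys m \<Longrightarrow> Suc j \<in> K"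
  shows "coeff_ms (power_sum r (one_then_copies d i)) m
    = (\<Sum>c\<in>K. if colour_mon i c r = m then (if c = 0 then 1 else of_nat d) else 0)"
proof -
  let ?z = "one_then_copies d i"
  \<comment> \<open>The colour of entry \<open>j\<close> of the sequence; the fibre over colour 0
    has one element, every other fibre has \<open>d\<close>.\<close>
  define c where "c j = (case j of 0 \<Rightarrow> 0 | Suc j' \<Rightarrow> Suc (j' div d))" for j
  have z: "coeff_ms (?z j ^ r) m = (if colour_mon i (c j) r = m then 1 else 0)" for j
    by (cases j) (auto simp: one_then_copies_def c_def colour_mon_def coeff_ms_one yvars_def coeff_ms_var_power)
  have fibre: "{j. c j = Suc J} = Suc ` {J * d..<J * d + d}" for J
  proof -
    have "j div d = J \<longleftrightarrow> J * d \<le> j \<and> j < J * d + d" for j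
    proof
      assume "j div d = J"
      thus "J * d \<le> j \<and> j < J * d + d"
        using div_mult_mod_eq[of j d] mod_less_divisor[OF d, of j] by auto
    next
      assume "J * d \<le> j \<and> j < J * d + d"
      hence "d * J \<le> j" "j < d * Suc J" by (simp_all add: algebra_simps)
      thus "j div d = J" by (rule div_nat_eqI)
    qed
    hence cS: "c (Suc j) = Suc J \<longleftrightarrow> j \<in> {J * d..<J * d + d}" for j by (simp add: c_def)
    have c0: "c 0 \<noteq> Suc J" by (simp add: c_def)
    show ?thesis
    proof (intro equalityI subsetI)
      fix j assume "j \<in> {j. c j = Suc J}"
      thus "j \<in> Suc ` {J * d..<J * d + d}" using c0 cS by (cases j) auto
    next
      fix j assume "j \<in> Suc ` {J * d..<J * d + d}"
      then obtain j' where "j = Suc j'" "j' \<in> {J * d..<J * d + d}" by blast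
      thus "j \<in> {j. c j = Suc J}" using cS by blast
    qed
  qed
  have fibre0: "{j. c j = 0} = {0}" 
  proof -
    have "c j = 0 \<longleftrightarrow> j = 0" for j by (cases j) (simp_all add: c_def)
    thus ?thesis by simp
  qed
  have cardf: "card {j. c j = x} = (if x = 0 then 1 else d)" "finite {j. c j = x}" for x
    by (cases x; simp add: fibre fibre0 card_image)+
  let ?I = "\<Union>x\<in>K. {j. c j = x}"
  have finI: "finite ?I" using K cardf by auto
  have "coeff_ms (power_sum r ?z) m = (\<Sum>j\<in>?I. coeff_ms (?z j ^ r) m)"
    unfolding power_sum_def
  proof (rule coeff_ms_sum_ms[OF finI])
    fix j assume "j \<notin> ?I"
    hence cj: "c j \<notin> K" by simp
    have "colour_mon i (c j) r \<noteq> m"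
    proof
      assume e: "colour_mon i (c j) r = m"
      obtain J where J: "c j = Suc J" using cj K(2) by (cases "c j") auto
      have "(i, J) \<in> Poly_Mapping.keys m" using r by (simp add: e[symmetric] J colour_mon_def)
      thus False using K(3) J cj by simp
    qed
    thus "coeff_ms (?z j ^ r) m = 0" by (simp add: z)
  qed
  also have "\<dots> = (\<Sum>x\<in>K. \<Sum>j | c j = x. coeff_ms (?z j ^ r) m)"
    using K cardf by (intro sum.UNION_disjoint) auto
  also have "\<dots> = (\<Sum>x\<in>K. if colour_mon i x r = m then (if x = 0 then 1 else of_nat d) else 0)"
  proof (rule sum.cong[OF refl])
    fix x
    have "(\<Sum>j | c j = x. coeff_ms (?z j ^ r) m) = (\<Sum>j | c j = x. if colour_mon i x r = m then 1 else 0)"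
      by (rule sum.cong) (auto simp: z)
    also have "\<dots> = (if colour_mon i x r = m then of_nat (card {j. c j = x}) else 0)" by simp
    finally show "(\<Sum>j | c j = x. coeff_ms (?z j ^ r) m)
        = (if colour_mon i x r = m then (if x = 0 then 1 else of_nat d) else 0)"
      by (simp add: cardf)
  qed
  finally show ?thesis .
qed

text \<open>Multiplying out amounts to choosing a colour for each factor. The formula for a factor
  is required at every \<open>p\<close> with keys among those of \<open>m\<close>, because the
  induction evaluates it at the parts of a splitting of \<open>m\<close>.\<close>

lemma coeff_ms_coloured_prod:
  fixes F :: "'c \<Rightarrow> (nat \<times> nat, rat) mseries"
  assumes "finite \<C>" and K: "finite K"
    and "\<And>C p. C \<in> \<C> \<Longrightarrow> Poly_Mapping.keys p \<subseteq> Poly_Mapping.keys m \<Longrightarrow>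
      coeff_ms (F C) p = (\<Sum>c\<in>K. if colour_mon i c (s C) = p then e C c else 0)"
  shows "coeff_ms (\<Prod>C\<in>\<C>. F C) m
    = (\<Sum>g\<in>\<C> \<rightarrow>\<^sub>E K. if (\<Sum>C\<in>\<C>. colour_mon i (g C) (s C)) = m then \<Prod>C\<in>\<C>. e C (g C) else 0)"
  using assms(1,3)
proof (induction \<C> arbitrary: m rule: finite_induct)
  case empty
  show ?case by (simp add: coeff_ms_one)
next
  case (insert D \<C>)
  let ?S = "{(p, q). p + q = m}"
  let ?cm = "\<lambda>g. \<Sum>C\<in>\<C>. colour_mon i (g C) (s C)"
  have "coeff_ms (\<Prod>C\<in>insert D \<C>. F C) m = (\<Sum>(p, q)\<in>?S. coeff_ms (F D) p * coeff_ms (\<Prod>C\<in>\<C>. F C) q)"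
    using insert.hyps by (simp add: coeff_ms_times)
  also have "\<dots> = (\<Sum>(p, q)\<in>?S. \<Sum>c\<in>K. \<Sum>g\<in>\<C> \<rightarrow>\<^sub>E K.
      if (colour_mon i c (s D), ?cm g) = (p, q) then e D c * (\<Prod>C\<in>\<C>. e C (g C)) else 0)"
  proof (rule sum.cong[OF refl], clarify)
    fix p q assume m: "m = p + q"
    have p: "coeff_ms (F D) p = (\<Sum>c\<in>K. if colour_mon i c (s D) = p then e D c else 0)"
      by (rule insert.prems) (auto simp: m keys_add_nat)
    have q: "coeff_ms (\<Prod>C\<in>\<C>. F C) q = (\<Sum>g\<in>\<C> \<rightarrow>\<^sub>E K. if ?cm g = q then \<Prod>C\<in>\<C>. e C (g C) else 0)"
      by (rule insert.IH, rule insert.prems) (auto simp: m keys_add_nat)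
    show "coeff_ms (F D) p * coeff_ms (\<Prod>C\<in>\<C>. F C) q = (\<Sum>c\<in>K. \<Sum>g\<in>\<C> \<rightarrow>\<^sub>E K.
      if (colour_mon i c (s D), ?cm g) = (p, q) then e D c * (\<Prod>C\<in>\<C>. e C (g C)) else 0)"
      unfolding p q sum_product by (intro sum.cong refl) auto
  qed
  also have "\<dots> = (\<Sum>c\<in>K. \<Sum>g\<in>\<C> \<rightarrow>\<^sub>E K. \<Sum>x\<in>?S.
      if (colour_mon i c (s D), ?cm g) = x then e D c * (\<Prod>C\<in>\<C>. e C (g C)) else 0)"
    unfolding split_def prod.collapse
    by (subst sum.swap) (intro sum.cong refl sum.swap)
  also have "\<dots> = (\<Sum>c\<in>K. \<Sum>g\<in>\<C> \<rightarrow>\<^sub>E K.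
      if colour_mon i c (s D) + ?cm g = m then e D c * (\<Prod>C\<in>\<C>. e C (g C)) else 0)"
    by (intro sum.cong refl) (simp add: finite_splittings)
  also have "\<dots> = (\<Sum>(c, g)\<in>K \<times> (\<C> \<rightarrow>\<^sub>E K).
      if colour_mon i c (s D) + ?cm g = m then e D c * (\<Prod>C\<in>\<C>. e C (g C)) else 0)"
    by (simp add: sum.cartesian_product)
  also have "\<dots> = (\<Sum>g\<in>insert D \<C> \<rightarrow>\<^sub>E K. if (\<Sum>C\<in>insert D \<C>. colour_mon i (g C) (s C)) = m
      then \<Prod>C\<in>insert D \<C>. e C (g C) else 0)"
  proof (rule sum.reindex_bij_witness[of _ "\<lambda>g. (g D, restrict g \<C>)" "\<lambda>(c, g). g(D := c)"], goal_cases)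
    case (1 a)
    then obtain c g where a: "a = (c, g)" "g \<in> \<C> \<rightarrow>\<^sub>E K" by auto
    thus ?case using insert.hyps by (auto simp: fun_eq_iff PiE_def extensional_def)
  next
    case (2 a)
    then obtain c g where a: "a = (c, g)" "g \<in> \<C> \<rightarrow>\<^sub>E K" "c \<in> K" by auto
    thus ?case by (auto simp: PiE_def extensional_def)
  next
    case (3 g) thus ?case by (auto simp: fun_eq_iff PiE_def extensional_def)
  next
    case (4 g) thus ?case by (auto simp: PiE_def Pi_def extensional_def)
  next
    case (5 a)
    then obtain c g where a: "a = (c, g)" by auto
    have "(\<Sum>C\<in>\<C>. colour_mon i ((g(D := c)) C) (s C)) = ?cm g" "(\<Prod>C\<in>\<C>. e C ((g(D := c)) C)) = (\<Prod>C\<in>\<C>. e C (g C))"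
      using insert.hyps(2) by (auto intro!: sum.cong prod.cong)
    thus ?case using insert.hyps by (simp add: a)
  qed
  finally show ?case .
qed

section \<open>Words and monomials\<close>

definition row_keys :: "nat \<Rightarrow> (nat \<times> nat \<Rightarrow>\<^sub>0 nat) \<Rightarrow> (nat \<times> nat) set" where
  "row_keys i m = {v \<in> Poly_Mapping.keys m. fst v = i}"

definition row_type :: "nat \<Rightarrow> (nat \<times> nat \<Rightarrow>\<^sub>0 nat) \<Rightarrow> nat multiset" where
  "row_type i m = image_mset (Poly_Mapping.lookup m) (mset_set (row_keys i m))"

text \<open>The content of the words that produce row \<open>i\<close> of \<open>m\<close>: variable
  \<open>j\<close> is colour \<open>Suc j\<close>, and colour 0 fills the remaining positions. The
  result has size \<open>n\<close> only if the degree of the row is at most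
  \<open>n\<close>.\<close>

definition colours :: "nat \<Rightarrow> nat \<Rightarrow> (nat \<times> nat \<Rightarrow>\<^sub>0 nat) \<Rightarrow> nat multiset" where
  "colours n i m = (\<Sum>v\<in>row_keys i m. replicate_mset (Poly_Mapping.lookup m v) (Suc (snd v))) +
     replicate_mset (n - sum_mset (row_type i m)) 0"

lemma finite_row_keys: "finite (row_keys i m)"
  by (simp add: row_keys_def)

lemma sum_row_type: "sum_mset (row_type i m) = (\<Sum>v\<in>row_keys i m. Poly_Mapping.lookup m v)"
  by (simp add: row_type_def sum_unfold_sum_mset)

lemma size_row_type: "size (row_type i m) = card (row_keys i m)"
  by (simp add: row_type_def)

lemma row_type_in_partitions: "sum_mset (row_type i m) \<le> n \<Longrightarrow> row_type i m \<in> partitions_upto n"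
  by (auto simp: partitions_upto_def row_type_def finite_row_keys row_keys_def in_keys_iff)

lemma row_keys_row_mon: "row_keys i (row_mon i m) = row_keys i m"
  by (auto simp: row_keys_def keys_restrict_mon)

lemma row_type_row_mon: "row_type i (row_mon i m) = row_type i m"
  unfolding row_type_def row_keys_row_mon
  by (rule image_mset_cong) (simp add: finite_row_keys row_keys_def lookup_restrict_mon)

lemma colours_row_mon: "colours n i (row_mon i m) = colours n i m"
  unfolding colours_def row_type_row_mon row_keys_row_mon
  by (intro arg_cong2[of _ _ _ _ "(+)"] sum.cong refl) (simp add: row_keys_def lookup_restrict_mon)

lemma count_colours_Suc: "count (colours n i m) (Suc j) = Poly_Mapping.lookup m (i, j)"
proof -
  have "count (colours n i m) (Suc j) = (\<Sum>v\<in>row_keys i m. if v = (i, j) then Poly_Mapping.lookup m v else 0)"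
    unfolding colours_def by (simp add: count_sum) (rule sum.cong, auto simp: row_keys_def)
  also have "\<dots> = (if (i, j) \<in> row_keys i m then Poly_Mapping.lookup m (i, j) else 0)"
    by (simp add: finite_row_keys)
  also have "\<dots> = Poly_Mapping.lookup m (i, j)" by (auto simp: row_keys_def in_keys_iff)
  finally show ?thesis .
qed

lemma count_colours_0: "count (colours n i m) 0 = n - sum_mset (row_type i m)"
  by (simp add: colours_def count_sum)

lemma size_mset_sum: "size (\<Sum>x\<in>S. M x :: 'a multiset) = (\<Sum>x\<in>S. size (M x))"
  by (induction S rule: infinite_finite_induct) simp_all

lemma size_colours: "sum_mset (row_type i m) \<le> n \<Longrightarrow> size (colours n i m) = n"
  by (simp add: colours_def sum_row_type size_mset_sum)

lemma set_colours:
  "set_mset (colours n i m) = (Suc \<circ> snd) ` row_keys i m \<union> (if sum_mset (row_type i m) < n then {0} else {})"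
proof (rule Set.set_eqI)
  fix c
  have "(\<exists>v\<in>row_keys i m. j = snd v) \<longleftrightarrow> (i, j) \<in> Poly_Mapping.keys m" for j
    by (force simp: row_keys_def)
  thus "c \<in># colours n i m \<longleftrightarrow> c \<in> (Suc \<circ> snd) ` row_keys i m \<union> (if sum_mset (row_type i m) < n then {0} else {})"
    by (cases c) (auto simp: count_colours_Suc count_colours_0 in_keys_iff image_iff simp flip: count_greater_zero_iff)
qed

text \<open>This is where the case distinction in \<open>qindex\<close> comes from: colour 0 occurs
  exactly when the degree of the row is below \<open>n\<close>.\<close>

lemma card_set_colours:
  assumes "sum_mset (row_type i m) \<le> n"
  shows "card (set_mset (colours n i m)) = qindex n (row_type i m)"
proof -
  have "inj_on (Suc \<circ> snd) (row_keys i m)" by (auto simp: inj_on_def row_keys_def prod_eq_iff)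
  hence "card ((Suc \<circ> snd) ` row_keys i m) = size (row_type i m)"
    unfolding size_row_type by (rule card_image)
  moreover have "0 \<notin> (Suc \<circ> snd) ` row_keys i m" by auto
  ultimately show ?thesis using assms finite_row_keys[of i m]
    by (auto simp: set_colours qindex_def)
qed

text \<open>The multiplicity of 0 is forced by the size.\<close>

lemma multiset_eq_SucI:
  assumes "size M = size N" "\<And>j. count M (Suc j) = count N (Suc j)"
  shows "M = N"
proof -
  have split: "M = filter_mset (\<lambda>c. c \<noteq> 0) M + replicate_mset (count M 0) 0" for M :: "nat multiset"
    by (rule multiset_eqI) (simp add: count_filter_mset)
  have e: "filter_mset (\<lambda>c. c \<noteq> 0) M = filter_mset (\<lambda>c. c \<noteq> 0) N"
  proof (rule multiset_eqI)
    fix c show "count (filter_mset (\<lambda>c. c \<noteq> 0) M) c = count (filter_mset (\<lambda>c. c \<noteq> 0) N) c"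
      using assms(2) by (cases c) simp_all
  qed
  have "size (filter_mset (\<lambda>c. c \<noteq> 0) M) + count M 0 = size (filter_mset (\<lambda>c. c \<noteq> 0) N) + count N 0"
    using assms(1) split[of M] split[of N] by (metis size_replicate_mset size_union)
  hence "count M 0 = count N 0" unfolding e by (rule add_left_imp_eq)
  thus ?thesis using split[of M] split[of N] e by metis
qed

lemma lookup_colour_mon:
  "Poly_Mapping.lookup (colour_mon i c s) (i', j) = (if i' = i \<and> c = Suc j then s else 0)"
  by (cases c) (auto simp: colour_mon_def lookup_single when_def)

lemma lookup_sum_colour_mon:
  "Poly_Mapping.lookup (\<Sum>x<n. colour_mon i (f x) 1) (i', j) = (if i' = i then card {x. x < n \<and> f x = Suc j} else 0)"
  for n :: nat
proof -
  have "(\<Sum>x<n. if f x = Suc j then 1 else 0) = (\<Sum>x\<in>{x \<in> {..<n}. f x = Suc j}. 1 :: nat)"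
    by (rule sum.inter_filter[symmetric]) simp
  thus ?thesis by (simp add: lookup_sum lookup_colour_mon del: One_nat_def)
qed

lemma count_image_mset_lessThan: "count (image_mset f (mset_set {..<n})) c = card {x. x < n \<and> f x = c}"
  for n :: nat
proof -
  have "restrict f {..<n} \<in> words {..<n} (image_mset f (mset_set {..<n}))"
    by (rule restrict_in_words[OF finite_lessThan refl])
  from count_words[OF finite_lessThan this, of c]
  have "card {x \<in> {..<n}. restrict f {..<n} x = c} = count (image_mset f (mset_set {..<n})) c" .
  moreover have "{x \<in> {..<n}. restrict f {..<n} x = c} = {x. x < n \<and> f x = c}" by auto
  ultimately show ?thesis by simp
qed

text \<open>Colour 0 leaves no trace in the monomial; its multiplicity is recovered from the length
  \<open>n\<close>, whence the bound on the degree.\<close>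

lemma content_eq_iff:
  assumes f: "f \<in> {..<n} \<rightarrow>\<^sub>E UNIV"
  shows "(\<Sum>x<n. colour_mon i (f x) 1) = m \<longleftrightarrow>
    fst ` Poly_Mapping.keys m \<subseteq> {i} \<and> sum_mset (row_type i m) \<le> n \<and> f \<in> words {..<n} (colours n i m)"
proof
  assume m: "(\<Sum>x<n. colour_mon i (f x) 1) = m"
  have l: "Poly_Mapping.lookup m (i', j) = (if i' = i then card {x. x < n \<and> f x = Suc j} else 0)" for i' j
    unfolding m[symmetric] by (rule lookup_sum_colour_mon)
  have row: "fst ` Poly_Mapping.keys m \<subseteq> {i}" by (auto simp: in_keys_iff l split: if_splits)
  have "sum_mset (row_type i m) = (\<Sum>v\<in>row_keys i m. card {x. x < n \<and> f x = Suc (snd v)})"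
    unfolding sum_row_type by (rule sum.cong) (auto simp: row_keys_def l)
  also have "\<dots> = card (\<Union>v\<in>row_keys i m. {x. x < n \<and> f x = Suc (snd v)})"
    by (rule card_UN_disjoint[symmetric]) (auto simp: finite_row_keys, auto simp: row_keys_def)
  also have "\<dots> \<le> card {..<n}" by (rule card_mono) auto
  finally have deg: "sum_mset (row_type i m) \<le> n" by simp
  have "image_mset f (mset_set {..<n}) = colours n i m"
    by (rule multiset_eq_SucI) (simp_all add: size_colours[OF deg] count_colours_Suc count_image_mset_lessThan l)
  thus "fst ` Poly_Mapping.keys m \<subseteq> {i} \<and> sum_mset (row_type i m) \<le> n \<and> f \<in> words {..<n} (colours n i m)"
    using row deg f by (simp add: words_def)
next
  assume A: "fst ` Poly_Mapping.keys m \<subseteq> {i} \<and> sum_mset (row_type i m) \<le> n \<and> f \<in> words {..<n} (colours n i m)"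
  hence c: "image_mset f (mset_set {..<n}) = colours n i m" by (simp add: words_def)
  show "(\<Sum>x<n. colour_mon i (f x) 1) = m"
  proof (rule poly_mapping_eqI)
    fix v :: "nat \<times> nat"
    obtain i' j where v: "v = (i', j)" by (cases v)
    have "Poly_Mapping.lookup m (i', j) = 0" if "i' \<noteq> i"
      using A that by (force simp: in_keys_iff)
    moreover have "card {x. x < n \<and> f x = Suc j} = Poly_Mapping.lookup m (i, j)"
      by (simp flip: count_image_mset_lessThan add: c count_colours_Suc)
    ultimately show "Poly_Mapping.lookup (\<Sum>x<n. colour_mon i (f x) 1) v = Poly_Mapping.lookup m v"
      unfolding v lookup_sum_colour_mon by auto
  qed
qed

lemma power_sum_part_weight0:
  assumes "u \<in> carrier (Gd1n d n)"
  shows "power_sum_part (weight0_cycle_type d n u) z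
    = (\<Prod>C\<in>orbit (fst u) ` {..<n}. if cycle_weight d u C = 0 then power_sum (card C) z else 1)"
  unfolding power_sum_part_def weight0_cycle_type_def
  by (simp add: multiset.map_comp comp_def prod.inter_filter flip: prod_unfold_prod_mset)

text \<open>A cycle of weight 0 and length r contributes 1 plus \<open>d\<close> times the r-th
  power sum of the variables, any other cycle contributes 1. Choosing one term for each cycle means
  colouring the cycles, that is, choosing a word fixed by the permutation part.\<close>

lemma coeff_ms_power_sum_part:
  assumes d: "d > 0" and u: "u \<in> carrier (Gd1n d n)"
  shows "coeff_ms (power_sum_part (weight0_cycle_type d n u) (one_then_copies d i)) m
    = (if fst ` Poly_Mapping.keys m \<subseteq> {i} \<and> sum_mset (row_type i m) \<le> n
       then weighted_fixed_words d n (colours n i m) u else 0)"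
proof -
  define \<pi> where "\<pi> = fst u"
  have \<pi>: "\<pi> permutes {..<n}" using u by (auto simp: \<pi>_def Gd1n_simps)
  let ?O = "orbit \<pi> ` {..<n}"
  define K where "K = insert 0 ((Suc \<circ> snd) ` Poly_Mapping.keys m)"
  have K: "finite K" "0 \<in> K" "\<And>i j. (i, j) \<in> Poly_Mapping.keys m \<Longrightarrow> Suc j \<in> K"
    by (force simp: K_def)+
  define e where "e C c = (if c = 0 then 1 else if cycle_weight d u C = 0 then of_nat d else (0 :: rat))"
    for C and c :: nat
  have "coeff_ms (power_sum_part (weight0_cycle_type d n u) (one_then_copies d i)) m
      = (\<Sum>g\<in>?O \<rightarrow>\<^sub>E K. if (\<Sum>C\<in>?O. colour_mon i (g C) (card C)) = m then \<Prod>C\<in>?O. e C (g C) else 0)"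
    unfolding power_sum_part_weight0[OF u] \<pi>_def[symmetric]
  proof (rule coeff_ms_coloured_prod)
    fix C and p :: "nat \<times> nat \<Rightarrow>\<^sub>0 nat" assume C: "C \<in> ?O" and p: "Poly_Mapping.keys p \<subseteq> Poly_Mapping.keys m"
    have cC: "card C > 0" using finite_in_orbits[OF \<pi> C] orbits_ne[OF \<pi> C] by (simp add: card_gt_0_iff)
    show "coeff_ms (if cycle_weight d u C = 0 then power_sum (card C) (one_then_copies d i) else 1) p
        = (\<Sum>c\<in>K. if colour_mon i c (card C) = p then e C c else 0)"
    proof (cases "cycle_weight d u C = 0")
      case True
      have "coeff_ms (power_sum (card C) (one_then_copies d i)) p
          = (\<Sum>c\<in>K. if colour_mon i c (card C) = p then (if c = 0 then 1 else of_nat d) else 0)"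
        by (rule coeff_ms_power_sum[OF cC d K(1,2)]) (use K(3) p in blast)
      thus ?thesis using True by (simp add: e_def cong: if_cong)
    next
      case False
      \<comment> \<open>A cycle of nonzero weight acts as the factor 1, which is the term of colour
        0 alone.\<close>
      have "(\<Sum>c\<in>K. if colour_mon i c (card C) = p then e C c else 0) = (\<Sum>c\<in>{0 :: nat}. if (0 :: nat \<times> nat \<Rightarrow>\<^sub>0 nat) = p then 1 else 0)"
        by (rule sum.mono_neutral_cong_right) (use K False in \<open>auto simp: e_def colour_mon_def\<close>)
      thus ?thesis using False by (auto simp: coeff_ms_one)
    qed
  qed (use K in auto)
  also have "\<dots> = (\<Sum>f\<in>{f \<in> {..<n} \<rightarrow>\<^sub>E K. fixes_word {..<n} \<pi> f}.
      if (\<Sum>x<n. colour_mon i (f x) 1) = m then word_weight d n u f else 0)"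
  \<comment> \<open>Colourings of the cycles correspond to words constant on cycles;
    \<open>Min C\<close> serves as the representative at which the colour of \<open>C\<close> is
    read off.\<close>
  proof (rule sum.reindex_bij_witness[of _ "\<lambda>f. \<lambda>C\<in>?O. f (Min C)" "\<lambda>g. \<lambda>x\<in>{..<n}. g (orbit \<pi> x)"], goal_cases)
    case (1 g)
    have "g (orbit \<pi> (Min C)) = g C" "Min C < n" if C: "C \<in> ?O" for C
    proof -
      have M: "Min C \<in> C" using finite_in_orbits[OF \<pi> C] orbits_ne[OF \<pi> C] by (rule Min_in)
      thus "g (orbit \<pi> (Min C)) = g C" using C orbit_eq[OF \<pi>, of "Min C"] by auto
      show "Min C < n" using M C orbit_sub[OF \<pi>] by blast
    qed
    thus ?case using 1 by (auto simp: fun_eq_iff PiE_def extensional_def)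
  next
    case (2 g)
    have "orbit \<pi> (\<pi> x) = orbit \<pi> x" for x
      by (rule orbit_eq[OF \<pi>]) (rule orbit.base)
    moreover have "\<pi> x < n" if "x < n" for x using permutes_in_image[OF \<pi>, of x] that by simp
    ultimately show ?case using 2 by (auto simp: fixes_word_def PiE_def Pi_def)
  next
    case (3 f)
    have "f (Min (orbit \<pi> x)) = f x" if x: "x < n" for x
    proof -
      have "Min (orbit \<pi> x) \<in> orbit \<pi> x"
        using finite_in_orbits[OF \<pi>] orbits_ne[OF \<pi>] x by (intro Min_in) blast+
      thus ?thesis using fixed_word_orbit[OF \<pi> _ x] 3 by blast
    qed
    thus ?case using 3 by (auto simp: fun_eq_iff PiE_def extensional_def)
  next
    case (4 f)
    have "Min C < n" if C: "C \<in> ?O" for C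
    proof -
      have "Min C \<in> C" using finite_in_orbits[OF \<pi> C] orbits_ne[OF \<pi> C] by (rule Min_in)
      thus ?thesis using C orbit_sub[OF \<pi>] by blast
    qed
    thus ?case using 4 by (auto simp: PiE_def Pi_def)
  next
    case (5 g)
    let ?f = "\<lambda>x\<in>{..<n}. g (orbit \<pi> x)"
    have fC: "?f x = g C" if "C \<in> ?O" "x \<in> C" for x C
      using that orbit_sub[OF \<pi>] orbit_eq[OF \<pi>, of x] by auto
    have "(\<Sum>x<n. colour_mon i (?f x) 1) = (\<Sum>C\<in>?O. \<Sum>x\<in>C. colour_mon i (?f x) 1)"
      by (rule sum_orbits[OF \<pi>, symmetric])
    also have "\<dots> = (\<Sum>C\<in>?O. colour_mon i (g C) (card C))"
    proof (rule sum.cong[OF refl])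
      fix C assume C: "C \<in> ?O"
      have "(\<Sum>x\<in>C. colour_mon i (?f x) 1) = (\<Sum>x\<in>C. colour_mon i (g C) 1)"
        by (rule sum.cong) (use fC[OF C] in auto)
      also have "\<dots> = colour_mon i (g C) (card C)"
        by (rule poly_mapping_eqI) (auto simp: lookup_sum lookup_colour_mon)
      finally show "(\<Sum>x\<in>C. colour_mon i (?f x) 1) = colour_mon i (g C) (card C)" .
    qed
    finally have cm: "(\<Sum>x<n. colour_mon i (?f x) 1) = (\<Sum>C\<in>?O. colour_mon i (g C) (card C))" .
    have "word_weight d n u ?f = (\<Prod>C\<in>?O. e C (g C))"
      unfolding word_weight_def \<pi>_def[symmetric]
    proof (rule prod.cong[OF refl])
      fix C assume C: "C \<in> ?O"
      have "(\<forall>x\<in>C. ?f x = 0) \<longleftrightarrow> g C = 0" using fC[OF C] orbits_ne[OF \<pi> C] by auto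
      thus "(if \<forall>x\<in>C. ?f x = 0 then 1 else if cycle_weight d u C = 0 then of_nat d else 0) = e C (g C)"
        by (simp add: e_def)
    qed
    thus ?case using cm by simp
  qed
  also have "\<dots> = (\<Sum>f\<in>{f \<in> {f \<in> {..<n} \<rightarrow>\<^sub>E K. fixes_word {..<n} \<pi> f}. (\<Sum>x<n. colour_mon i (f x) 1) = m}. word_weight d n u f)"
    using K(1) by (intro sum.inter_filter[symmetric]) (simp add: finite_PiE)
  also have "\<dots> = (if fst ` Poly_Mapping.keys m \<subseteq> {i} \<and> sum_mset (row_type i m) \<le> n
       then weighted_fixed_words d n (colours n i m) u else 0)"
  proof (cases "fst ` Poly_Mapping.keys m \<subseteq> {i} \<and> sum_mset (row_type i m) \<le> n")
    case False
    have "{f \<in> {f \<in> {..<n} \<rightarrow>\<^sub>E K. fixes_word {..<n} \<pi> f}. (\<Sum>x<n. colour_mon i (f x) 1) = m} = {}"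
    proof (rule ccontr)
      assume "\<not> ?thesis"
      then obtain f where f: "f \<in> {..<n} \<rightarrow>\<^sub>E K" "(\<Sum>x<n. colour_mon i (f x) 1) = m" by blast
      hence "f \<in> {..<n} \<rightarrow>\<^sub>E UNIV" by auto
      thus False using content_eq_iff[of f n i m] f(2) False by blast
    qed
    thus ?thesis unfolding if_not_P[OF False] by (simp only: sum.empty)
  next
    case True
    have "{f \<in> {f \<in> {..<n} \<rightarrow>\<^sub>E K. fixes_word {..<n} \<pi> f}. (\<Sum>x<n. colour_mon i (f x) 1) = m}
        = {f. f \<in> words {..<n} (colours n i m) \<and> fixes_word {..<n} \<pi> f}"
    proof (rule Set.set_eqI)
      fix f
      have "f \<in> {..<n} \<rightarrow>\<^sub>E K" if f: "f \<in> words {..<n} (colours n i m)"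
      proof -
        have "f x \<in> K" if "x < n" for x
        proof (cases "f x")
          case (Suc j)
          have "f x \<in># colours n i m" using words_range[OF _ f] that by simp
          hence "(i, j) \<in> Poly_Mapping.keys m"
            by (simp add: Suc in_keys_iff count_colours_Suc flip: count_greater_zero_iff)
          thus ?thesis using K(3) Suc by simp
        qed (use K in simp)
        thus ?thesis using f by (auto simp: words_def PiE_def)
      qed
      moreover have "f \<in> {..<n} \<rightarrow>\<^sub>E UNIV" if "f \<in> {..<n} \<rightarrow>\<^sub>E K" using that by auto
      ultimately show "f \<in> {f \<in> {f \<in> {..<n} \<rightarrow>\<^sub>E K. fixes_word {..<n} \<pi> f}. (\<Sum>x<n. colour_mon i (f x) 1) = m}
          \<longleftrightarrow> f \<in> {f. f \<in> words {..<n} (colours n i m) \<and> fixes_word {..<n} \<pi> f}"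
        using content_eq_iff[of f n i m] True unfolding mem_Collect_eq by blast
    qed
    thus ?thesis unfolding if_P[OF True] weighted_fixed_words_def \<pi>_def by (rule sum.cong) (rule refl)
  qed
  finally show ?thesis .
qed

lemma in_row_power_sum_part:
  assumes "d > 0" "u \<in> carrier (Gd1n d n)"
  shows "in_row i (power_sum_part (weight0_cycle_type d n u) (one_then_copies d i))"
  unfolding in_row_def coeff_ms_power_sum_part[OF assms] by auto

text \<open>The weighted count is a coefficient of a series that depends only on the weight-zero
  cycle type. Passing to \<open>row_mon i m\<close> gives a monomial in the i-th set of variables
  alone, as the coefficient formula demands.\<close>

lemma weighted_fixed_words_conj:
  assumes d: "d > 0" and deg: "sum_mset (row_type i m) \<le> n"
    and x: "x \<in> carrier (Gd1n d n)" and u: "u \<in> carrier (Gd1n d n)"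
  shows "weighted_fixed_words d n (colours n i m) (x \<otimes>\<^bsub>Gd1n d n\<^esub> u \<otimes>\<^bsub>Gd1n d n\<^esub> inv\<^bsub>Gd1n d n\<^esub> x)
    = weighted_fixed_words d n (colours n i m) u"
proof -
  interpret group "Gd1n d n" by (rule group_Gd1n) (use d in simp)
  have w: "weighted_fixed_words d n (colours n i m) g
      = coeff_ms (power_sum_part (weight0_cycle_type d n g) (one_then_copies d i)) (row_mon i m)"
    if "g \<in> carrier (Gd1n d n)" for g
  proof -
    have "fst ` Poly_Mapping.keys (row_mon i m) \<subseteq> {i}" by (auto simp: keys_restrict_mon)
    thus ?thesis
      unfolding coeff_ms_power_sum_part[OF d that] row_type_row_mon colours_row_mon using deg by simp
  qed
  have "x \<otimes>\<^bsub>Gd1n d n\<^esub> u \<otimes>\<^bsub>Gd1n d n\<^esub> inv\<^bsub>Gd1n d n\<^esub> x \<in> carrier (Gd1n d n)" using x u by simp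
  thus ?thesis using w weight0_cycle_type_conj[OF d x u] u by simp
qed

text \<open>A monomial in the i-th set of variables arises from exactly one exponent vector, here
  \<open>\<alpha>0\<close>.\<close>

lemma coeff_ms_monomial_sym:
  "coeff_ms (monomial_sym \<mu> (yvars i)) m
    = (if fst ` Poly_Mapping.keys m \<subseteq> {i} \<and> row_type i m = \<mu> then 1 else 0)"
proof -
  define emb where "emb \<alpha> = (\<Sum>j\<in>Poly_Mapping.keys \<alpha>. Poly_Mapping.single (i, j) (Poly_Mapping.lookup \<alpha> j))"
    for \<alpha> :: "nat \<Rightarrow>\<^sub>0 nat"
  have emb: "Poly_Mapping.lookup (emb \<alpha>) (i', j) = (if i' = i then Poly_Mapping.lookup \<alpha> j else 0)" for \<alpha> i' j
  proof -
    have "Poly_Mapping.lookup (emb \<alpha>) (i', j)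
        = (\<Sum>j'\<in>Poly_Mapping.keys \<alpha>. if j' = j then (if i' = i then Poly_Mapping.lookup \<alpha> j else 0) else 0)"
      unfolding emb_def lookup_sum by (rule sum.cong) (auto simp: lookup_single when_def)
    thus ?thesis by (auto simp: in_keys_iff)
  qed
  let ?T = "\<lambda>\<alpha>. if exponent_type \<alpha> = \<mu> then \<Prod>j \<in> Poly_Mapping.keys \<alpha>. yvars i j ^ Poly_Mapping.lookup \<alpha> j else 0"
  have T: "coeff_ms (?T \<alpha>) m = (if exponent_type \<alpha> = \<mu> \<and> m = emb \<alpha> then 1 else 0)" for \<alpha>
  proof -
    have "coeff_ms (\<Prod>j \<in> Poly_Mapping.keys \<alpha>. yvars i j ^ Poly_Mapping.lookup \<alpha> j) m = (if m = emb \<alpha> then 1 else 0)"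
      unfolding emb_def by (rule coeff_ms_monomial_prod) (simp_all add: yvars_def coeff_ms_var_power)
    thus ?thesis by (auto simp: zero_mseries.rep_eq)
  qed
  define \<alpha>0 where "\<alpha>0 = Poly_Mapping.map_key (Pair i) m"
  have l0: "Poly_Mapping.lookup \<alpha>0 j = Poly_Mapping.lookup m (i, j)" for j
    unfolding \<alpha>0_def by (subst map_key.rep_eq) (auto simp: inj_on_def)
  have emb_eq: "m = emb \<alpha> \<longleftrightarrow> fst ` Poly_Mapping.keys m \<subseteq> {i} \<and> \<alpha> = \<alpha>0" for \<alpha>
  proof
    assume m: "m = emb \<alpha>"
    have "\<alpha> = \<alpha>0" by (rule poly_mapping_eqI) (simp add: l0 m emb)
    moreover have "fst ` Poly_Mapping.keys m \<subseteq> {i}" by (auto simp: m in_keys_iff emb split: if_splits)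
    ultimately show "fst ` Poly_Mapping.keys m \<subseteq> {i} \<and> \<alpha> = \<alpha>0" by blast
  next
    assume A: "fst ` Poly_Mapping.keys m \<subseteq> {i} \<and> \<alpha> = \<alpha>0"
    show "m = emb \<alpha>"
    proof (rule poly_mapping_eqI)
      fix v :: "nat \<times> nat"
      obtain i' j where v: "v = (i', j)" by (cases v)
      have "Poly_Mapping.lookup m (i', j) = 0" if "i' \<noteq> i" using A that by (force simp: in_keys_iff)
      thus "Poly_Mapping.lookup m v = Poly_Mapping.lookup (emb \<alpha>) v" using A by (auto simp: v emb l0)
    qed
  qed
  have "row_keys i m = Pair i ` Poly_Mapping.keys \<alpha>0"
    by (auto simp: row_keys_def in_keys_iff l0 image_iff)
  hence "mset_set (row_keys i m) = image_mset (Pair i) (mset_set (Poly_Mapping.keys \<alpha>0))"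
    by (simp add: image_mset_mset_set inj_on_def)
  hence type: "row_type i m = exponent_type \<alpha>0"
    by (simp add: row_type_def exponent_type_def multiset.map_comp comp_def l0[symmetric])
  have "coeff_ms (monomial_sym \<mu> (yvars i)) m = (\<Sum>\<alpha>\<in>{\<alpha>0}. coeff_ms (?T \<alpha>) m)"
    unfolding monomial_sym_def by (rule coeff_ms_sum_ms) (auto simp: T emb_eq)
  thus ?thesis by (simp add: T emb_eq type conj_commute)
qed

lemma in_row_monomial_sym: "in_row i (monomial_sym \<mu> (yvars i))"
  unfolding in_row_def coeff_ms_monomial_sym by auto

lemma weight0_cycle_type_in_partitions:
  assumes "u \<in> carrier (Gd1n d n)"
  shows "weight0_cycle_type d n u \<in> partitions_upto n"
proof -
  have \<pi>: "fst u permutes {..<n}" using assms by (auto simp: Gd1n_simps)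
  let ?O = "orbit (fst u) ` {..<n}"
  have "sum_mset (weight0_cycle_type d n u) = (\<Sum>C\<in>{C \<in> ?O. cycle_weight d u C = 0}. card C)"
    by (simp add: weight0_cycle_type_def sum_unfold_sum_mset)
  also have "\<dots> \<le> (\<Sum>C\<in>?O. card C)" by (rule sum_mono2) auto
  also have "\<dots> = n" using sum_orbits[OF \<pi>, of "\<lambda>_. 1 :: nat"] by simp
  finally show ?thesis
    using finite_in_orbits[OF \<pi>] orbits_ne[OF \<pi>]
    by (auto simp: partitions_upto_def weight0_cycle_type_def card_eq_0_iff)
qed

section \<open>Comparison of coefficients\<close>

lemma sum_num_factorizations:
  fixes X :: "nat multiset list \<Rightarrow> rat"
  shows "(\<Sum>lams \<in> {lams. length lams = k \<and> set lams \<subseteq> partitions_upto n}.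
            of_nat (num_factorizations d n c lams) * X lams)
       = (\<Sum>us \<in> {us. length us = k \<and> set us \<subseteq> carrier (Gd1n d n) \<and>
             foldr (mult (Gd1n d n)) us (one (Gd1n d n)) = c}. X (map (weight0_cycle_type d n) us))"
proof -
  let ?L = "{lams. length lams = k \<and> set lams \<subseteq> partitions_upto n}"
  let ?U = "{us. length us = k \<and> set us \<subseteq> carrier (Gd1n d n) \<and>
             foldr (mult (Gd1n d n)) us (one (Gd1n d n)) = c}"
  have finL: "finite ?L"
    using finite_lists_length_eq[OF finite_partitions_upto, of n k] by (simp add: conj_commute)
  have finU: "finite ?U"
    by (rule finite_subset[OF _ finite_lists_length_eq[OF finite_carrier_Gd1n, of d n k]]) auto
  have im: "map (weight0_cycle_type d n) ` ?U \<subseteq> ?L"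
  proof
    fix lams assume "lams \<in> map (weight0_cycle_type d n) ` ?U"
    then obtain us where us: "length us = k" "set us \<subseteq> carrier (Gd1n d n)"
      "lams = map (weight0_cycle_type d n) us" by blast
    have "weight0_cycle_type d n ` set us \<subseteq> partitions_upto n"
      using us(2) weight0_cycle_type_in_partitions by blast
    thus "lams \<in> ?L" using us by simp
  qed
  have "(\<Sum>us\<in>?U. X (map (weight0_cycle_type d n) us))
      = (\<Sum>lams\<in>?L. \<Sum>us\<in>{us \<in> ?U. map (weight0_cycle_type d n) us = lams}. X (map (weight0_cycle_type d n) us))"
    by (rule sum.group[OF finU finL im, symmetric])
  also have "\<dots> = (\<Sum>lams\<in>?L. of_nat (num_factorizations d n c lams) * X lams)"
  proof (rule sum.cong[OF refl])
    fix lams assume l: "lams \<in> ?L"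
    have e: "{us \<in> ?U. map (weight0_cycle_type d n) us = lams}
        = {us. length us = length lams \<and> set us \<subseteq> carrier (Gd1n d n) \<and>
               foldr (mult (Gd1n d n)) us (one (Gd1n d n)) = c \<and>
               (\<forall>i < length lams. weight0_cycle_type d n (us ! i) = lams ! i)}"
      using l by (auto simp: list_eq_iff_nth_eq)
    have "(\<Sum>us\<in>{us \<in> ?U. map (weight0_cycle_type d n) us = lams}. X (map (weight0_cycle_type d n) us))
        = (\<Sum>us\<in>{us \<in> ?U. map (weight0_cycle_type d n) us = lams}. X lams)"
      by (rule sum.cong) auto
    also have "\<dots> = of_nat (num_factorizations d n c lams) * X lams"
      unfolding num_factorizations_def e sum_constant ..
    finally show "(\<Sum>us\<in>{us \<in> ?U. map (weight0_cycle_type d n) us = lams}. X (map (weight0_cycle_type d n) us))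
        = of_nat (num_factorizations d n c lams) * X lams" .
  qed
  finally show ?thesis ..
qed

theorem theorem7p2:
  fixes d n k :: nat and c :: gelem
  assumes "d \<ge> 2" and "n \<ge> 1" and "k \<ge> 1"
    and "coxeter_element d n c"
  shows "(\<Sum>lams \<in> {lams. length lams = k \<and> set lams \<subseteq> partitions_upto n}.
            of_nat (num_factorizations d n c lams) *
            (\<Prod>i<k. power_sum_part (lams ! i) (one_then_copies d i)))
       = of_nat (order (Gd1n d n) ^ (k - 1)) *
         (\<Sum>mus \<in> {mus. length mus = k \<and> set mus \<subseteq> partitions_upto n \<and>
                           \<not> (\<forall>\<mu> \<in> set mus. sum_mset \<mu> = n)}.
            const_ms (of_int (Mcoeff (n - 1) (map (\<lambda>\<mu>. int (qindex n \<mu>) - 1) mus)) /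
                      (\<Prod>i<k. of_nat ((n - 1) choose (qindex n (mus ! i) - 1)))) *
            (\<Prod>i<k. monomial_sym (mus ! i) (yvars i)))"
  (is "?LHS = of_nat _ * (\<Sum>mus\<in>?M. const_ms (?v mus) * _)")
proof (rule mseries_eqI)
  fix m :: "nat \<times> nat \<Rightarrow>\<^sub>0 nat"
  let ?G = "Gd1n d n"
  have d: "d > 0" and n: "n > 0" using assms by auto
  interpret group ?G by (rule group_Gd1n) (use d in simp)
  note c = coxeter_element_properties[OF assms(1,2,4)]
  let ?row = "fst ` Poly_Mapping.keys m \<subseteq> {..<k}"
  let ?deg = "\<lambda>i. sum_mset (row_type i m)"
  define As where "As = map (\<lambda>i. colours n i m) [0..<k]"
  \<comment> \<open>The only tuple of partitions on the right-hand side whose product of monomial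
    symmetric functions can contain \<open>m\<close>.\<close>
  define mus0 where "mus0 = map (\<lambda>i. row_type i m) [0..<k]"
  have rowi: "fst ` Poly_Mapping.keys (row_mon i m) \<subseteq> {i}" for i by (auto simp: keys_restrict_mon)
  have finL: "finite {us. length us = k \<and> set us \<subseteq> carrier ?G}"
    using finite_lists_length_eq[OF finite_carrier_Gd1n, of d n k] by (simp add: conj_commute)
  have psp: "coeff_ms (\<Prod>i<k. power_sum_part (map (weight0_cycle_type d n) us ! i) (one_then_copies d i)) m
      = (if ?row then \<Prod>i<k. if ?deg i \<le> n then weighted_fixed_words d n (colours n i m) (us ! i) else 0 else 0)"
    if us: "length us = k" "set us \<subseteq> carrier ?G" for us
  proof -
    have u: "us ! i \<in> carrier ?G" if "i < k" for i using us that by auto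
    have "coeff_ms (\<Prod>i<k. power_sum_part (map (weight0_cycle_type d n) us ! i) (one_then_copies d i)) m
        = coeff_ms (\<Prod>i<k. power_sum_part (weight0_cycle_type d n (us ! i)) (one_then_copies d i)) m"
      using us by simp
    also have "\<dots> = (if ?row then \<Prod>i<k. coeff_ms (power_sum_part (weight0_cycle_type d n (us ! i)) (one_then_copies d i)) (row_mon i m) else 0)"
      by (rule coeff_ms_prod_rows) (use u in_row_power_sum_part[OF d] in simp)
    also have "\<dots> = (if ?row then \<Prod>i<k. if ?deg i \<le> n then weighted_fixed_words d n (colours n i m) (us ! i) else 0 else 0)"
      by (intro if_cong refl prod.cong) (simp add: coeff_ms_power_sum_part[OF d u] rowi row_type_row_mon colours_row_mon)
    finally show ?thesis .
  qed
  have "coeff_ms ?LHS m = (\<Sum>lams \<in> {lams. length lams = k \<and> set lams \<subseteq> partitions_upto n}.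
      of_nat (num_factorizations d n c lams) *
      coeff_ms (\<Prod>i<k. power_sum_part (lams ! i) (one_then_copies d i)) m)"
    by (simp add: coeff_ms_sum coeff_ms_of_nat_mult)
  also have "\<dots> = (\<Sum>us \<in> {us. length us = k \<and> set us \<subseteq> carrier ?G \<and> foldr (mult ?G) us (one ?G) = c}.
      coeff_ms (\<Prod>i<k. power_sum_part (map (weight0_cycle_type d n) us ! i) (one_then_copies d i)) m)"
    by (rule sum_num_factorizations)
  also have "\<dots> = (if ?row \<and> (\<forall>i<k. ?deg i \<le> n)
      then conv_sum ?G (map (weighted_fixed_words d n) As) (\<lambda>g. if g = c then 1 else 0) else 0)"
  proof (cases "?row \<and> (\<forall>i<k. ?deg i \<le> n)")
    case True
    have "conv_sum ?G (map (weighted_fixed_words d n) As) (\<lambda>g. if g = c then 1 else 0)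
        = (\<Sum>us \<in> {us. length us = k \<and> set us \<subseteq> carrier ?G}.
            if foldr (mult ?G) us (one ?G) = c then \<Prod>i<k. weighted_fixed_words d n (colours n i m) (us ! i) else 0)"
      unfolding conv_sum_lists[OF finite_carrier_Gd1n] by (intro sum.cong) (simp_all add: As_def)
    also have "\<dots> = (\<Sum>us \<in> {us \<in> {us. length us = k \<and> set us \<subseteq> carrier ?G}. foldr (mult ?G) us (one ?G) = c}.
        \<Prod>i<k. weighted_fixed_words d n (colours n i m) (us ! i))"
      by (rule sum.inter_filter[OF finL, symmetric])
    also have "\<dots> = (\<Sum>us \<in> {us. length us = k \<and> set us \<subseteq> carrier ?G \<and> foldr (mult ?G) us (one ?G) = c}.
      coeff_ms (\<Prod>i<k. power_sum_part (map (weight0_cycle_type d n) us ! i) (one_then_copies d i)) m)"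
    proof (rule sum.cong)
      fix us assume "us \<in> {us. length us = k \<and> set us \<subseteq> carrier ?G \<and> foldr (mult ?G) us (one ?G) = c}"
      hence us: "length us = k" "set us \<subseteq> carrier ?G" by auto
      show "(\<Prod>i<k. weighted_fixed_words d n (colours n i m) (us ! i))
        = coeff_ms (\<Prod>i<k. power_sum_part (map (weight0_cycle_type d n) us ! i) (one_then_copies d i)) m"
        unfolding psp[OF us] using True by simp
    qed auto
    finally show ?thesis using True by simp
  next
    case False
    have "coeff_ms (\<Prod>i<k. power_sum_part (map (weight0_cycle_type d n) us ! i) (one_then_copies d i)) m = 0"
      if "length us = k" "set us \<subseteq> carrier ?G" for us
      unfolding psp[OF that] using False by (auto intro!: prod_zero)
    thus ?thesis unfolding if_not_P[OF False] by (intro sum.neutral) blast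
  qed
  finally have L: "coeff_ms ?LHS m = (if ?row \<and> (\<forall>i<k. ?deg i \<le> n)
      then conv_sum ?G (map (weighted_fixed_words d n) As) (\<lambda>g. if g = c then 1 else 0) else 0)" .

  have finM: "finite ?M"
    by (rule finite_subset[OF _ finite_lists_length_eq[OF finite_partitions_upto, of n k]]) auto
  have msym: "coeff_ms (\<Prod>i<k. monomial_sym (mus ! i) (yvars i)) m = (if ?row \<and> mus = mus0 then 1 else 0)"
    if len: "length mus = k" for mus
  proof -
    have "coeff_ms (\<Prod>i<k. monomial_sym (mus ! i) (yvars i)) m
        = (if ?row then \<Prod>i<k. coeff_ms (monomial_sym (mus ! i) (yvars i)) (row_mon i m) else 0)"
      by (rule coeff_ms_prod_rows) (rule in_row_monomial_sym)
    also have "(\<Prod>i<k. coeff_ms (monomial_sym (mus ! i) (yvars i)) (row_mon i m)) = (\<Prod>i<k. if row_type i m = mus ! i then 1 else 0)"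
      by (simp add: coeff_ms_monomial_sym rowi row_type_row_mon)
    also have "\<dots> = (if mus = mus0 then 1 else 0)"
    proof (cases "mus = mus0")
      case True thus ?thesis by (simp add: mus0_def)
    next
      case False
      then obtain i where "i < k" "row_type i m \<noteq> mus ! i"
        using len by (auto simp: mus0_def list_eq_iff_nth_eq)
      hence "(\<Prod>i<k. if row_type i m = mus ! i then 1 else 0) = (0 :: rat)" by (intro prod_zero) auto
      thus ?thesis using False by simp
    qed
    finally show ?thesis by simp
  qed
  have "coeff_ms (\<Sum>mus\<in>?M. const_ms (?v mus) * (\<Prod>i<k. monomial_sym (mus ! i) (yvars i))) m
      = (\<Sum>mus\<in>?M. if mus = mus0 then (if ?row then ?v mus else 0) else 0)"
    unfolding coeff_ms_sum coeff_ms_const_mult by (intro sum.cong refl) (auto simp: msym)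
  also have "\<dots> = (if mus0 \<in> ?M then (if ?row then ?v mus0 else 0) else 0)"
    by (rule sum.delta[OF finM])
  finally have R: "coeff_ms (of_nat (order ?G ^ (k - 1)) *
        (\<Sum>mus\<in>?M. const_ms (?v mus) * (\<Prod>i<k. monomial_sym (mus ! i) (yvars i)))) m
      = of_nat (order ?G ^ (k - 1)) * (if mus0 \<in> ?M then (if ?row then ?v mus0 else 0) else 0)"
    by (simp only: coeff_ms_of_nat_mult)
  have mus0M: "mus0 \<in> ?M \<longleftrightarrow> (\<forall>i<k. ?deg i \<le> n) \<and> (\<exists>i<k. ?deg i \<noteq> n)"
  proof -
    have "row_type i m \<in> partitions_upto n \<longleftrightarrow> ?deg i \<le> n" for i
      using row_type_in_partitions by (auto simp: partitions_upto_def)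
    thus ?thesis by (auto simp: mus0_def image_subset_iff)
  qed

  have main: "conv_sum ?G (map (weighted_fixed_words d n) As) (\<lambda>g. if g = c then 1 else 0)
      = of_nat (order ?G ^ (k - 1)) * (if mus0 \<in> ?M then ?v mus0 else 0)"
    if deg: "\<forall>i<k. ?deg i \<le> n"
  proof (cases "\<exists>i<k. ?deg i \<noteq> n")
    case False
    \<comment> \<open>All rows have full degree, so colour 0 is absent everywhere: the left-hand
      side vanishes because \<open>c\<close> has nonzero weight, and the right-hand side excludes
      this tuple.\<close>
    have "0 \<notin># A" if "A \<in> set As" for A
      using that False by (auto simp: As_def set_colours)
    hence "conv_sum ?G (map (weighted_fixed_words d n) As) (\<lambda>g. if g = c then 1 else 0) = 0"
      by (intro conv_sum_weight_0[OF d _ c(3)])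
    moreover have "mus0 \<notin> ?M" using False unfolding mus0M by blast
    ultimately show ?thesis by (simp only: if_False mult_zero_right)
  next
    case True
    then obtain i where i: "i < k" "?deg i < n" using deg le_neq_implies_less by blast
    have "colours n i m \<in> set As" "0 \<in># colours n i m" using i by (auto simp: As_def set_colours)
    hence ex0: "\<exists>A\<in>set As. 0 \<in># A" by blast
    define ps where "ps = map (\<lambda>i. qindex n (row_type i m) - 1) [0..<k]"
    \<comment> \<open>These bounds make the truncated \<open>q - 1\<close> agree with the integer
      index of the statement and place it between 0 and \<open>n - 1\<close>. In full degree the
      lower bound holds because \<open>n > 0\<close> forces a part.\<close>
    have q: "qindex n (row_type i m) \<ge> 1 \<and> qindex n (row_type i m) \<le> n" if "i < k" for i
    proof -
      have D: "?deg i \<le> n" using deg that by blast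
      have "size M \<le> sum_mset M" if "0 \<notin># M" for M :: "nat multiset"
        using that by (induction M) auto
      hence "size (row_type i m) \<le> ?deg i"
        using row_type_in_partitions[OF D] by (simp add: partitions_upto_def)
      moreover have "size (row_type i m) \<ge> 1" if "?deg i = n"
        using that n by (cases "row_type i m = {#}") (auto simp: Suc_le_eq nonempty_has_size)
      ultimately show ?thesis using D by (auto simp: qindex_def)
    qed
    have sz: "size A = n" if "A \<in> set As" for A
      using that deg by (auto simp: As_def size_colours)
    have "conv_sum ?G (map (weighted_fixed_words d n) As) (\<lambda>g. if g = c then 1 else 0)
        = of_nat (order ?G ^ (length As - 1)) * hook_sum n (map (\<lambda>A. card (set_mset A)) As)"
    proof (rule conv_sum_single_cycle_element[OF d n _ sz ex0 _ c(1,2)])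
      show "As \<noteq> []" using assms(3) by (simp add: As_def)
      fix A x g assume "A \<in> set As" and xg: "x \<in> carrier ?G" "g \<in> carrier ?G"
      then obtain i where "i < k" "A = colours n i m" by (auto simp: As_def)
      thus "weighted_fixed_words d n A (x \<otimes>\<^bsub>?G\<^esub> g \<otimes>\<^bsub>?G\<^esub> inv\<^bsub>?G\<^esub> x) = weighted_fixed_words d n A g"
        using weighted_fixed_words_conj[OF d _ xg] deg by simp
    qed
    also have "map (\<lambda>A. card (set_mset A)) As = map Suc ps"
    proof -
      have "qindex n (row_type i m) = Suc (qindex n (row_type i m) - 1)" if "i < k" for i
        using q[OF that] by simp
      thus ?thesis using deg by (auto simp: As_def ps_def card_set_colours)
    qed
    also have "hook_sum n (map Suc ps) = ?v mus0"
    proof -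
      have "of_int (Mcoeff (n - 1) (map int ps)) / (\<Prod>i<length ps. of_nat ((n - 1) choose (ps ! i)))
          = hook_sum (Suc (n - 1)) (map Suc ps)"
      proof (rule Mcoeff_eq_hook_sum)
        fix p assume "p \<in> set ps"
        then obtain i where "i < k" "p = qindex n (row_type i m) - 1" by (auto simp: ps_def)
        thus "p \<le> n - 1" using q[of i] by auto
      qed
      moreover have "map int ps = map (\<lambda>\<mu>. int (qindex n \<mu>) - 1) mus0"
      proof -
        have "int (qindex n (row_type i m) - 1) = int (qindex n (row_type i m)) - 1" if "i < k" for i
          using q[OF that] by simp
        thus ?thesis by (auto simp: ps_def mus0_def)
      qed
      moreover have "(\<Prod>i<length ps. of_nat ((n - 1) choose (ps ! i)) :: rat)
          = (\<Prod>i<k. of_nat ((n - 1) choose (qindex n (mus0 ! i) - 1)))"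
        by (rule prod.cong) (auto simp: ps_def mus0_def)
      ultimately show ?thesis using n by simp
    qed
    also have "length As = k" by (simp add: As_def)
    finally show ?thesis using mus0M True deg by simp
  qed
  show "coeff_ms ?LHS m = coeff_ms (of_nat (order ?G ^ (k - 1)) *
        (\<Sum>mus\<in>?M. const_ms (?v mus) * (\<Prod>i<k. monomial_sym (mus ! i) (yvars i)))) m"
  proof (cases "?row \<and> (\<forall>i<k. ?deg i \<le> n)")
    case True
    have "coeff_ms ?LHS m = of_nat (order ?G ^ (k - 1)) * (if mus0 \<in> ?M then ?v mus0 else 0)"
      unfolding L if_P[OF True] by (rule main) (use True in blast)
    thus ?thesis unfolding R if_P[OF conjunct1[OF True]] .
  next
    case False
    hence "(if mus0 \<in> ?M then (if ?row then ?v mus0 else 0) else 0) = 0"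
      using mus0M by auto
    thus ?thesis unfolding L R if_not_P[OF False] by (simp only: mult_zero_right)
  qed
qed

end
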